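(* Let $d$ be odd, let $k\ge 1$ with $d-2k\ge 3$, and put $\delta=\frac{d-1}{2}$. Let $L=BW_d$, let $t\in G_d$ be an involution of defect $k$ with positive trace on $\mathbb Q\otimes L$, and let $f\in R_d$ be a fourvolution commuting with $t$. For $\varepsilon\in\{+,-\}$ set $M_\varepsilon=L^\varepsilon(t)+P^\varepsilon(L)(f-1)$. Then: (i) the minimum norm of $M_\varepsilon$ is $2^{\delta-1}$; (ii) a vector $v\in M_\varepsilon$ is a minimal vector of $M_\varepsilon$ if and only if $v(f-1)$ is a minimal vector of $L^\varepsilon(t)$ (equivalently, $v(f-1)$ is a minimal vector of $BW_d$ lying in $L^\varepsilon(t)$); (iii) the minimal vectors of $M_\varepsilon$ lie in $M_\varepsilon\setminus L^\varepsilon(t)$.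
   Context: Let $\Omega=\mathbb F_2^d$ (affine space); $RM(k,d)$ is the Reed–Muller code spanned (in the power set of $\Omega$ under symmetric difference) by affine subspaces of codimension at most $k$. $V=\mathbb R^\Omega$ has basis $v_i$ with $(v_i,v_j)=2^{\lfloor d/2\rfloor}\delta_{ij}$, $v_A=\sum_{i\in A}v_i$; $\varepsilon_S$ negates $v_i$ for $i\in S$ and fixes the others; $\tau_c:v_i\mapsto v_{i+c}$. $BW_d$ is the $\mathbb Z$-span of all $2^{-m}v_A\varepsilon_S$, $m\ge 0$, $A$ affine of dimension $2m$, $S\in RM(2,d)$; its minimum norm is $2^{\lfloor d/2\rfloor}$. $R_d$ is the extraspecial group of order $2^{1+2d}$ generated by the $\varepsilon_S$ ($S\in RM(1,d)$) and the $\tau_c$. $G_d$ is the Bolt–Room–Wall group, a subgroup of $O(BW_d)$ of shape $2^{1+2d}_+.\Omega^+(2d,2)$ with largest normal 2-subgroup $R_d$. A fourvolution is an isometry $f$ with $f^2=-1$. The defect of an involution $t\in G_d$ is $d-e$ where $2e$ is the dimension of the fixed space of conjugation by $t$ on $R_d/Z(R_d)\cong\mathbb F_2^{2d}$. $L^\varepsilon(t)=\{x\in L:xt=\varepsilon x\}$ and $P^\varepsilon$ is the orthogonal projection of $\mathbb Q\otimes L$ onto $\mathbb Q\otimes L^\varepsilon(t)$. *)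

theory Defs
  imports "HOL-Analysis.Analysis" "HOL-Algebra.Algebra" "HOL-Library.Z2"
begin

text \<open>
  The dimension \<open>d\<close> is \<^term>\<open>CARD('n)\<close>: the affine space \<open>\<Omega>\<close> is \<^typ>\<open>bit ^ 'n\<close>, and
  \<open>V = \<real>\<^sup>\<Omega>\<close> is \<^typ>\<open>real ^ (bit ^ 'n)\<close>, with \<^term>\<open>axis i 1\<close> for the basis vector \<open>v\<^sub>i\<close>.
\<close>

instance bit :: finite
proof
  have "(UNIV :: bit set) \<subseteq> {0, 1}"
    by auto
  then show "finite (UNIV :: bit set)"
    by (rule finite_subset) simp
qed

type_synonym 'n omega = "bit ^ 'n"
type_synonym 'n ambient = "real ^ (bit ^ 'n)"


section \<open>Reed--Muller codes\<close>

definition affine_of_dim :: "nat \<Rightarrow> 'n::finite omega set \<Rightarrow> bool" where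
  "affine_of_dim m A \<longleftrightarrow>
     (\<exists>a W. vec.subspace W \<and> vec.dim W = m \<and> A = (\<lambda>w. a + w) ` W)"

text \<open>
  The span over the field of two elements, inside the power set of \<open>\<Omega>\<close> under symmetric
  difference, of the affine subspaces of codimension at most \<open>k\<close>.
\<close>

inductive_set RM :: "nat \<Rightarrow> 'n::finite omega set set" for k :: nat where
  empty: "{} \<in> RM k"
| add: "S \<in> RM k \<Longrightarrow> affine_of_dim m A \<Longrightarrow> CARD('n) \<le> m + k \<Longrightarrow> sym_diff S A \<in> RM k"
    for A :: "'n::finite omega set"


section \<open>Barnes--Wall lattices\<close>

definition bw_inner :: "'n::finite ambient \<Rightarrow> 'n ambient \<Rightarrow> real" where
  "bw_inner x y = 2 ^ (CARD('n) div 2) * (x \<bullet> y)"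

definition vsum :: "'n::finite omega set \<Rightarrow> 'n ambient" where
  "vsum A = (\<Sum>i\<in>A. axis i 1)"

definition sign_change :: "'n::finite omega set \<Rightarrow> 'n ambient \<Rightarrow> 'n ambient" where
  "sign_change S x = (\<chi> i. if i \<in> S then - (x $ i) else x $ i)"

text \<open>The coordinate form of the linear map sending \<^term>\<open>axis i 1\<close> to \<^term>\<open>axis (i + c) 1\<close>.\<close>

definition translation :: "'n::finite omega \<Rightarrow> 'n ambient \<Rightarrow> 'n ambient" where
  "translation c x = (\<chi> i. x $ (i - c))"

definition int_span :: "'a::real_vector set \<Rightarrow> 'a set" where
  "int_span = Modules.module.span (\<lambda>n::int. scaleR (of_int n))"

definition rat_span :: "'a::real_vector set \<Rightarrow> 'a set" where
  "rat_span = Modules.module.span (\<lambda>q::rat. scaleR (of_rat q))"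

definition BW :: "'n::finite ambient set" where
  "BW = int_span {(1 / 2 ^ m) *\<^sub>R sign_change S (vsum A) | m A S.
                    affine_of_dim (2 * m) A \<and> S \<in> RM 2}"

definition has_min_norm :: "'n::finite ambient set \<Rightarrow> real \<Rightarrow> bool" where
  "has_min_norm L \<mu> \<longleftrightarrow>
     (\<exists>v \<in> L - {0}. bw_inner v v = \<mu>) \<and> (\<forall>v \<in> L - {0}. \<mu> \<le> bw_inner v v)"

definition minimal_vector :: "'n::finite ambient set \<Rightarrow> 'n ambient \<Rightarrow> bool" where
  "minimal_vector L v \<longleftrightarrow>
     v \<in> L - {0} \<and> (\<forall>w \<in> L - {0}. bw_inner v v \<le> bw_inner w w)"


section \<open>The groups\<close>

text \<open>
  Isometries act on the right, so the product of \<open>g\<close> and \<open>h\<close> is \<open>g\<close> followed by \<open>h\<close>. Being an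
  isometry for \<^const>\<open>bw_inner\<close> or for the standard inner product is the same.
\<close>

definition OV :: "('n::finite ambient \<Rightarrow> 'n ambient) monoid" where
  "OV = \<lparr>carrier = {g. orthogonal_transformation g}, mult = (\<lambda>g h. h \<circ> g), one = id\<rparr>"

text \<open>An isometry of a lattice spanning \<open>V\<close> is identified with its linear extension to \<open>V\<close>.\<close>

definition lattice_isometries ::
    "'n::finite ambient set \<Rightarrow> ('n ambient \<Rightarrow> 'n ambient) set" where
  "lattice_isometries L = {g \<in> carrier OV. g ` L = L}"

definition RR :: "('n::finite ambient \<Rightarrow> 'n ambient) set" where
  "RR = generate OV ({sign_change S | S. S \<in> RM 1} \<union> {translation c | c. True})"

text \<open>
  \<open>\<Omega>\<^sup>+(2d,2)\<close> as the derived subgroup of \<open>O\<^sup>+(2d,2)\<close>, the isometry group of the split quadratic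
  form \<open>x\<^sub>1y\<^sub>1 + \<dots> + x\<^sub>dy\<^sub>d\<close>.
\<close>

definition split_form :: "bit ^ ('n::finite + 'n) \<Rightarrow> bit" where
  "split_form x = (\<Sum>i\<in>UNIV. x $ Inl i * x $ Inr i)"

definition O_plus :: "(bit ^ ('n::finite + 'n) \<Rightarrow> bit ^ ('n + 'n)) monoid" where
  "O_plus = \<lparr>carrier = {g. Vector_Spaces.linear (*s) (*s) g \<and> bij g \<and>
                           (\<forall>x. split_form (g x) = split_form x)},
             mult = (\<lambda>g h. h \<circ> g), one = id\<rparr>"

definition Omega_plus :: "(bit ^ ('n::finite + 'n) \<Rightarrow> bit ^ ('n + 'n)) monoid" where
  "Omega_plus = O_plus\<lparr>carrier := derived O_plus (carrier O_plus)\<rparr>"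

definition normal_2_subgroup :: "'a set \<Rightarrow> 'a monoid \<Rightarrow> bool" where
  "normal_2_subgroup N G \<longleftrightarrow> N \<lhd> G \<and> (\<exists>n. card N = 2 ^ n)"

text \<open>
  \<open>G\<close> is the Bolt--Room--Wall group \<open>G\<^sub>d\<close>: a subgroup of \<open>O(BW\<^sub>d)\<close> whose largest normal
  2-subgroup is \<open>R\<^sub>d\<close>, with quotient \<open>\<Omega>\<^sup>+(2d,2)\<close>. The remaining part of the shape
  \<open>2\<^sup>1\<^sup>+\<^sup>2\<^sup>d.\<Omega>\<^sup>+(2d,2)\<close>, that \<open>R\<^sub>d\<close> is extraspecial of plus type and order \<open>2\<^sup>1\<^sup>+\<^sup>2\<^sup>d\<close>, is a
  property of the explicit group \<^const>\<open>RR\<close>. For \<open>d \<ge> 4\<close> at most one \<open>G\<close> qualifies: it lies in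
  the normalizer of \<open>R\<^sub>d\<close> in \<open>O(BW\<^sub>d)\<close> and has the same order.
\<close>

definition is_BRW_group :: "('n::finite ambient \<Rightarrow> 'n ambient) set \<Rightarrow> bool" where
  "is_BRW_group G \<longleftrightarrow>
     subgroup G OV \<and> G \<subseteq> lattice_isometries BW \<and>
     normal_2_subgroup RR (OV\<lparr>carrier := G\<rparr>) \<and>
     (\<forall>N. normal_2_subgroup N (OV\<lparr>carrier := G\<rparr>) \<longrightarrow> N \<subseteq> RR) \<and>
     (OV\<lparr>carrier := G\<rparr> Mod RR) \<cong>
       (Omega_plus :: (bit ^ ('n + 'n) \<Rightarrow> bit ^ ('n + 'n)) monoid)"


section \<open>Involutions, defect, fourvolutions\<close>

definition involution :: "('a \<Rightarrow> 'a) \<Rightarrow> bool" where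
  "involution t \<longleftrightarrow> t \<circ> t = id \<and> t \<noteq> id"

definition fourvolution :: "('n::finite ambient \<Rightarrow> 'n ambient) \<Rightarrow> bool" where
  "fourvolution f \<longleftrightarrow> orthogonal_transformation f \<and> f \<circ> f = uminus"

definition group_center :: "('a, 'b) monoid_scheme \<Rightarrow> 'a set" where
  "group_center G =
     {z \<in> carrier G. \<forall>g \<in> carrier G. z \<otimes>\<^bsub>G\<^esub> g = g \<otimes>\<^bsub>G\<^esub> z}"

definition conj_fixed ::
    "('n::finite ambient \<Rightarrow> 'n ambient) \<Rightarrow> ('n ambient \<Rightarrow> 'n ambient) set set" where
  "conj_fixed t =
     {C \<in> carrier (OV\<lparr>carrier := RR\<rparr> Mod group_center (OV\<lparr>carrier := RR\<rparr>)).
        (\<lambda>r. inv\<^bsub>OV\<^esub> t \<otimes>\<^bsub>OV\<^esub> r \<otimes>\<^bsub>OV\<^esub> t) ` C = C}"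

text \<open>
  \<open>R\<^sub>d/Z(R\<^sub>d)\<close> is an elementary abelian 2-group, so its subgroup of fixed points has dimension \<open>2e\<close>
  over the field of two elements iff it has \<open>2\<^sup>2\<^sup>e\<close> elements. The defect is \<open>d - e\<close>.
\<close>

definition has_defect :: "('n::finite ambient \<Rightarrow> 'n ambient) \<Rightarrow> nat \<Rightarrow> bool" where
  "has_defect t k \<longleftrightarrow> (\<exists>e. card (conj_fixed t) = 2 ^ (2 * e) \<and> k + e = CARD('n))"


section \<open>Eigenlattices and projections\<close>

definition eigenlattice ::
    "'n::finite ambient set \<Rightarrow> real \<Rightarrow> ('n ambient \<Rightarrow> 'n ambient) \<Rightarrow> 'n ambient set" where
  "eigenlattice L \<epsilon> t = {x \<in> L. t x = \<epsilon> *\<^sub>R x}"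

text \<open>For a rational subspace \<open>W\<close> of \<open>\<rat> \<otimes> L\<close>, this is used only at points of \<open>\<rat> \<otimes> L\<close>.\<close>

definition orth_proj :: "'n::finite ambient set \<Rightarrow> 'n ambient \<Rightarrow> 'n ambient" where
  "orth_proj W x = (THE y. y \<in> W \<and> (\<forall>w \<in> W. bw_inner (x - y) w = 0))"

definition eigenproj ::
    "'n::finite ambient set \<Rightarrow> real \<Rightarrow> ('n ambient \<Rightarrow> 'n ambient) \<Rightarrow> 'n ambient \<Rightarrow> 'n ambient"
  where "eigenproj L \<epsilon> t = orth_proj (rat_span (eigenlattice L \<epsilon> t))"

definition M_lattice ::
    "'n::finite ambient set \<Rightarrow> real \<Rightarrow> ('n ambient \<Rightarrow> 'n ambient) \<Rightarrow> ('n ambient \<Rightarrow> 'n ambient) \<Rightarrow>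
     'n ambient set" where
  "M_lattice L \<epsilon> t f =
     {x + (f y - y) | x y. x \<in> eigenlattice L \<epsilon> t \<and> y \<in> eigenproj L \<epsilon> t ` L}"

end

theory Submission
  imports Defs
begin

text \<open>
  As \<open>f\<^sup>2 = -1\<close>, the map \<open>v \<mapsto> v(f - 1)\<close> doubles norms, and it sends \<open>M\<^sub>\<epsilon>\<close> into \<open>L\<^sup>\<epsilon>(t)\<close>, because
  \<open>(f - 1)\<^sup>2 = -2f\<close> and \<open>2P\<^sup>\<epsilon>(L) \<subseteq> L\<^sup>\<epsilon>(t)\<close>. Given the minimum norm \<open>2\<^sup>\<delta>\<close> of \<open>L\<close>, everything follows once
  \<open>M\<^sub>\<epsilon>\<close> is shown to contain a vector of norm \<open>2\<^sup>\<delta>\<^sup>-\<^sup>1\<close>.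

  Such a vector is \<open>a(f - 1)/2\<close> with \<open>a\<close> minimal in \<open>L\<^sup>\<epsilon>(t)\<close>. As \<open>t\<close> has nonzero trace, it commutes with every
  \<open>r \<in> R\<close> that it centralizes modulo \<open>\<plusminus>1\<close>, so the commutators \<open>[r, t]\<close> generate an elementary abelian
  subgroup of \<open>R\<close>; its centralizer in \<open>R\<close> is that of \<open>t\<close>. Some minimal vector \<open>w\<close>, obtained from \<open>v\<^sub>0\<close> by
  isometries \<open>(a + z)/\<surd>2\<close> normalizing \<open>R\<close>, is an eigenvector of all these commutators, hence of \<open>t\<close>; the bound
  \<open>d - 2k \<ge> 3\<close> enters here, through the order of the centralizer of \<open>t\<close> in \<open>R\<close>. Choosing \<open>r, q \<in> R\<close> with
  \<open>[r, t]\<close> and \<open>q\<close> anticommuting, \<open>u = (w + rw + qw + rqw)/2\<close> lies in \<open>L\<close> since \<open>[L, R, R] \<subseteq> 2L\<close>, and its four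
  summands are eigenvectors of \<open>t\<close> with eigenvalues of product \<open>-1\<close>. The projections of \<open>u\<close> give \<open>a(f - 1)/2\<close>.
\<close>

section \<open>Affine subspaces and Reed--Muller codes\<close>

lemma bit_vec_add_self [simp]: "(x::bit^'n) + x = 0"
  by (simp add: vec_eq_iff)

lemma bit_vec_double [simp]: "2 * (x::bit^'n) = 0"
  by (metis bit_vec_add_self mult_2)

lemma bit_vec_diff: "(x::bit^'n) - y = x + y"
  by (simp add: vec_eq_iff)

lemma bit_vec_add_left_cancel [simp]: "(x::bit^'n) + (x + y) = y"
  by (metis add.assoc add_0 bit_vec_add_self)

lemma bit_vec_subspace_iff:
  "vec.subspace (W::(bit^'n) set) \<longleftrightarrow> 0 \<in> W \<and> (\<forall>x\<in>W. \<forall>y\<in>W. x + y \<in> W)"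
proof -
  have "c *s x \<in> W" if "0 \<in> W" "x \<in> W" for c :: bit and x
    using that by (cases c) auto
  then show ?thesis
    by (auto simp: vec.subspace_def)
qed

lemma card_translate: "card ((\<lambda>w. a + w) ` W) = card (W :: (bit^'n) set)"
  by (rule card_image) (auto simp: inj_on_def)

text \<open>Over two scalars, adjoining \<open>b\<close> adds just one coset of the old span,
  disjoint from it by independence; so every basis vector doubles the span.\<close>

lemma card_span_independent:
  assumes "vec.independent (B :: (bit^'n::finite) set)"
  shows "card (vec.span B) = 2 ^ card B"
proof -
  have "finite B" by simp
  then show ?thesis using assms
  proof (induction B rule: finite_induct)
    case empty
    then show ?case by simp
  next
    case (insert b B)
    have ind: "vec.independent B" and nin: "b \<notin> vec.span B"
      using insert.prems insert.hyps by (auto simp: vec.independent_insert split: if_splits)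
    have eq: "vec.span (insert b B) = vec.span B \<union> (\<lambda>w. b + w) ` vec.span B"
    proof -
      have "x \<in> vec.span (insert b B) \<longleftrightarrow> x \<in> vec.span B \<or> b + x \<in> vec.span B" for x
      proof -
        have "x \<in> vec.span (insert b B) \<longleftrightarrow> (\<exists>k::bit. x - k *s b \<in> vec.span B)"
          by (simp add: vec.span_insert)
        also have "\<dots> \<longleftrightarrow> x \<in> vec.span B \<or> b + x \<in> vec.span B"
        proof -
          have "(\<exists>k::bit. P k) \<longleftrightarrow> P 0 \<or> P 1" for P
            by (metis bit.exhaust)
          then show ?thesis by (simp add: bit_vec_diff add.commute)
        qed
        finally show ?thesis .
      qed
      moreover have "b + x \<in> S \<longleftrightarrow> x \<in> (\<lambda>w. b + w) ` S" for x S
        by (metis (no_types, lifting) bit_vec_add_left_cancel imageE image_eqI)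
      ultimately show ?thesis by blast
    qed
    have disj: "vec.span B \<inter> (\<lambda>w. b + w) ` vec.span B = {}"
    proof -
      have False if "b + w \<in> vec.span B" "w \<in> vec.span B" for w
      proof -
        have "(b + w) + w \<in> vec.span B"
          using that by (rule vec.span_add)
        then show False using nin by (simp add: add.assoc)
      qed
      then show ?thesis by auto
    qed
    show ?case
      using insert.IH[OF ind] insert.hyps disj
      by (simp add: eq card_Un_disjoint card_translate)
  qed
qed

lemma card_subspace:
  assumes "vec.subspace (W :: (bit^'n::finite) set)"
  shows "card W = 2 ^ vec.dim W"
proof -
  obtain B where "vec.independent B" "vec.span B = W" "card B = vec.dim W"
    using vec.basis_subspace_exists[OF assms] by metis
  then show ?thesis using card_span_independent by metis
qed

lemma affine_of_dim_iff:
  "affine_of_dim m (A :: 'n::finite omega set) \<longleftrightarrow>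
     (\<exists>a W. vec.subspace W \<and> card W = 2 ^ m \<and> A = (\<lambda>w. a + w) ` W)"
  unfolding affine_of_dim_def using card_subspace by (metis one_less_numeral_iff power_inject_exp semiring_norm(76))

text \<open>In characteristic two the difference of two points is their sum, so membership relative
  to any chosen point of \<open>A\<close> is a test in the direction space \<open>W\<close>.\<close>

lemma affine_of_dimE:
  assumes "affine_of_dim m (A :: 'n::finite omega set)"
  obtains W where "vec.subspace W" "card W = 2 ^ m" "\<And>a. a \<in> A \<Longrightarrow> A = (\<lambda>w. a + w) ` W" "A \<noteq> {}"
    "\<And>x y. x \<in> A \<Longrightarrow> y \<in> A \<longleftrightarrow> x + y \<in> W"
proof -
  obtain b W where W: "vec.subspace W" "card W = 2 ^ m" "A = (\<lambda>w. b + w) ` W"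
    using assms by (auto simp: affine_of_dim_iff)
  have mem: "y \<in> A \<longleftrightarrow> b + y \<in> W" for y
    using W(3) by (metis (no_types, lifting) bit_vec_add_left_cancel imageE image_eqI)
  have iff: "y \<in> A \<longleftrightarrow> x + y \<in> W" if "x \<in> A" for x y
  proof -
    have "b + x \<in> W" using that mem by simp
    then have "b + y \<in> W \<longleftrightarrow> (b + x) + (b + y) \<in> W"
      using W(1) by (metis (no_types, lifting) bit_vec_add_left_cancel bit_vec_subspace_iff)
    moreover have "(b + x) + (b + y) = x + y"
      by (metis (no_types, lifting) add.commute add.left_commute bit_vec_add_left_cancel)
    ultimately show ?thesis using mem by simp
  qed
  have "A = (\<lambda>w. a + w) ` W" if "a \<in> A" for a
    using iff[OF that] by (metis (no_types, lifting) bit_vec_add_left_cancel image_iff subsetI subset_antisym)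
  moreover have "A \<noteq> {}" using W by (auto simp: bit_vec_subspace_iff)
  ultimately show thesis using that W iff by metis
qed

lemma affine_of_dimI:
  assumes "vec.subspace (W :: 'n::finite omega set)" "card W = 2 ^ m"
  shows "affine_of_dim m ((\<lambda>w. a + w) ` W)"
  using assms by (auto simp: affine_of_dim_iff)

lemma card_affine:
  assumes "affine_of_dim m (A :: 'n::finite omega set)"
  shows "card A = 2 ^ m"
  using assms by (auto simp: affine_of_dim_iff card_translate)

lemma affine_of_dim_translate:
  assumes "affine_of_dim m (A :: 'n::finite omega set)"
  shows "affine_of_dim m ((\<lambda>x. c + x) ` A)"
proof -
  obtain a W where "vec.subspace W" "card W = 2 ^ m" "A = (\<lambda>w. a + w) ` W"
    using assms by (auto simp: affine_of_dim_iff)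
  then show ?thesis
    using affine_of_dimI[of W m "c + a"] by (simp add: image_image add.assoc)
qed

lemma card_omega: "card (UNIV :: 'n::finite omega set) = 2 ^ CARD('n)"
proof -
  have "(UNIV :: bit set) = {0, 1}" by auto
  then have "CARD(bit) = 2" by (metis card_2_iff zero_neq_one)
  then show ?thesis by simp
qed

lemma affine_of_dim_le:
  assumes "affine_of_dim m (A :: 'n::finite omega set)"
  shows "m \<le> CARD('n)"
proof -
  have "card A \<le> card (UNIV :: 'n omega set)" by (rule card_mono) auto
  then show ?thesis using card_affine[OF assms] by (simp only: card_omega) simp
qed

lemma affine_of_dim_eq_UNIV:
  assumes "affine_of_dim m (A :: 'n::finite omega set)" "CARD('n) \<le> m"
  shows "A = UNIV"
proof -
  have "m = CARD('n)" using affine_of_dim_le[OF assms(1)] assms(2) by simp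
  then have "card A = card (UNIV :: 'n omega set)"
    using card_affine[OF assms(1)] by (simp only: card_omega)
  then show ?thesis using card_subset_eq[of UNIV A] by simp
qed

lemma affine_of_dim_UNIV: "affine_of_dim CARD('n) (UNIV :: 'n::finite omega set)"
  using affine_of_dimI[of "UNIV :: 'n omega set" "CARD('n)" 0, OF vec.subspace_UNIV card_omega] by simp

lemma subspace_card_exists:
  assumes "vec.subspace (W :: 'n::finite omega set)"
  obtains m where "card W = 2 ^ m"
  using card_subspace[OF assms] by blast

lemma subspace_extend:
  assumes W: "vec.subspace (W :: 'n::finite omega set)" "card W = 2 ^ m" and c: "c \<notin> W"
  shows "vec.subspace (W \<union> (\<lambda>w. c + w) ` W)" "card (W \<union> (\<lambda>w. c + w) ` W) = 2 ^ Suc m"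
proof -
  have mem: "x \<in> (\<lambda>w. c + w) ` W \<longleftrightarrow> c + x \<in> W" for x
    by (metis (no_types, lifting) bit_vec_add_left_cancel imageE image_eqI)
  have sub: "x + y \<in> W" if "x \<in> W" "y \<in> W" for x y
    using W that by (auto simp: bit_vec_subspace_iff)
  have a: "(c + x) + (c + y) = x + y" "x + (c + y) = c + (x + y)" "(c + x) + y = c + (x + y)" for x y
    by (metis (no_types, lifting) add.commute add.left_commute bit_vec_add_left_cancel)
      (simp_all add: ac_simps)
  show "vec.subspace (W \<union> (\<lambda>w. c + w) ` W)"
    using W(1) sub a by (auto simp: bit_vec_subspace_iff)
  have "x \<notin> W" if "c + x \<in> W" for x
    using sub[OF that, of x] c by (auto simp: add.assoc)
  then have "W \<inter> (\<lambda>w. c + w) ` W = {}" using mem by blast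
  then show "card (W \<union> (\<lambda>w. c + w) ` W) = 2 ^ Suc m"
    using W by (simp add: card_Un_disjoint card_translate)
qed

section \<open>Integer-valued signs and Reed-Muller codes of low degree\<close>

definition chi :: "'n::finite omega set \<Rightarrow> 'n omega \<Rightarrow> int" where
  "chi S i = (if i \<in> S then - 1 else 1)"

lemma chi_sym_diff: "chi (sym_diff S T) i = chi S i * chi T i"
  by (auto simp: chi_def)

lemma chi_square [simp]: "chi S i * chi S i = 1" "chi S i * (chi S i * z) = z"
  by (auto simp: chi_def)

lemma chi_eq_iff: "chi S = chi T \<longleftrightarrow> S = T"
  by (auto simp: chi_def fun_eq_iff split: if_splits)

lemma mem_translate_iff: "x \<in> (\<lambda>w. c + w) ` S \<longleftrightarrow> c + x \<in> (S :: 'n::finite omega set)"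
  by (metis (no_types, lifting) bit_vec_add_left_cancel imageE image_eqI)

lemma chi_translate: "chi ((\<lambda>w. c + w) ` S) i = chi S (c + i)"
  by (simp add: chi_def mem_translate_iff)

lemma RM_affine: "affine_of_dim m A \<Longrightarrow> CARD('n) \<le> m + k \<Longrightarrow> (A :: 'n::finite omega set) \<in> RM k"
  using RM.add[OF RM.empty, of m A k] by simp

lemma RM_sym_diff:
  assumes "S \<in> RM k" "(T :: 'n::finite omega set) \<in> RM k"
  shows "sym_diff S T \<in> RM k"
  using assms(2)
proof induction
  case empty
  then show ?case using assms(1) by simp
next
  case (add A T m)
  have "sym_diff S (sym_diff T A) = sym_diff (sym_diff S T) A" by blast
  then show ?case using RM.add[OF add.IH add.hyps(2,3)] by simp
qed

lemma RM_mono: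
  assumes "S \<in> RM k" "k \<le> l"
  shows "(S :: 'n::finite omega set) \<in> RM l"
  using assms(1)
proof induction
  case (add A T m)
  then show ?case using assms(2) by (intro RM.add) auto
qed (rule RM.empty)

lemma RM_translate:
  assumes "S \<in> RM k"
  shows "(\<lambda>x. c + x) ` (S :: 'n::finite omega set) \<in> RM k"
  using assms
proof induction
  case empty
  then show ?case by (simp add: RM.empty)
next
  case (add A T m)
  have "(\<lambda>x. c + x) ` sym_diff T A = sym_diff ((\<lambda>x. c + x) ` T) ((\<lambda>x. c + x) ` A)"
    by (auto simp: mem_translate_iff)
  then show ?case
    using RM.add[OF add.IH affine_of_dim_translate[OF add.hyps(2)] add.hyps(3)] by simp
qed

lemma RM_UNIV: "(UNIV :: 'n::finite omega set) \<in> RM k"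
  by (rule RM_affine[OF affine_of_dim_UNIV]) simp

text \<open>A direction \<open>c\<close> of \<open>A\<close> leaves \<open>A\<close> invariant; any
  other \<open>c\<close> makes \<open>A\<close> and its translate the disjoint halves of a flat one
  dimension larger.\<close>

lemma affine_sym_diff_translate:
  assumes "affine_of_dim m (A :: 'n::finite omega set)"
  shows "sym_diff A ((\<lambda>x. c + x) ` A) = {} \<or> affine_of_dim (Suc m) (sym_diff A ((\<lambda>x. c + x) ` A))"
proof -
  obtain W where W: "vec.subspace W" "card W = 2 ^ m" "\<And>a. a \<in> A \<Longrightarrow> A = (\<lambda>w. a + w) ` W" "A \<noteq> {}"
    using affine_of_dimE[OF assms] by metis
  obtain a where a: "A = (\<lambda>w. a + w) ` W" using W by blast
  have A: "x \<in> A \<longleftrightarrow> a + x \<in> W" for x by (simp add: a mem_translate_iff)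
  have sub: "x + y \<in> W" if "x \<in> W" "y \<in> W" for x y
    using W that by (auto simp: bit_vec_subspace_iff)
  show ?thesis
  proof (cases "c \<in> W")
    case True
    have "a + x \<in> W \<longleftrightarrow> a + (c + x) \<in> W" for x
      using sub[OF True, of "a + x"] sub[OF True, of "a + (c + x)"]
      by (metis add.left_commute bit_vec_add_left_cancel)
    then show ?thesis by (auto simp: mem_translate_iff A)
  next
    case False
    have disj: "\<not> (a + x \<in> W \<and> a + (c + x) \<in> W)" for x
      using sub[of "a + x" "a + (c + x)"] False
      by (metis add.commute add.left_commute bit_vec_add_left_cancel)
    have "sym_diff A ((\<lambda>x. c + x) ` A) = (\<lambda>w. a + w) ` (W \<union> (\<lambda>w. c + w) ` W)"
    proof (rule Set.set_eqI)
      fix x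
      show "x \<in> sym_diff A ((\<lambda>x. c + x) ` A) \<longleftrightarrow> x \<in> (\<lambda>w. a + w) ` (W \<union> (\<lambda>w. c + w) ` W)"
        using disj[of x] unfolding Un_iff Diff_iff mem_translate_iff A add.left_commute[of c a x] by blast
    qed
    then show ?thesis
      using affine_of_dimI[OF subspace_extend[OF W(1,2) False]] by simp
  qed
qed

text \<open>Differencing a polynomial function over two elements lowers its degree. On generators,
  \<open>affine_sym_diff_translate\<close> lowers the codimension by one or leaves nothing.\<close>

lemma RM_derivative:
  assumes "S \<in> RM (Suc k)"
  shows "sym_diff S ((\<lambda>x. c + x) ` (S :: 'n::finite omega set)) \<in> RM k"
  using assms
proof induction
  case empty
  then show ?case by (simp add: RM.empty)
next
  case (add A T m)
  have eq: "sym_diff (sym_diff T A) ((\<lambda>x. c + x) ` sym_diff T A) =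
     sym_diff (sym_diff T ((\<lambda>x. c + x) ` T)) (sym_diff A ((\<lambda>x. c + x) ` A))"
    by (auto simp: mem_translate_iff)
  have "sym_diff A ((\<lambda>x. c + x) ` A) \<in> RM k"
    using affine_sym_diff_translate[OF add.hyps(2), of c]
  proof
    assume "affine_of_dim (Suc m) (sym_diff A ((\<lambda>x. c + x) ` A))"
    then show ?thesis using add.hyps(3) by (intro RM_affine) auto
  qed (simp only: RM.empty)
  from RM_sym_diff[OF add.IH this] show ?case unfolding eq .
qed

lemma RM_0: 
  assumes "S \<in> RM 0"
  shows "S = {} \<or> S = (UNIV :: 'n::finite omega set)"
  using assms
proof induction
  case (add A T m)
  then have "A = UNIV" using affine_of_dim_eq_UNIV by simp
  then show ?case using add.IH by auto
qed simp

text \<open>The derivative of an affine function is constant, by \<open>RM_derivative\<close> and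
  \<open>RM_0\<close>; evaluating at the origin gives its value. Thus \<open>chi S\<close> is a
  character up to the sign \<open>chi S 0\<close>.\<close>

lemma RM_1_chi:
  assumes "S \<in> RM 1"
  shows "chi S (c + x) = chi S c * chi S 0 * chi S (x :: 'n::finite omega)"
proof -
  have "sym_diff S ((\<lambda>x. c + x) ` S) = {} \<or> sym_diff S ((\<lambda>x. c + x) ` S) = UNIV"
    using assms RM_derivative[of S 0 c] by (intro RM_0) (simp only: One_nat_def)
  moreover have "chi S x * chi S (c + x) = chi (sym_diff S ((\<lambda>x. c + x) ` S)) x" for x
    by (simp only: chi_sym_diff chi_translate)
  moreover have "chi {} x = 1" "chi UNIV x = -1" for x :: "'n omega"
    by (simp_all add: chi_def)
  ultimately obtain k where k: "chi S x * chi S (c + x) = k" for x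
    by metis
  have "chi S x * chi S (c + x) = chi S c * chi S 0"
    using k[of x] k[of 0] by (simp add: mult.commute)
  then show ?thesis
    by (metis chi_square(2) mult.commute)
qed

text \<open>An affine function is constant on a flat or cuts it into two parallel halves, which are
  cosets of the kernel \<open>W0\<close> of its linear part on \<open>W\<close>.\<close>

lemma affine_inter_RM_1:
  assumes "affine_of_dim n (A :: 'n::finite omega set)" "S \<in> RM 1"
  shows "A \<inter> S = {} \<or> A \<inter> S = A \<or>
    (\<exists>m. n = Suc m \<and> affine_of_dim m (A \<inter> S) \<and> affine_of_dim m (A - S))"
proof -
  obtain W where W: "vec.subspace W" "card W = 2 ^ n" "\<And>a. a \<in> A \<Longrightarrow> A = (\<lambda>w. a + w) ` W" "A \<noteq> {}"
    "\<And>x y. x \<in> A \<Longrightarrow> y \<in> A \<longleftrightarrow> x + y \<in> W"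
    using affine_of_dimE[OF assms(1)] by metis
  have sub: "x + y \<in> W" if "x \<in> W" "y \<in> W" for x y
    using W that by (auto simp: bit_vec_subspace_iff)
  define W0 where "W0 = {w \<in> W. chi S w = chi S 0}"
  note ch = RM_1_chi[OF assms(2)]
  have W0: "vec.subspace W0"
    using W(1) by (auto simp: bit_vec_subspace_iff W0_def ch mult.assoc)
  have S: "x \<in> S \<longleftrightarrow> chi S x = -1" for x by (simp add: chi_def)
  show ?thesis
  proof (cases "W0 = W")
    case True
    have "chi S y = chi S x" if "x \<in> A" "y \<in> A" for x y
    proof -
      have "x + y \<in> W0" using that(2) W(5)[OF that(1), of y] True by simp
      then show ?thesis using ch[of x "x + y"] by (simp add: W0_def mult.assoc)
    qed
    then have "y \<in> S \<longleftrightarrow> x \<in> S" if "x \<in> A" "y \<in> A" for x y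
      using that unfolding S by metis
    then show ?thesis using W(4) by blast
  next
    case False
    then obtain e where e: "e \<in> W" "chi S e \<noteq> chi S 0"
      unfolding W0_def by blast
    then have e: "e \<in> W" "chi S e = - chi S 0"
      by (auto simp: chi_def split: if_splits)
    then have e0: "e \<notin> W0" by (auto simp: W0_def chi_def)
    obtain m where m: "card W0 = 2 ^ m" using W0 subspace_card_exists by blast
    have "W = W0 \<union> (\<lambda>w. e + w) ` W0"
    proof (rule Set.set_eqI)
      fix x
      have "x \<in> W \<longleftrightarrow> e + x \<in> W" using sub[OF e(1), of x] sub[OF e(1), of "e + x"] by auto
      moreover have "chi S x = chi S 0 \<or> chi S x = - chi S 0" by (auto simp: chi_def)
      then have "chi S x = chi S 0 \<or> chi S (e + x) = chi S 0" by (auto simp: ch e)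
      ultimately show "x \<in> W \<longleftrightarrow> x \<in> W0 \<union> (\<lambda>w. e + w) ` W0"
        by (auto simp: mem_translate_iff W0_def)
    qed
    then have n: "n = Suc m"
      using subspace_extend(2)[OF W0 m e0] W(2) by (metis one_less_numeral_iff power_inject_exp semiring_norm(76))
    have half: "{y \<in> A. chi S y = chi S a} = (\<lambda>w. a + w) ` W0" if "a \<in> A" for a
    proof (rule Set.set_eqI)
      fix y
      have "a + y \<in> W \<longleftrightarrow> y \<in> A" using W(5)[OF that, of y] by simp
      moreover have "chi S (a + y) = chi S 0 \<longleftrightarrow> chi S y = chi S a"
        unfolding ch by (auto simp: chi_def)
      ultimately show "y \<in> {y \<in> A. chi S y = chi S a} \<longleftrightarrow> y \<in> (\<lambda>w. a + w) ` W0"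
        by (auto simp: mem_translate_iff W0_def)
    qed
    then have haff: "affine_of_dim m {y \<in> A. chi S y = chi S a}" if "a \<in> A" for a
      using affine_of_dimI[OF W0 m] that by simp
    obtain a where a: "a \<in> A" using W(4) by blast
    have ae: "a + e \<in> A" using W(5)[OF a] e by simp
    have "chi S (a + e) = - chi S a" by (simp add: ch e)
    then have *: "{A \<inter> S, A - S} = {{y \<in> A. chi S y = chi S a}, {y \<in> A. chi S y = chi S (a + e)}}"
      by (cases "a \<in> S") (auto simp: chi_def split: if_splits)
    have "affine_of_dim m Y" if "Y \<in> {A \<inter> S, A - S}" for Y
      using that haff[OF a] haff[OF ae] unfolding * by blast
    then show ?thesis using n by simp
  qed
qed

lemma RM_1_inter:
  assumes "S \<in> RM 1" "(T :: 'n::finite omega set) \<in> RM 1"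
  shows "S \<inter> T \<in> RM 2"
proof -
  consider "S = {}" | "S = UNIV" | m where "CARD('n) = Suc m" "affine_of_dim m S"
    using affine_inter_RM_1[OF affine_of_dim_UNIV assms(1)] by auto
  then show ?thesis
  proof cases
    case 1
    then show ?thesis by (simp add: RM.empty)
  next
    case 2
    then show ?thesis using assms(2) RM_mono[of T 1 2] by simp
  next
    case 3
    from affine_inter_RM_1[OF 3(2) assms(2)] show ?thesis
    proof (elim disjE exE conjE)
      assume "S \<inter> T = S"
      then show ?thesis using assms(1) RM_mono[of S 1 2] by simp
    next
      fix l assume "m = Suc l" "affine_of_dim l (S \<inter> T)"
      then show ?thesis using 3(1) by (intro RM_affine) auto
    qed (simp add: RM.empty)
  qed
qed

text \<open>A subspace maximal among those containing \<open>W\<close> and avoiding \<open>c\<close>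
  is a hyperplane, and \<open>H\<close> is its other coset.\<close>

lemma hyperplane_separation:
  assumes "vec.subspace (W :: 'n::finite omega set)" "c \<notin> W"
  obtains H where "H \<in> RM 1" "W \<inter> H = {}" "\<And>x. x \<in> W \<Longrightarrow> c + x \<in> H"
proof -
  let ?P = "\<lambda>U. vec.subspace U \<and> W \<subseteq> U \<and> c \<notin> U"
  have "\<exists>U. ?P U \<and> (\<forall>V. ?P V \<longrightarrow> card V \<le> card U)"
    using assms by (intro ex_has_greatest_nat[where b = "Suc (card (UNIV :: 'n omega set))"])
      (auto intro!: le_imp_less_Suc card_mono simp del: CARD_vec)
  then obtain U where U: "vec.subspace U" "W \<subseteq> U" "c \<notin> U" and mx: "\<And>V. ?P V \<Longrightarrow> card V \<le> card U"
    by blast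
  obtain m where m: "card U = 2 ^ m" using U subspace_card_exists by blast
  \<comment> \<open>A point outside both cosets could be adjoined to \<open>U\<close> without
    capturing \<open>c\<close>, against maximality.\<close>
  have "U \<union> (\<lambda>w. c + w) ` U = UNIV"
  proof (rule ccontr)
    assume "\<not> ?thesis"
    then obtain x where x: "x \<notin> U" "x \<notin> (\<lambda>w. c + w) ` U" by blast
    let ?V = "U \<union> (\<lambda>w. x + w) ` U"
    have "c \<notin> (\<lambda>w. x + w) ` U"
      using x(2) unfolding mem_translate_iff add.commute[of x c] .
    then have "?P ?V"
      using U subspace_extend(1)[OF U(1) m x(1)] by blast
    from mx[OF this] show False using subspace_extend(2)[OF U(1) m x(1)] m by simp
  qed
  then have "(2::nat) ^ Suc m = 2 ^ CARD('n)"
    using subspace_extend(2)[OF U(1) m U(3)] by (metis card_omega)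
  then have "CARD('n) = Suc m"
    by (metis one_less_numeral_iff power_inject_exp semiring_norm(76))
  then have "(\<lambda>w. c + w) ` U \<in> RM 1"
    using affine_of_dimI[OF U(1) m, of c] by (intro RM_affine) auto
  moreover have "W \<inter> (\<lambda>w. c + w) ` U = {}"
  proof -
    have False if "x \<in> W" "c + x \<in> U" for x
    proof -
      have "x + (c + x) \<in> U" using that U by (metis bit_vec_subspace_iff subsetD)
      then show False using U(3) by (simp add: add.left_commute)
    qed
    then show ?thesis unfolding disjoint_iff mem_translate_iff by blast
  qed
  moreover have "c + x \<in> (\<lambda>w. c + w) ` U" if "x \<in> W" for x using that U by auto
  ultimately show thesis using that by blast
qed

section \<open>The minimum norm\<close>

lemma sum_chi: "finite A \<Longrightarrow> (\<Sum>i\<in>A. chi S i) = int (card (A - S)) - int (card (A \<inter> S))"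
proof -
  assume "finite A"
  then have "(\<Sum>i\<in>A. chi S i) = (\<Sum>i\<in>A \<inter> S. chi S i) + (\<Sum>i\<in>A - S. chi S i)"
    by (rule sum.Int_Diff)
  also have "(\<Sum>i\<in>A \<inter> S. chi S i) = (\<Sum>i\<in>A \<inter> S. - 1)"
    by (rule sum.cong) (auto simp: chi_def)
  also have "(\<Sum>i\<in>A - S. chi S i) = (\<Sum>i\<in>A - S. 1)"
    by (rule sum.cong) (auto simp: chi_def)
  finally show ?thesis by simp
qed

text \<open>By differencing, \<open>T\<^sup>2\<close> is a sum of character sums over \<open>A\<close>, each \<open>0\<close> or \<open>\<plusminus>|A|\<close>.\<close>

lemma quadratic_sum_square:
  assumes "affine_of_dim n (A :: 'n::finite omega set)" "S \<in> RM 2"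
  shows "2 ^ n dvd (\<Sum>i\<in>A. chi S i)\<^sup>2"
proof -
  obtain W where W: "vec.subspace W" "card W = 2 ^ n" "\<And>a. a \<in> A \<Longrightarrow> A = (\<lambda>w. a + w) ` W"
    using affine_of_dimE[OF assms(1)] by metis
  have "(\<Sum>i\<in>A. chi S i)\<^sup>2 = (\<Sum>x\<in>A. \<Sum>y\<in>A. chi S x * chi S y)"
    by (simp add: power2_eq_square sum_product)
  also have "\<dots> = (\<Sum>x\<in>A. \<Sum>w\<in>W. chi S x * chi S (w + x))"
  proof (rule sum.cong)
    fix x assume "x \<in> A"
    then have "bij_betw (\<lambda>w. x + w) W A"
      using W(3) by (intro bij_betw_imageI) (auto simp: inj_on_def)
    then show "(\<Sum>y\<in>A. chi S x * chi S y) = (\<Sum>w\<in>W. chi S x * chi S (w + x))"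
      by (subst sum.reindex_bij_betw[symmetric]) (auto simp: add.commute)
  qed simp
  also have "\<dots> = (\<Sum>w\<in>W. \<Sum>x\<in>A. chi S x * chi S (w + x))"
    by (rule sum.swap)
  also have "\<dots> = (\<Sum>w\<in>W. \<Sum>x\<in>A. chi (sym_diff S ((\<lambda>x. w + x) ` S)) x)"
    by (simp only: chi_sym_diff chi_translate)
  also have "2 ^ n dvd \<dots>"
  proof (rule dvd_sum)
    fix w
    have "sym_diff S ((\<lambda>x. w + x) ` S) \<in> RM 1"
      using RM_derivative[of S 1 w] assms(2) by (simp add: numeral_2_eq_2)
    from affine_inter_RM_1[OF assms(1) this]
    show "2 ^ n dvd (\<Sum>x\<in>A. chi (sym_diff S ((\<lambda>x. w + x) ` S)) x)"
    proof (elim disjE exE conjE)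
      let ?D = "sym_diff S ((\<lambda>x. w + x) ` S)"
      assume "A \<inter> ?D = {}"
      moreover from this have "A - ?D = A" by blast
      ultimately show ?thesis by (simp only: sum_chi finite card.empty card_affine[OF assms(1)]) simp
    next
      let ?D = "sym_diff S ((\<lambda>x. w + x) ` S)"
      assume "A \<inter> ?D = A"
      moreover from this have "A - ?D = {}" by blast
      ultimately show ?thesis by (simp only: sum_chi finite card.empty card_affine[OF assms(1)]) simp
    next
      fix m
      let ?D = "sym_diff S ((\<lambda>x. w + x) ` S)"
      assume "affine_of_dim m (A \<inter> ?D)" "affine_of_dim m (A - ?D)"
      then show ?thesis by (simp only: sum_chi finite card_affine) simp
    qed
  qed
  finally show ?thesis .
qed

lemma two_power_dvd_square:
  assumes "2 ^ n dvd (T::int)\<^sup>2"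
  shows "2 ^ ((n + 1) div 2) dvd T"
  using assms
proof (induction n arbitrary: T rule: less_induct)
  case (less n)
  consider "n = 0" | "n = 1" | m where "n = m + 2"
    by (metis One_nat_def Suc_eq_plus1 add_2_eq_Suc' not0_implies_Suc)
  then show ?case
  proof cases
    case 2
    then show ?thesis using less.prems by simp
  next
    case 3
    have "even (T\<^sup>2)"
      by (rule dvd_trans[OF _ less.prems]) (simp add: 3)
    then obtain U where U: "T = 2 * U" by (metis even_power evenE)
    have "4 * 2 ^ m dvd 4 * U\<^sup>2" using less.prems by (simp add: 3 U power_mult_distrib power_add mult.commute)
    then have "2 ^ m dvd U\<^sup>2" by simp
    then have "2 ^ ((m + 1) div 2) dvd U" using less.IH[of m U] 3 by simp
    then show ?thesis by (simp add: 3 U)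
  qed simp
qed

lemma affine_inter_affine:
  assumes "affine_of_dim a (A :: 'n::finite omega set)" "affine_of_dim q Q" "a + q \<ge> CARD('n) + n"
  shows "A \<inter> Q = {} \<or> (\<exists>m\<ge>n. affine_of_dim m (A \<inter> Q))"
proof (cases "A \<inter> Q = {}")
  case False
  obtain W where W: "vec.subspace W" "card W = 2 ^ a" "\<And>x. x \<in> A \<Longrightarrow> A = (\<lambda>w. x + w) ` W"
    using affine_of_dimE[OF assms(1)] by metis
  obtain U where U: "vec.subspace U" "card U = 2 ^ q" "\<And>x. x \<in> Q \<Longrightarrow> Q = (\<lambda>w. x + w) ` U"
    using affine_of_dimE[OF assms(2)] by metis
  obtain x where x: "x \<in> A" "x \<in> Q" using False by blast
  have AQ: "A \<inter> Q = (\<lambda>w. x + w) ` (W \<inter> U)"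
    by (subst W(3)[OF x(1)], subst U(3)[OF x(2)]) auto
  have dims: "vec.dim W = a" "vec.dim U = q"
    using card_subspace W U by (metis one_less_numeral_iff power_inject_exp semiring_norm(76))+
  have "vec.dim {x + y |x y. x \<in> W \<and> y \<in> U} \<le> CARD('n)"
    by (rule dim_subset_UNIV_cart_gen)
  then have "n \<le> vec.dim (W \<inter> U)"
    using vec.dim_sums_Int[OF W(1) U(1)] dims assms(3) by linarith
  then show ?thesis
    using affine_of_dimI[OF vec.subspace_inter[OF W(1) U(1)] card_subspace[OF vec.subspace_inter[OF W(1) U(1)]], of x]
    unfolding AQ by blast
qed simp

text \<open>By the dimension formula a nonempty \<open>A \<inter> Q\<close> has dimension at least
  \<open>2 * n - 1\<close>. The squared sum is divisible by that power of two, and rounding the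
  halved exponent up yields the last factor.\<close>

lemma quadratic_sum_dvd:
  assumes "affine_of_dim a (A :: 'n::finite omega set)" "affine_of_dim q Q" "S \<in> RM 2"
    "a + q + 1 \<ge> CARD('n) + 2 * n"
  shows "2 ^ n dvd (\<Sum>i\<in>A \<inter> Q. chi S i)"
proof (cases "n = 0")
  case False
  then have "a + q \<ge> CARD('n) + (2 * n - 1)" using assms(4) by simp
  from affine_inter_affine[OF assms(1,2) this] show ?thesis
  proof (elim disjE exE conjE)
    fix m assume m: "2 * n - 1 \<le> m" "affine_of_dim m (A \<inter> Q)"
    have "2 ^ (2 * n - 1) dvd (2::int) ^ m" using m(1) by (rule le_imp_power_dvd)
    also have "\<dots> dvd (\<Sum>i\<in>A \<inter> Q. chi S i)\<^sup>2" by (rule quadratic_sum_square[OF m(2) assms(3)])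
    finally have "2 ^ ((2 * n - 1 + 1) div 2) dvd (\<Sum>i\<in>A \<inter> Q. chi S i)" by (rule two_power_dvd_square)
    then show ?thesis using False by simp
  qed simp
qed simp

section \<open>Coordinate subcubes and a minimum-weight bound\<close>

definition cube :: "'n set \<Rightarrow> ('n \<Rightarrow> bit) \<Rightarrow> 'n::finite omega set" where
  "cube I a = {x. \<forall>i\<in>I. x $ i = a i}"

lemma affine_cube: "affine_of_dim (CARD('n) - card I) (cube I a :: 'n::finite omega set)"
proof -
  let ?W = "{x :: 'n omega. \<forall>i. i \<notin> - I \<longrightarrow> x $ i = 0}"
  have "vec.subspace ?W" by (auto simp: bit_vec_subspace_iff)
  moreover have "vec.dim ?W = CARD('n) - card I"
    by (subst dim_substandard_cart) (simp add: Compl_eq_Diff_UNIV card_Diff_subset)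
  moreover have "cube I a = (\<lambda>w. (\<chi> i. a i) + w) ` ?W"
  proof (rule Set.set_eqI)
    fix x :: "'n omega"
    have "p + q = 0 \<longleftrightarrow> q = p" for p q :: bit by (cases p; cases q) auto
    then show "x \<in> cube I a \<longleftrightarrow> x \<in> (\<lambda>w. (\<chi> i. a i) + w) ` ?W"
      unfolding mem_translate_iff by (auto simp: cube_def)
  qed
  ultimately show ?thesis unfolding affine_of_dim_def by blast
qed

lemma cube_split:
  fixes Y :: "'n::finite omega set"
  assumes "i \<notin> I"
  shows "card (Y \<inter> cube I a) =
    card (Y \<inter> cube (insert i I) (a(i := 0))) + card (Y \<inter> cube (insert i I) (a(i := 1)))"
proof -
  have "Y \<inter> cube I a = (Y \<inter> cube (insert i I) (a(i := 0))) \<union> (Y \<inter> cube (insert i I) (a(i := 1)))"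
    using assms by (auto simp: cube_def) 
  moreover have "(Y \<inter> cube (insert i I) (a(i := 0))) \<inter> (Y \<inter> cube (insert i I) (a(i := 1))) = {}"
    by (auto simp: cube_def)
  ultimately show ?thesis by (simp add: card_Un_disjoint)
qed

text \<open>In coding terms, \<open>Y\<close> lies in the dual of \<open>RM s\<close>, a Reed-Muller
  code of degree \<open>CARD('n) - s - 1\<close>, and this is its minimum weight. The proof bisects
  cubes.\<close>

lemma even_cubes_card:
  fixes Y :: "'n::finite omega set"
  assumes s: "s < CARD('n)" and ev: "\<And>I a. card I = s \<Longrightarrow> even (card (Y \<inter> cube I a))"
    and ne: "Y \<noteq> {}"
  shows "2 ^ Suc s \<le> card Y"
proof -
  \<comment> \<open>Parity passes to larger cubes, each being the disjoint union of two halves; so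
    it holds whenever at most \<open>s\<close> coordinates are fixed.\<close>
  have even: "even (card (Y \<inter> cube I a))" if "card I + r = s" for I a r
    using that
  proof (induction r arbitrary: I a)
    case (Suc r)
    have "I \<noteq> UNIV" using Suc.prems s by auto
    then obtain i where i: "i \<notin> I" by blast
    show ?case unfolding cube_split[OF i] using Suc i by simp
  qed (simp add: ev)
  have "2 ^ r \<le> card (Y \<inter> cube I a)" if "card I + r = Suc s" "Y \<inter> cube I a \<noteq> {}" for I a r
    using that
  proof (induction r arbitrary: I a)
    case 0
    then show ?case by (simp add: Suc_le_eq card_gt_0_iff)
  next
    case (Suc r)
    \<comment> \<open>An even nonempty intersection has a second point; a coordinate separating the
      two points bisects the cube into halves that both meet \<open>Y\<close>.\<close>
    have "even (card (Y \<inter> cube I a))" using even[of I r a] Suc.prems by simp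
    moreover obtain x where x: "x \<in> Y \<inter> cube I a" using Suc.prems by blast
    ultimately have "Y \<inter> cube I a \<noteq> {x}" by auto
    then obtain y where y: "y \<in> Y \<inter> cube I a" "y \<noteq> x" using x by blast
    then obtain i where i: "x $ i \<noteq> y $ i" by (metis vec_eq_iff)
    then have nI: "i \<notin> I" using x y by (auto simp: cube_def)
    have "z \<in> cube (insert i I) (a(i := z $ i))" if "z \<in> cube I a" for z
      using that by (auto simp: cube_def)
    then have "Y \<inter> cube (insert i I) (a(i := x $ i)) \<noteq> {}" "Y \<inter> cube (insert i I) (a(i := y $ i)) \<noteq> {}"
      using x y by blast+
    then have ne: "Y \<inter> cube (insert i I) (a(i := b)) \<noteq> {}" for b
      using i by (metis (full_types) bit.exhaust)
    have "card (insert i I) + r = Suc s" using Suc.prems nI by simp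
    from Suc.IH[OF this ne]
    have "2 ^ r \<le> card (Y \<inter> cube (insert i I) (a(i := b)))" for b .
    from add_mono[OF this[of 0] this[of 1]] show ?case
      unfolding cube_split[OF nI] by simp
  qed
  from this[of "{}" "Suc s" undefined] show ?thesis using ne by (simp add: cube_def)
qed

section \<open>Integral spans and the minimum norm of \<open>BW\<close>\<close>

interpretation int_mod: Modules.module "\<lambda>n::int. scaleR (of_int n) :: 'a::real_vector \<Rightarrow> 'a"
  by unfold_locales (simp_all add: algebra_simps)

interpretation rat_mod: Modules.module "\<lambda>q::rat. scaleR (of_rat q) :: 'a::real_vector \<Rightarrow> 'a"
  by unfold_locales (simp_all add: algebra_simps of_rat_add of_rat_mult)

lemma int_span_induct [consumes 1, case_names base zero add scale]:
  assumes "x \<in> int_span B" "\<And>b. b \<in> B \<Longrightarrow> P b" "P 0" "\<And>x y. P x \<Longrightarrow> P y \<Longrightarrow> P (x + y)"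
    "\<And>k x. P x \<Longrightarrow> P (of_int k *\<^sub>R x)"
  shows "P x"
  by (rule int_mod.span_induct_alt[OF assms(1)[unfolded int_span_def]]) (use assms in auto)

lemma int_span_base: "b \<in> B \<Longrightarrow> b \<in> int_span B"
  unfolding int_span_def by (rule int_mod.span_base)

lemma int_span_0: "0 \<in> int_span B"
  unfolding int_span_def by (rule int_mod.span_zero)

lemma int_span_add: "x \<in> int_span B \<Longrightarrow> y \<in> int_span B \<Longrightarrow> x + y \<in> int_span B"
  unfolding int_span_def by (rule int_mod.span_add)

lemma int_span_diff: "x \<in> int_span B \<Longrightarrow> y \<in> int_span B \<Longrightarrow> x - y \<in> int_span B"
  unfolding int_span_def by (rule int_mod.span_diff)

lemma int_span_neg: "x \<in> int_span B \<Longrightarrow> - x \<in> int_span B"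
  unfolding int_span_def by (rule int_mod.span_neg)

lemma int_span_scale: "x \<in> int_span B \<Longrightarrow> of_int k *\<^sub>R x \<in> int_span B"
  unfolding int_span_def by (rule int_mod.span_scale)

lemma BW_0: "0 \<in> BW"
  unfolding BW_def by (rule int_span_0)

lemma BW_add: "x \<in> BW \<Longrightarrow> y \<in> BW \<Longrightarrow> x + y \<in> BW"
  unfolding BW_def by (rule int_span_add)

lemma BW_diff: "x \<in> BW \<Longrightarrow> y \<in> BW \<Longrightarrow> x - y \<in> BW"
  unfolding BW_def by (rule int_span_diff)

lemma BW_neg: "x \<in> BW \<Longrightarrow> - x \<in> BW"
  unfolding BW_def by (rule int_span_neg)

lemma sign_change_nth: "sign_change S x $ i = of_int (chi S i) * x $ i"
  by (simp add: sign_change_def chi_def)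

lemma vsum_nth: "vsum A $ i = (if i \<in> A then 1 else 0)"
  by (simp add: vsum_def axis_def if_distrib cong: if_cong)

text \<open>On a generator this is a quadratic character sum over \<open>A \<inter> Q\<close>
  divided by \<open>2 ^ m\<close>. A single point \<open>Q\<close> bounds the denominators of the
  coordinates; larger \<open>Q\<close> restrict where the largest denominators occur.\<close>

lemma BW_affine_sum:
  fixes x :: "'n::finite ambient"
  assumes "x \<in> BW" "CARD('n) = 2 * \<delta> + 1" "affine_of_dim (2 * j) Q"
  shows "\<exists>k::int. (\<Sum>i\<in>Q. x $ i) = of_int k * 2 ^ j / 2 ^ \<delta>"
  using assms(1) unfolding BW_def
proof (induction rule: int_span_induct)
  case (base b)
  then obtain m A S where b: "b = (1 / 2 ^ m) *\<^sub>R sign_change S (vsum A)"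
    and A: "affine_of_dim (2 * m) A" and S: "S \<in> RM 2" by blast
  have "(\<Sum>i\<in>Q. b $ i) = (\<Sum>i\<in>Q. if i \<in> A then of_int (chi S i) else 0) / 2 ^ m"
    unfolding sum_divide_distrib by (rule sum.cong) (auto simp: b sign_change_nth vsum_nth)
  also have "(\<Sum>i\<in>Q. if i \<in> A then of_int (chi S i) else (0::real)) = of_int (\<Sum>i\<in>A \<inter> Q. chi S i)"
    by (simp add: sum.If_cases Int_def conj_commute)
  finally have sm: "(\<Sum>i\<in>Q. b $ i) = of_int (\<Sum>i\<in>A \<inter> Q. chi S i) / 2 ^ m" .
  \<comment> \<open>For dimensions \<open>2 * m\<close> and \<open>2 * j\<close> in odd dimension
    \<open>2 * \<delta> + 1\<close> this exponent meets the bound of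
    \<open>quadratic_sum_dvd\<close> with equality; if \<open>m + j < \<delta>\<close>, natural
    subtraction leaves divisibility by 1.\<close>
  have "2 ^ (m + j - \<delta>) dvd (\<Sum>i\<in>A \<inter> Q. chi S i)"
  proof (cases "m + j \<ge> \<delta>")
    case True
    then show ?thesis using A S assms(2,3) by (intro quadratic_sum_dvd) auto
  qed simp
  then obtain c where c: "(\<Sum>i\<in>A \<inter> Q. chi S i) = 2 ^ (m + j - \<delta>) * c" by (elim dvdE)
  have "\<delta> + (m + j - \<delta>) = m + j + (\<delta> - (m + j))" by simp
  then have "(2::real) ^ \<delta> * 2 ^ (m + j - \<delta>) = 2 ^ m * 2 ^ j * 2 ^ (\<delta> - (m + j))"
    by (metis power_add)
  then have "(\<Sum>i\<in>Q. b $ i) = of_int (c * 2 ^ (\<delta> - (m + j))) * 2 ^ j / 2 ^ \<delta>"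
    unfolding sm c by (simp add: field_simps)
  then show ?case by blast
next
  case zero
  show ?case by (rule exI[of _ 0]) simp
next
  case (add x y)
  then obtain k l where "(\<Sum>i\<in>Q. x $ i) = of_int k * 2 ^ j / 2 ^ \<delta>" "(\<Sum>i\<in>Q. y $ i) = of_int l * 2 ^ j / 2 ^ \<delta>"
    by blast
  then show ?case by (intro exI[of _ "k + l"]) (simp add: sum.distrib algebra_simps add_divide_distrib)
next
  case (scale c x)
  then obtain k where "(\<Sum>i\<in>Q. x $ i) = of_int k * 2 ^ j / 2 ^ \<delta>" by blast
  then show ?case by (intro exI[of _ "c * k"]) (simp add: sum_distrib_left[symmetric])
qed

lemma affine_singleton: "affine_of_dim 0 {i :: 'n::finite omega}"
  using affine_of_dimI[of "{0}" 0 i] by simp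

text \<open>
  If \<open>2\<^sup>m x\<close> is integral with \<open>m > 0\<close> minimal, then the set of its odd coordinates meets every
  affine subspace of dimension \<open>d - 2m + 1\<close> evenly, hence has at least \<open>4\<^sup>m\<close> elements.
\<close>

lemma BW_min_norm:
  fixes x :: "'n::finite ambient"
  assumes x: "x \<in> BW" and d: "odd CARD('n)" and nz: "x \<noteq> 0"
  shows "1 \<le> x \<bullet> x"
proof -
  obtain \<delta> where \<delta>: "CARD('n) = 2 * \<delta> + 1" using d by (auto elim: oddE)
  define P where "P m \<longleftrightarrow> (\<forall>i. \<exists>k::int. 2 ^ m * x $ i = of_int k)" for m :: nat
  have "\<exists>k::int. 2 ^ \<delta> * x $ i = of_int k" for i
    using BW_affine_sum[OF x \<delta>, of 0 "{i}"] affine_singleton[of i] by (auto simp: field_simps)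
  then have "P \<delta>" unfolding P_def by blast
  then obtain m where m: "P m" "\<And>l. l < m \<Longrightarrow> \<not> P l" and "m \<le> \<delta>"
    using LeastI[of P \<delta>] not_less_Least[of _ P] Least_le[of P \<delta>] by blast
  from m(1) obtain y where y: "2 ^ m * x $ i = of_int (y i)" for i unfolding P_def by metis
  then have xy: "x $ i = of_int (y i) / 2 ^ m" for i by (simp add: field_simps)
  have inner: "x \<bullet> x = (\<Sum>i\<in>UNIV. (of_int (y i) / 2 ^ m)\<^sup>2)"
    by (simp add: inner_vec_def xy power2_eq_square)
  show ?thesis
  proof (cases "m = 0")
    case True
    obtain i where "x $ i \<noteq> 0" using nz by (auto simp: vec_eq_iff)
    then have "y i \<noteq> 0" using xy by auto
    then have "1 \<le> (y i)\<^sup>2" by (metis int_one_le_iff_zero_less power_eq_0_iff zero_less_power2 zero_power2)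
    then have "1 \<le> (of_int (y i) / 2 ^ m :: real)\<^sup>2" using True by (simp add: one_le_power flip: of_int_power)
    also have "\<dots> \<le> x \<bullet> x" unfolding inner
      by (rule member_le_sum) auto
    finally show ?thesis .
  next
    case False
    define Y where "Y = {i. odd (y i)}"
    have "Y \<noteq> {}"
    proof
      assume "Y = {}"
      then have "\<exists>k. y i = 2 * k" for i unfolding Y_def by (auto elim: evenE)
      then obtain k where k: "y i = 2 * k i" for i by metis
      have "2 ^ (m - 1) * x $ i = of_int (k i)" for i
        using y[of i] k[of i] False by (simp add: power_eq_if)
      then have "P (m - 1)" unfolding P_def by blast
      then show False using m(2) False by simp
    qed
    moreover have "even (card (Y \<inter> cube I a))" if "card I = 2 * m - 1" for I a
    proof -
      let ?Q = "cube I a"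
      \<comment> \<open>Fixing \<open>2 * m - 1\<close> coordinates leaves an even-dimensional flat,
        as \<open>BW_affine_sum\<close> demands; its factor \<open>2 ^ (\<delta> + 1 - m)\<close>
        makes the sum of the numerators \<open>y i\<close> even.\<close>
      have "CARD('n) - card I = 2 * (\<delta> + 1 - m)" using that False \<delta> \<open>m \<le> \<delta>\<close> by simp
      then have "affine_of_dim (2 * (\<delta> + 1 - m)) ?Q" using affine_cube[of I a] by simp
      from BW_affine_sum[OF x \<delta> this] obtain k :: int
        where k: "(\<Sum>i\<in>?Q. x $ i) = of_int k * 2 ^ (\<delta> + 1 - m) / 2 ^ \<delta>" by blast
      have "(2::real) ^ m * 2 ^ (\<delta> + 1 - m) = 2 * 2 ^ \<delta>"
        using \<open>m \<le> \<delta>\<close> by (simp flip: power_add power_Suc)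
      then have "2 ^ m * (\<Sum>i\<in>?Q. x $ i) = of_int (2 * k)"
        unfolding k by (simp add: field_simps)
      moreover have "2 ^ m * (\<Sum>i\<in>?Q. x $ i) = of_int (\<Sum>i\<in>?Q. y i)"
        by (simp add: sum_distrib_left y)
      ultimately have "(\<Sum>i\<in>?Q. y i) = 2 * k" by linarith
      then have "even (\<Sum>i\<in>?Q. y i)" by simp
      then have "even (card {i \<in> ?Q. odd (y i)})" by (subst (asm) even_sum_iff) auto
      moreover have "{i \<in> ?Q. odd (y i)} = Y \<inter> ?Q" by (auto simp: Y_def)
      ultimately show ?thesis by simp
    qed
    moreover have "2 * m - 1 < CARD('n)" using \<delta> \<open>m \<le> \<delta>\<close> by simp
    ultimately have "2 ^ Suc (2 * m - 1) \<le> card Y" by (intro even_cubes_card) auto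
    then have "2 ^ (2 * m) \<le> card Y" using False by simp
    then have "1 \<le> real (card Y) / 2 ^ (2 * m)"
      by (simp add: le_divide_eq)
    also have "\<dots> = (\<Sum>i\<in>Y. 1 / 2 ^ (2 * m))" by simp
    also have "\<dots> \<le> (\<Sum>i\<in>Y. (of_int (y i) / 2 ^ m)\<^sup>2)"
    proof (rule sum_mono)
      fix i assume "i \<in> Y"
      then have "y i \<noteq> 0" by (auto simp: Y_def)
      then have "1 \<le> (y i)\<^sup>2" by (metis int_one_le_iff_zero_less power_eq_0_iff zero_less_power2 zero_power2)
      then have "1 \<le> (of_int (y i) :: real)\<^sup>2" by (simp add: one_le_power flip: of_int_power)
      then show "1 / 2 ^ (2 * m) \<le> (of_int (y i) / 2 ^ m :: real)\<^sup>2"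
        by (simp add: power_divide power_mult[symmetric] mult.commute divide_right_mono)
    qed
    also have "\<dots> \<le> x \<bullet> x" unfolding inner by (rule sum_mono2) auto
    finally show ?thesis .
  qed
qed

section \<open>The action of the extraspecial group on the lattice\<close>

text \<open>
  Scaling by \<open>\<surd>2\<close> exchanges the two parities: \<open>Lam p\<close> for even \<open>p\<close> is \<open>BW\<close>, and the span of
  \<open>2\<^sup>-\<^sup>m v\<^sub>A \<epsilon>\<^sub>S\<close> with \<open>dim A = 2 m + 1\<close> is \<open>\<surd>2 \<cdot> Lam 1\<close>.
\<close>

definition frame_vec :: "nat \<Rightarrow> 'n::finite omega set \<Rightarrow> 'n omega set \<Rightarrow> 'n ambient" where
  "frame_vec n A S = (1 / sqrt 2 ^ n) *\<^sub>R sign_change S (vsum A)"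

definition Lam :: "nat \<Rightarrow> 'n::finite ambient set" where
  "Lam p = int_span {frame_vec n A S | n A S. affine_of_dim n A \<and> S \<in> RM 2 \<and> even (n + p)}"

lemma frame_vec_nth:
  "frame_vec n A S $ i = (if i \<in> A then of_int (chi S i) / sqrt 2 ^ n else 0)"
  by (simp add: frame_vec_def sign_change_nth vsum_nth)

lemma frame_vec_in_Lam:
  "affine_of_dim n A \<Longrightarrow> S \<in> RM 2 \<Longrightarrow> even (n + p) \<Longrightarrow> frame_vec n A S \<in> Lam p"
  unfolding Lam_def by (rule int_span_base) blast

lemma Lam_parity: "even p \<longleftrightarrow> even q \<Longrightarrow> Lam p = Lam q"
  by (simp add: Lam_def)

lemma BW_eq_Lam: "(BW :: 'n::finite ambient set) = Lam 0"
proof -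
  have "{(1 / 2 ^ m) *\<^sub>R sign_change S (vsum A) | m A S. affine_of_dim (2 * m) A \<and> S \<in> RM 2} =
     {frame_vec n A S | n A S :: 'n omega set. affine_of_dim n A \<and> S \<in> RM 2 \<and> even (n + 0)}"
    (is "?L = ?R")
  proof (rule Set.set_eqI)
    fix v :: "'n ambient"
    have "frame_vec (2 * m) A S = (1 / 2 ^ m) *\<^sub>R sign_change S (vsum A)" for m and A S :: "'n omega set"
      by (simp add: frame_vec_def power_mult)
    then have fv: "(1 / 2 ^ m) *\<^sub>R sign_change S (vsum A) = frame_vec (2 * m) A S" for m and A S :: "'n omega set"
      by simp
    have ev: "even (n + 0) \<longleftrightarrow> (\<exists>m. n = 2 * m)" for n :: nat by auto
    show "v \<in> ?L \<longleftrightarrow> v \<in> ?R"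
      unfolding fv ev by blast
  qed
  then show ?thesis by (simp add: BW_def Lam_def)
qed

text \<open>A hyperplane separating two points of \<open>A\<close> cuts it into halves; the
  normalization of a half is larger by the factor \<open>sqrt 2\<close>.\<close>

lemma frame_vec_split:
  assumes "affine_of_dim n A" "0 < n" "(S :: 'n::finite omega set) \<in> RM 2"
  obtains m B C where "n = Suc m" "affine_of_dim m B" "affine_of_dim m C"
    "2 *\<^sub>R frame_vec n A S = sqrt 2 *\<^sub>R (frame_vec m B S + frame_vec m C S)"
proof -
  obtain W where W: "vec.subspace W" "card W = 2 ^ n" "A \<noteq> {}" 
    "\<And>x y. x \<in> A \<Longrightarrow> y \<in> A \<longleftrightarrow> x + y \<in> W"
    using affine_of_dimE[OF assms(1)] by metis
  have "card W \<noteq> 1" using W(2) assms(2) by simp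
  then have "W \<noteq> {0}" by auto
  then obtain c where c: "c \<in> W" "c \<noteq> 0" using W(1) by (auto simp: bit_vec_subspace_iff)
  have "vec.subspace {0 :: 'n omega}" by simp
  from hyperplane_separation[OF this, of c] c obtain H
    where H: "H \<in> RM 1" "0 \<notin> H" "c \<in> H" by auto
  obtain a where a: "a \<in> A" using W(3) by blast
  have ac: "a + c \<in> A" using W(4)[OF a] c by simp
  have "chi H (a + c) = - chi H a"
    unfolding RM_1_chi[OF H(1)] using H by (simp add: chi_def)
  then have "a \<in> H \<longleftrightarrow> a + c \<notin> H" by (auto simp: chi_def split: if_splits)
  then have "A \<inter> H \<noteq> {}" "A \<inter> H \<noteq> A" using a ac by blast+
  then obtain m where m: "n = Suc m" "affine_of_dim m (A \<inter> H)" "affine_of_dim m (A - H)"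
    using affine_inter_RM_1[OF assms(1) H(1)] by blast
  have "2 *\<^sub>R frame_vec n A S = sqrt 2 *\<^sub>R (frame_vec m (A \<inter> H) S + frame_vec m (A - H) S)"
    by (auto simp: vec_eq_iff frame_vec_nth m(1) field_simps)
  then show thesis using that m by blast
qed

text \<open>The scalar is \<open>sqrt 2\<close>, in the form that arises when a frame vector is
  negated. In positive dimension the two halves of \<open>A\<close> lie in the other lattice; a
  single point is the sum of two vectors on a line whose signs cancel at the second point.\<close>

lemma two_frame_vec:
  assumes A: "affine_of_dim n A" and S: "(S :: 'n::finite omega set) \<in> RM 2" and n: "even (n + p)"
  shows "(2 / sqrt 2) *\<^sub>R frame_vec n A S \<in> Lam (Suc p)"
proof (cases "n = 0")
  case False
  then obtain m B C where *: "n = Suc m" "affine_of_dim m B" "affine_of_dim m C"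
    "2 *\<^sub>R frame_vec n A S = sqrt 2 *\<^sub>R (frame_vec m B S + frame_vec m C S)"
    using frame_vec_split[OF A _ S] by blast
  have "(2 / sqrt 2) *\<^sub>R frame_vec n A S = (1 / sqrt 2) *\<^sub>R (2 *\<^sub>R frame_vec n A S)" by simp
  also have "\<dots> = frame_vec m B S + frame_vec m C S" unfolding *(4) by simp
  also have "\<dots> \<in> Lam (Suc p)"
    using frame_vec_in_Lam[OF *(2) S, of "Suc p"] frame_vec_in_Lam[OF *(3) S, of "Suc p"] n *(1)
    unfolding Lam_def by (intro int_span_add) auto
  finally show ?thesis .
next
  case True
  obtain a where a: "A = {a}"
    using card_affine[OF A] True by (auto simp: card_1_singleton_iff)
  \<comment> \<open>Any nonzero direction serves; this is the unit vector of an arbitrary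
    coordinate.\<close>
  define c :: "'n omega" where "c = axis undefined 1"
  have c0: "c \<noteq> 0" by (simp add: c_def)
  have sub: "vec.subspace {0 :: 'n omega}" by simp
  from hyperplane_separation[OF this, of c] c0 obtain H
    where H: "H \<in> RM 1" "0 \<notin> H" "c \<in> H" by auto
  define K where "K = (\<lambda>x. a + x) ` H"
  have K: "K \<in> RM 2" "a \<notin> K" "a + c \<in> K"
    using RM_mono[OF RM_translate[OF H(1), of a], of 2] H by (auto simp: K_def mem_translate_iff)
  have "affine_of_dim 1 ((\<lambda>x. a + x) ` ({0} \<union> (\<lambda>w. c + w) ` {0}))"
    using subspace_extend[OF sub, of 0 c] c0 by (intro affine_of_dimI) auto
  then have B: "affine_of_dim 1 {a, a + c}" by (simp add: insert_commute)
  have "(2 / sqrt 2) *\<^sub>R frame_vec n A S = frame_vec 1 {a, a + c} S + frame_vec 1 {a, a + c} (sym_diff S K)"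
  proof (rule iffD2[OF vec_eq_iff], rule allI)
    fix i
    consider "i = a" | "i \<noteq> a" "i = a + c" | "i \<noteq> a" "i \<noteq> a + c" by blast
    then show "((2 / sqrt 2) *\<^sub>R frame_vec n A S) $ i =
        (frame_vec 1 {a, a + c} S + frame_vec 1 {a, a + c} (sym_diff S K)) $ i"
      using K by cases (simp_all add: frame_vec_nth a True chi_sym_diff chi_def[of K])
  qed
  also have "\<dots> \<in> Lam (Suc p)"
    using frame_vec_in_Lam[OF B S, of "Suc p"] frame_vec_in_Lam[OF B RM_sym_diff[OF S K(1)], of "Suc p"] n True
    unfolding Lam_def by (intro int_span_add) auto
  finally show ?thesis .
qed

lemma Lam_0: "0 \<in> Lam p" and Lam_add: "x \<in> Lam p \<Longrightarrow> y \<in> Lam p \<Longrightarrow> x + y \<in> Lam p"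
  and Lam_neg: "x \<in> Lam p \<Longrightarrow> - x \<in> Lam p"
  and Lam_scale: "x \<in> Lam p \<Longrightarrow> of_int k *\<^sub>R x \<in> Lam p"
  unfolding Lam_def
  by (rule int_span_0 int_span_add int_span_neg int_span_scale; assumption)+

lemma Lam_induct [consumes 1, case_names base zero add scale]:
  assumes "x \<in> Lam p"
    "\<And>n A S. affine_of_dim n A \<Longrightarrow> S \<in> RM 2 \<Longrightarrow> even (n + p) \<Longrightarrow> P (frame_vec n A S)"
    "P 0" "\<And>x y. P x \<Longrightarrow> P y \<Longrightarrow> P (x + y)" "\<And>k x. P x \<Longrightarrow> P (of_int k *\<^sub>R x)"
  shows "P x"
  using assms(1) unfolding Lam_def by (induction rule: int_span_induct) (use assms in auto)

lemma sqrt_two_Lam: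
  assumes "x \<in> Lam p"
  shows "sqrt 2 *\<^sub>R x \<in> Lam (Suc p)"
  using assms
proof (induction rule: Lam_induct)
  case (base n A S)
  have "sqrt 2 = 2 / sqrt 2" by (simp add: real_div_sqrt)
  then show ?case using two_frame_vec[OF base] by metis
next
  case (scale k x)
  then show ?case using Lam_scale[OF scale, of k] by (simp add: mult.commute)
qed (simp_all add: Lam_0 Lam_add scaleR_add_right)

text \<open>The maps that act trivially on all the quotients \<open>Lam p / \<surd>2 Lam (p + 1)\<close>.\<close>

definition Lam_unipotent :: "('n::finite ambient \<Rightarrow> 'n ambient) \<Rightarrow> bool" where
  "Lam_unipotent g \<longleftrightarrow> linear g \<and> (\<forall>p. \<forall>x \<in> Lam p. (1 / sqrt 2) *\<^sub>R (g x - x) \<in> Lam (Suc p))"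

lemma Lam_unipotent_stable:
  assumes "Lam_unipotent g" "x \<in> Lam p"
  shows "g x \<in> Lam p"
proof -
  have "sqrt 2 *\<^sub>R ((1 / sqrt 2) *\<^sub>R (g x - x)) \<in> Lam (Suc (Suc p))"
    using assms by (intro sqrt_two_Lam) (auto simp: Lam_unipotent_def)
  then have "g x - x \<in> Lam p" by (simp add: Lam_parity[of "Suc (Suc p)" p])
  from Lam_add[OF this assms(2)] show ?thesis by simp
qed

lemma Lam_unipotent_comp:
  assumes "Lam_unipotent g" "Lam_unipotent h"
  shows "Lam_unipotent (g \<circ> h)"
  unfolding Lam_unipotent_def
proof (intro conjI allI ballI)
  show "linear (g \<circ> h)" using assms by (auto simp: Lam_unipotent_def intro: linear_compose)
  fix p and x :: "'a ambient" assume x: "x \<in> Lam p"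
  have "(1 / sqrt 2) *\<^sub>R (g (h x) - h x) + (1 / sqrt 2) *\<^sub>R (h x - x) \<in> Lam (Suc p)"
    using assms x Lam_unipotent_stable[OF assms(2) x] by (intro Lam_add) (auto simp: Lam_unipotent_def)
  then show "(1 / sqrt 2) *\<^sub>R ((g \<circ> h) x - x) \<in> Lam (Suc p)"
    by (simp flip: scaleR_add_right)
qed

lemma Lam_unipotentI:
  assumes "linear g"
    "\<And>n A S p. affine_of_dim n A \<Longrightarrow> S \<in> RM 2 \<Longrightarrow> even (n + p) \<Longrightarrow>
       (1 / sqrt 2) *\<^sub>R (g (frame_vec n A S) - frame_vec n A S) \<in> Lam (Suc p)"
  shows "Lam_unipotent g"
  unfolding Lam_unipotent_def
proof (intro conjI allI ballI)
  fix p and x :: "'a ambient" assume "x \<in> Lam p"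
  then show "(1 / sqrt 2) *\<^sub>R (g x - x) \<in> Lam (Suc p)"
  proof (induction rule: Lam_induct)
    case zero
    then show ?case using assms(1) by (simp add: linear_0 Lam_0)
  next
    case (add x y)
    then show ?case using Lam_add[OF add] assms(1)
      by (simp add: linear_add algebra_simps)
  next
    case (scale k x)
    then show ?case using Lam_scale[OF scale, of k] assms(1)
      by (simp add: linear_cmul algebra_simps)
  qed (rule assms(2))
qed (rule assms(1))

section \<open>Unipotent action of sign changes and translations\<close>

lemma linear_sign_change: "linear (sign_change S)"
  by (rule linearI) (simp_all add: vec_eq_iff sign_change_nth algebra_simps)

lemma translation_nth: "translation c x $ i = x $ (c + i)"
  by (simp add: translation_def bit_vec_diff add.commute)

lemma linear_translation: "linear (translation c)"
  by (rule linearI) (simp_all add: vec_eq_iff translation_nth algebra_simps)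

text \<open>If \<open>H\<close> is not constant on \<open>A\<close>, the difference is supported on
  the half \<open>A \<inter> H\<close>; the factor -2 and the division by \<open>sqrt 2\<close>
  produce exactly the normalization for one dimension less.\<close>

lemma sign_change_frame_vec:
  assumes A: "affine_of_dim n A" and S: "S \<in> RM 2" and n: "even (n + p)" and H: "(H :: 'n::finite omega set) \<in> RM 1"
  shows "(1 / sqrt 2) *\<^sub>R (sign_change H (frame_vec n A S) - frame_vec n A S) \<in> Lam (Suc p)"
  using affine_inter_RM_1[OF A H]
proof (elim disjE exE conjE)
  assume "A \<inter> H = {}"
  then have "sign_change H (frame_vec n A S) = frame_vec n A S"
    by (auto simp: vec_eq_iff sign_change_nth frame_vec_nth chi_def[of H])
  then show ?thesis by (simp add: Lam_0)
next
  assume "A \<inter> H = A"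
  then have "sign_change H (frame_vec n A S) = - frame_vec n A S"
    by (auto simp: vec_eq_iff sign_change_nth frame_vec_nth chi_def[of H])
  then have "(1 / sqrt 2) *\<^sub>R (sign_change H (frame_vec n A S) - frame_vec n A S) =
      - ((2 / sqrt 2) *\<^sub>R frame_vec n A S)"
    by (simp add: vec_eq_iff algebra_simps)
  then show ?thesis using Lam_neg[OF two_frame_vec[OF A S n]] by simp
next
  fix m assume m: "n = Suc m" "affine_of_dim m (A \<inter> H)"
  have "(1 / sqrt 2) *\<^sub>R (sign_change H (frame_vec n A S) - frame_vec n A S) = - frame_vec m (A \<inter> H) S"
    by (auto simp: vec_eq_iff sign_change_nth frame_vec_nth chi_def[of H] m(1) field_simps)
  then show ?thesis using Lam_neg[OF frame_vec_in_Lam[OF m(2) S]] m(1) n by simp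
qed

text \<open>Along a direction of \<open>A\<close> a translation acts as the sign change by the
  derivative of \<open>S\<close>, which has degree 1. Otherwise the difference lives on the doubled
  flat \<open>B\<close>, and a quadratic sign pattern \<open>T\<close> on it has to be
  found.\<close>

lemma translation_diff_frame_vec:
  assumes A: "affine_of_dim n A" and S: "S \<in> RM 2" and n: "even (n + p)"
  shows "(1 / sqrt 2) *\<^sub>R (translation c (frame_vec n A S) - frame_vec n (A :: 'n::finite omega set) S) \<in> Lam (Suc p)"
proof -
  obtain W where W: "vec.subspace W" "card W = 2 ^ n" "A \<noteq> {}"
    "\<And>x y. x \<in> A \<Longrightarrow> y \<in> A \<longleftrightarrow> x + y \<in> W"
    using affine_of_dimE[OF A] by metis
  define D where "D = sym_diff S ((\<lambda>x. c + x) ` S)"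
  have D: "D \<in> RM 1" using RM_derivative[of S 1 c] S by (simp add: D_def numeral_2_eq_2)
  have chiD: "chi D i = chi S i * chi S (c + i)" for i
    by (simp only: D_def chi_sym_diff chi_translate)
  have sub: "x + y \<in> W" if "x \<in> W" "y \<in> W" for x y
    using W that by (auto simp: bit_vec_subspace_iff)
  obtain a where a: "a \<in> A" using W by blast
  show ?thesis
  proof (cases "c \<in> W")
    case True
    have "x \<in> A \<longleftrightarrow> c + x \<in> A" for x
      using sub[OF True, of "a + x"] sub[OF True, of "a + (c + x)"] W(4)[OF a]
      by (metis add.left_commute bit_vec_add_left_cancel)
    then have "translation c (frame_vec n A S) = sign_change D (frame_vec n A S)"
      by (simp add: vec_eq_iff translation_nth sign_change_nth frame_vec_nth chiD mult.assoc mult.left_commute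
          flip: of_int_mult)
    then show ?thesis using sign_change_frame_vec[OF A S n D] by simp
  next
    case False
    obtain H where H: "H \<in> RM 1" "W \<inter> H = {}" "\<And>x. x \<in> W \<Longrightarrow> c + x \<in> H"
      using hyperplane_separation[OF W(1) False] by metis
    define K where "K = (\<lambda>x. a + x) ` H"
    have K: "K \<in> RM 1" unfolding K_def by (rule RM_translate[OF H(1)])
    have KA: "x \<notin> K" if "x \<in> A" for x
      using that W(4)[OF a, of x] H(2) by (auto simp: K_def mem_translate_iff)
    have KcA: "x \<in> K" if "c + x \<in> A" for x
      using that W(4)[OF a, of "c + x"] H(3)[of "a + (c + x)"]
      by (simp add: K_def mem_translate_iff add.left_commute)
    \<comment> \<open>\<open>K\<close> misses \<open>A\<close> and contains its translate by
      \<open>c\<close>. So \<open>T\<close> reverses \<open>S\<close> on \<open>A\<close>; on the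
      translate the reversals by \<open>UNIV\<close> and \<open>K\<close> cancel, and
      \<open>K \<inter> D\<close> turns the signs of \<open>S\<close> into the translated
      ones.\<close>
    define T where "T = sym_diff (sym_diff (sym_diff S UNIV) K) (K \<inter> D)"
    have T: "T \<in> RM 2"
      unfolding T_def by (intro RM_sym_diff S RM_UNIV RM_1_inter D K RM_mono[OF K]) simp
    have chiT: "chi T i = - chi S i * chi K i * chi (K \<inter> D) i" for i
      unfolding T_def chi_sym_diff by (simp add: chi_def[of UNIV])
    have chiTA: "chi T i = - chi S i" if "i \<in> A" for i
      using KA[OF that] unfolding chiT by (simp add: chi_def)
    have chiTcA: "chi T i = chi S (c + i)" if "c + i \<in> A" for i
    proof -
      have "chi (K \<inter> D) i = chi D i" using KcA[OF that] by (simp add: chi_def)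
      then show ?thesis using KcA[OF that] by (simp add: chiT chiD chi_def[of K])
    qed
    define B where "B = A \<union> (\<lambda>x. c + x) ` A"
    have "B = (\<lambda>w. a + w) ` (W \<union> (\<lambda>w. c + w) ` W)"
      unfolding B_def set_eq_iff Un_iff mem_translate_iff W(4)[OF a] add.left_commute[of c a] by blast
    then have B: "affine_of_dim (Suc n) B"
      using affine_of_dimI[OF subspace_extend[OF W(1,2) False]] by simp
    have eq: "(1 / sqrt 2) *\<^sub>R (translation c (frame_vec n A S) - frame_vec n A S) = frame_vec (Suc n) B T"
    proof (rule iffD2[OF vec_eq_iff], rule allI)
      fix i
      have "\<not> (i \<in> A \<and> c + i \<in> A)" using KA KcA by blast
      then consider "i \<in> A" "c + i \<notin> A" | "i \<notin> A" "c + i \<in> A" | "i \<notin> A" "c + i \<notin> A" by blast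
      then show "((1 / sqrt 2) *\<^sub>R (translation c (frame_vec n A S) - frame_vec n A S)) $ i = frame_vec (Suc n) B T $ i"
        by cases (simp_all add: translation_nth frame_vec_nth B_def mem_translate_iff chiTA chiTcA)
    qed
    show ?thesis unfolding eq using n by (intro frame_vec_in_Lam B T) simp
  qed
qed

lemma Lam_unipotent_sign_change: "S \<in> RM 1 \<Longrightarrow> Lam_unipotent (sign_change S)"
  by (intro Lam_unipotentI linear_sign_change sign_change_frame_vec)

lemma Lam_unipotent_translation: "Lam_unipotent (translation c)"
  by (intro Lam_unipotentI linear_translation translation_diff_frame_vec)

section \<open>Monomial form of the extraspecial group\<close>

definition monomial :: "'n::finite omega set \<Rightarrow> 'n omega \<Rightarrow> 'n ambient \<Rightarrow> 'n ambient" where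
  "monomial S c x = sign_change S (translation c x)"

lemma monomial_nth: "monomial S c x $ i = of_int (chi S i) * x $ (c + i)"
  by (simp add: monomial_def sign_change_nth translation_nth)

lemma linear_monomial: "linear (monomial S c)"
  by (rule linearI) (simp_all add: vec_eq_iff monomial_nth algebra_simps)

lemma sum_translate: "(\<Sum>i\<in>UNIV. f (c + i)) = (\<Sum>i\<in>UNIV. f (i :: 'n::finite omega))"
proof -
  have "bij (\<lambda>i::'n omega. c + i)"
    by (rule bijI') (auto intro: exI[of _ "c + _"])
  then show ?thesis by (rule sum.reindex_bij_betw)
qed

lemma orthogonal_monomial: "orthogonal_transformation (monomial S (c :: 'n::finite omega))"
  unfolding orthogonal_transformation_def
proof (intro conjI allI linear_monomial)
  fix x y :: "'n ambient"
  have "monomial S c x \<bullet> monomial S c y = (\<Sum>i\<in>UNIV. x $ (c + i) * y $ (c + i))"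
    unfolding inner_vec_def by (rule sum.cong) (auto simp: monomial_nth chi_def)
  then show "monomial S c x \<bullet> monomial S c y = x \<bullet> y"
    using sum_translate[of "\<lambda>i. x $ i * y $ i" c] by (simp add: inner_vec_def)
qed

lemma monomial_comp:
  assumes "(T :: 'n::finite omega set) \<in> RM 1"
  obtains U where "U \<in> RM 1" "\<And>x. monomial S c (monomial T e x) = monomial (sym_diff S U) (c + e) x"
proof
  show "(\<lambda>x. c + x) ` T \<in> RM 1" by (rule RM_translate[OF assms])
  show "monomial S c (monomial T e x) = monomial (sym_diff S ((\<lambda>x. c + x) ` T)) (c + e) x" for x
    by (simp add: vec_eq_iff monomial_nth chi_sym_diff chi_translate add.left_commute[of e c] add.assoc)
qed

lemma group_OV: "group (OV :: ('n::finite ambient \<Rightarrow> 'n ambient) monoid)"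
proof (rule groupI)
  fix x y z :: "'n ambient \<Rightarrow> 'n ambient"
  assume x: "x \<in> carrier OV"
  then have ox: "orthogonal_transformation x" by (simp add: OV_def)
  show "\<exists>y\<in>carrier OV. y \<otimes>\<^bsub>OV\<^esub> x = \<one>\<^bsub>OV\<^esub>"
    by (rule bexI[of _ "inv_into UNIV x"])
      (simp_all add: OV_def orthogonal_transformation_inv[OF ox] surj_iff[symmetric] orthogonal_transformation_surj[OF ox])
qed (auto simp: OV_def orthogonal_transformation_compose comp_assoc simp: id_def)

lemma inv_OV:
  assumes "orthogonal_transformation g" "\<And>x. g (g x) = x"
  shows "inv\<^bsub>OV\<^esub> g = g"
  using assms by (intro group.inv_equality[OF group_OV]) (auto simp: OV_def fun_eq_iff)

text \<open>Moving sign changes past translations only translates their sets, so products stay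
  monomial; the generators are involutions, so inverses add nothing.\<close>

lemma RR_eq: "(RR :: ('n::finite ambient \<Rightarrow> 'n ambient) set) = {monomial S c | S c. S \<in> RM 1}"
proof (rule Set.set_eqI, rule iffI)
  have sc: "sign_change S = monomial S 0" and tc: "translation c = monomial {} c" for S and c :: "'n omega"
    by (simp_all add: vec_eq_iff fun_eq_iff monomial_nth sign_change_nth translation_nth chi_def)
  fix r :: "'n ambient \<Rightarrow> 'n ambient"
  show "r \<in> {monomial S c | S c. S \<in> RM 1}" if "r \<in> RR"
    using that unfolding RR_def
  proof (induction rule: generate.induct)
    case one
    have "id = monomial {} (0 :: 'n omega)"
      by (simp add: vec_eq_iff fun_eq_iff monomial_nth chi_def)
    then have "id \<in> {monomial S (c :: 'n omega) | S c. S \<in> RM 1}"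
      using RM.empty by blast
    then show ?case unfolding OV_def by (simp only: monoid.select_convs)
  next
    case (incl h)
    then show ?case using RM.empty by (auto simp: sc tc)
  next
    case (inv h)
    then have *: "\<exists>S c. S \<in> RM 1 \<and> h = monomial S c \<and> (\<forall>x. h (h x) = x)"
    proof (elim UnE CollectE exE conjE)
      fix S assume "h = sign_change S" "S \<in> RM 1"
      then show ?thesis by (intro exI[of _ S] exI[of _ 0]) (simp add: sc vec_eq_iff monomial_nth flip: of_int_mult mult.assoc)
    next
      fix c assume "h = translation c"
      then show ?thesis
        by (intro exI[of _ "{}"] exI[of _ c]) (simp add: tc vec_eq_iff monomial_nth chi_def RM.empty)
    qed
    then have "inv\<^bsub>OV\<^esub> h = h" by (intro inv_OV) (auto simp: orthogonal_monomial)
    then show ?case using * by auto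
  next
    case (eng h1 h2)
    then obtain S1 c1 S2 c2 where "S1 \<in> RM 1" "h1 = monomial S1 c1" "S2 \<in> RM 1" "h2 = monomial S2 c2"
      by blast
    moreover obtain U where "U \<in> RM 1" "\<And>x. monomial S2 c2 (monomial S1 c1 x) = monomial (sym_diff S2 U) (c2 + c1) x"
      using monomial_comp[OF \<open>S1 \<in> RM 1\<close>] by blast
    ultimately have "h1 \<otimes>\<^bsub>OV\<^esub> h2 = monomial (sym_diff S2 U) (c2 + c1) \<and> sym_diff S2 U \<in> RM 1"
      by (simp add: OV_def fun_eq_iff RM_sym_diff)
    then show ?case by blast
  qed
  show "r \<in> RR" if r: "r \<in> {monomial S c | S c. S \<in> RM 1}"
  proof -
    obtain S c where S: "r = monomial S c" "S \<in> RM 1" using r by blast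
    have "translation c \<otimes>\<^bsub>OV\<^esub> sign_change S \<in> RR"
      unfolding RR_def using S(2) by (intro generate.eng generate.incl) auto
    then show ?thesis by (simp add: OV_def S(1) comp_def monomial_def[abs_def])
  qed
qed

lemma RR_unipotent: "r \<in> RR \<Longrightarrow> Lam_unipotent r"
  using Lam_unipotent_comp[OF Lam_unipotent_sign_change Lam_unipotent_translation]
  by (auto simp: RR_eq monomial_def[abs_def] comp_def)

lemma RR_BW:
  assumes "r \<in> RR" "x \<in> BW"
  shows "r x \<in> BW"
  using Lam_unipotent_stable[OF RR_unipotent] assms by (auto simp: BW_eq_Lam)

text \<open>Each unipotent factor contributes \<open>sqrt 2\<close> and changes the parity of the
  lattice; two of them contribute 2 and return to \<open>BW\<close>.\<close>

lemma RR_commutator: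
  assumes "r \<in> RR" "q \<in> RR" "x \<in> BW"
  shows "(1 / 2) *\<^sub>R (r (q x - x) - (q x - x)) \<in> BW"
proof -
  have lin: "linear r" using RR_unipotent[OF assms(1)] by (simp add: Lam_unipotent_def)
  have "(1 / sqrt 2) *\<^sub>R (q x - x) \<in> Lam (Suc 0)"
    using RR_unipotent[OF assms(2)] assms(3) by (simp add: Lam_unipotent_def BW_eq_Lam)
  then have "(1 / sqrt 2) *\<^sub>R (r ((1 / sqrt 2) *\<^sub>R (q x - x)) - (1 / sqrt 2) *\<^sub>R (q x - x)) \<in> Lam (Suc (Suc 0))"
    using RR_unipotent[OF assms(1)] by (simp add: Lam_unipotent_def)
  moreover have "(1 / sqrt 2) *\<^sub>R (r ((1 / sqrt 2) *\<^sub>R (q x - x)) - (1 / sqrt 2) *\<^sub>R (q x - x)) =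
      (1 / 2) *\<^sub>R (r (q x - x) - (q x - x))"
    by (simp add: linear_cmul[OF lin] flip: scaleR_diff_right)
  ultimately show ?thesis
    by (simp add: BW_eq_Lam Lam_parity[of "Suc (Suc 0)" 0])
qed

lemma RR_orthogonal: "r \<in> RR \<Longrightarrow> orthogonal_transformation r"
  by (auto simp: RR_eq orthogonal_monomial)

lemma RR_linear: "r \<in> RR \<Longrightarrow> linear r"
  by (auto simp: RR_eq linear_monomial)

lemma RR_comp: 
  assumes "r \<in> RR" "q \<in> RR"
  shows "r \<circ> q \<in> RR"
proof -
  obtain S c T e where "S \<in> RM 1" "r = monomial S c" "T \<in> RM 1" "q = monomial T e"
    using assms by (auto simp: RR_eq)
  moreover obtain U where "U \<in> RM 1" "\<And>x. monomial S c (monomial T e x) = monomial (sym_diff S U) (c + e) x"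
    using monomial_comp[OF \<open>T \<in> RM 1\<close>] by blast
  ultimately have "r \<circ> q = monomial (sym_diff S U) (c + e) \<and> sym_diff S U \<in> RM 1"
    by (simp add: fun_eq_iff RM_sym_diff)
  then show ?thesis by (auto simp: RR_eq)
qed

lemma RR_id: "id \<in> RR"
  unfolding RR_def using generate.one[of OV] by (simp add: OV_def)

lemma RR_uminus: "uminus \<in> RR"
proof -
  have "uminus = monomial UNIV (0 :: 'a omega)"
    by (simp add: fun_eq_iff vec_eq_iff monomial_nth chi_def)
  then show ?thesis by (auto simp: RR_eq RM_UNIV)
qed

lemma RR_neg: "r \<in> RR \<Longrightarrow> (\<lambda>x. - r x) \<in> RR"
  using RR_comp[OF RR_uminus] by (simp add: comp_def)

text \<open>Translating an affine function alters its signs by a constant only, so commutators are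
  \<plusminus>1, as in an extraspecial group.\<close>

lemma RR_commute:
  assumes "r \<in> RR" "q \<in> RR"
  obtains \<sigma> :: real where "\<sigma> = 1 \<or> \<sigma> = -1" "\<And>x. r (q x) = \<sigma> *\<^sub>R q (r x)"
proof -
  obtain S c T e where r: "S \<in> RM 1" "r = monomial S c" "T \<in> RM 1" "q = monomial T e"
    using assms by (auto simp: RR_eq)
  let ?k = "chi S e * chi S 0 * (chi T c * chi T 0)"
  have "r (q x) = of_int ?k *\<^sub>R q (r x)" for x
    by (simp add: vec_eq_iff r(2,4) monomial_nth RM_1_chi[OF r(1)] RM_1_chi[OF r(3)] ac_simps flip: of_int_mult)
  moreover have "?k = 1 \<or> ?k = -1" by (auto simp: chi_def)
  then have "of_int ?k = (1::real) \<or> of_int ?k = (-1::real)" by (metis of_int_1 of_int_minus)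
  ultimately show thesis using that by blast
qed

lemma RR_square:
  assumes "r \<in> RR"
  obtains \<sigma> :: real where "\<sigma> = 1 \<or> \<sigma> = -1" "\<And>x. r (r x) = \<sigma> *\<^sub>R x"
proof -
  obtain S c where r: "S \<in> RM 1" "r = monomial S c"
    using assms by (auto simp: RR_eq)
  let ?k = "chi S c * chi S 0"
  have "r (r x) = of_int ?k *\<^sub>R x" for x
    by (simp add: vec_eq_iff r(2) monomial_nth RM_1_chi[OF r(1)] ac_simps flip: of_int_mult)
  moreover have "?k = 1 \<or> ?k = -1" by (auto simp: chi_def)
  then have "of_int ?k = (1::real) \<or> of_int ?k = (-1::real)" by (metis of_int_1 of_int_minus)
  ultimately show thesis using that by blast
qed

lemma finite_RR: "finite (RR :: ('n::finite ambient \<Rightarrow> 'n ambient) set)"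
proof -
  have "RR \<subseteq> (\<lambda>(S, c). monomial S c) ` (UNIV :: ('n omega set \<times> 'n omega) set)"
    by (auto simp: RR_eq)
  then show ?thesis by (rule finite_subset) simp
qed

lemma card_RM_1: "card (RM 1 :: 'n::finite omega set set) \<le> 2 ^ (CARD('n) + 1)"
proof -
  define F where "F S = (chi S 0 = 1, {i. chi S (axis i 1) = 1})" for S :: "'n omega set"
  have "inj_on F (RM 1)"
  proof (rule inj_onI)
    fix S T :: "'n omega set" assume ST: "S \<in> RM 1" "T \<in> RM 1" "F S = F T"
    have pm: "chi S i = 1 \<or> chi S i = -1" for S and i :: "'n omega" by (auto simp: chi_def)
    have "chi S 0 = 1 \<longleftrightarrow> chi T 0 = 1" "chi S (axis i 1) = 1 \<longleftrightarrow> chi T (axis i 1) = 1" for i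
      using ST(3) unfolding F_def by (auto simp: set_eq_iff)
    then have z: "chi S 0 = chi T 0" and ax: "chi S (axis i 1) = chi T (axis i 1)" for i
      using pm by metis+
    let ?W = "{x. chi S x = chi T x}"
    have "vec.subspace ?W"
      using z by (auto simp: bit_vec_subspace_iff RM_1_chi[OF ST(1)] RM_1_chi[OF ST(2)])
    moreover have "cart_basis \<subseteq> ?W" using ax by (auto simp: cart_basis_def)
    ultimately have "vec.span cart_basis \<subseteq> ?W" by (rule vec.span_minimal[rotated])
    then have "chi S = chi T" by (auto simp: fun_eq_iff)
    then show "S = T" by (simp add: chi_eq_iff)
  qed
  then have "card (RM 1 :: 'n omega set set) \<le> card (UNIV :: (bool \<times> 'n set) set)"
    by (rule card_inj_on_le) auto
  also have "\<dots> = 2 ^ (CARD('n) + 1)"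
    by (simp add: card_UNIV_bool card_set)
  finally show ?thesis .
qed

section \<open>The base vector, its stabilizer and Schur's lemma\<close>

definition v0 :: "'n::finite ambient" where "v0 = axis 0 1"

lemma monomial_v0_nth: "monomial S c v0 $ i = (if i = c then of_int (chi S i) else 0)"
proof -
  have "c + i = 0 \<longleftrightarrow> i = c" by (metis add.right_neutral bit_vec_add_left_cancel bit_vec_add_self)
  then show ?thesis by (simp add: monomial_nth v0_def axis_def)
qed

lemma card_stab_v0:
  "card {r \<in> RR. r v0 = v0 \<or> r v0 = - (v0 :: 'n::finite ambient)} \<le> 2 ^ (CARD('n) + 1)"
proof -
  have "{r \<in> RR. r v0 = v0 \<or> r v0 = - (v0 :: 'n ambient)} \<subseteq> (\<lambda>S. monomial S 0) ` RM 1"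
  proof
    fix r assume "r \<in> {r \<in> RR. r v0 = v0 \<or> r v0 = - (v0 :: 'n ambient)}"
    then obtain S c where r: "S \<in> RM 1" "r = monomial S c" and rv: "r v0 = v0 \<or> r v0 = - v0"
      by (auto simp: RR_eq)
    have "r v0 $ c = of_int (chi S c)" by (simp add: r monomial_v0_nth)
    then have "v0 $ c \<noteq> 0" using rv by (auto simp: chi_def split: if_splits)
    then have "c = 0" by (auto simp: v0_def axis_def split: if_splits)
    then show "r \<in> (\<lambda>S. monomial S 0) ` RM 1" using r by blast
  qed
  then have "card {r \<in> RR. r v0 = v0 \<or> r v0 = - (v0 :: 'n ambient)} \<le> card ((\<lambda>S. monomial S (0 :: 'n omega)) ` RM 1)"
    by (rule card_mono[rotated]) simp
  also have "\<dots> \<le> card (RM 1 :: 'n omega set set)" by (rule card_image_le) simp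
  finally show ?thesis using card_RM_1[where 'n = 'n] by linarith
qed

lemma v0_in_BW: "(v0 :: 'n::finite ambient) \<in> BW"
proof -
  have "frame_vec 0 {0} {} = (v0 :: 'n ambient)"
    by (auto simp: vec_eq_iff frame_vec_nth v0_def axis_def chi_def)
  moreover have "frame_vec 0 {0 :: 'n omega} {} \<in> Lam 0"
    by (intro frame_vec_in_Lam affine_singleton RM.empty) simp
  ultimately show ?thesis by (simp only: BW_eq_Lam)
qed

lemma v0_inner: "v0 \<bullet> v0 = 1"
  by (simp add: v0_def inner_axis_axis)

text \<open>For \<open>i \<noteq> 0\<close> some hyperplane contains \<open>i\<close> and misses the
  origin; its sign change fixes \<open>v0\<close> and forces the coordinate of \<open>x\<close> at
  \<open>i\<close> to vanish.\<close>

lemma RR_fixed_v0: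
  assumes "\<And>r. r \<in> RR \<Longrightarrow> r v0 = v0 \<Longrightarrow> r x = (x :: 'n::finite ambient)"
  shows "x = (x $ 0) *\<^sub>R v0"
proof (rule iffD2[OF vec_eq_iff], rule allI)
  fix i :: "'n omega"
  show "x $ i = ((x $ 0) *\<^sub>R v0) $ i"
  proof (cases "i = 0")
    case False
    then obtain j where j: "i $ j \<noteq> 0" by (metis vec_eq_iff zero_index)
    then have "i $ j = 1" by (metis bit.exhaust)
    define H where "H = cube {j} (\<lambda>_. 1)"
    have H: "H \<in> RM 1" unfolding H_def
      by (rule RM_affine[OF affine_cube]) simp
    have "i \<in> H" "0 \<notin> H" using \<open>i $ j = 1\<close> by (auto simp: H_def cube_def)
    have "monomial H 0 v0 $ l = v0 $ l" for l
      using \<open>0 \<notin> H\<close> by (cases "l = 0") (simp_all add: monomial_v0_nth, simp_all add: v0_def axis_def chi_def)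
    then have "monomial H 0 v0 = v0" by (simp add: vec_eq_iff)
    then have "monomial H 0 x = x" using assms H by (auto simp: RR_eq)
    then have "monomial H 0 x $ i = x $ i" by simp
    then have "x $ i = 0" using \<open>i \<in> H\<close> by (simp add: monomial_nth chi_def)
    then show ?thesis using False by (simp add: v0_def axis_def)
  qed (simp add: v0_def)
qed

lemma RR_transitive: "\<exists>r\<in>RR. r v0 = axis c (1::real)"
proof
  show "monomial {} c \<in> RR" by (auto simp: RR_eq RM.empty)
  show "monomial {} c v0 = axis c 1" by (auto simp: vec_eq_iff monomial_v0_nth chi_def axis_def)
qed

text \<open>Schur's lemma for \<open>RR\<close>: \<open>q\<close> preserves the line of
  \<open>v0\<close>, the fixed space of the stabilizer of \<open>v0\<close>, and transitivity on the
  axes spreads the scalar.\<close>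

lemma centralizer_RR:
  fixes q :: "'n::finite ambient \<Rightarrow> 'n ambient"
  assumes lin: "linear q" and comm: "\<And>r x. r \<in> RR \<Longrightarrow> q (r x) = r (q x)"
  obtains c where "\<And>x. q x = c *\<^sub>R x"
proof -
  define c where "c = q v0 $ 0"
  have q0: "q v0 = c *\<^sub>R v0"
    unfolding c_def by (rule RR_fixed_v0) (metis comm)
  have qi: "q (axis i 1) = c *\<^sub>R axis i 1" for i
  proof -
    obtain r where r: "r \<in> RR" "r v0 = axis i (1::real)" using RR_transitive by blast
    have "q (r v0) = r (q v0)" by (rule comm[OF r(1)])
    then show ?thesis using r RR_linear[OF r(1)] by (simp add: q0 linear_cmul)
  qed
  have "q x = c *\<^sub>R x" for x
  proof -
    have x: "x = (\<Sum>i\<in>UNIV. x $ i *\<^sub>R axis i 1)"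
      using basis_expansion[of x] by (simp add: scalar_mult_eq_scaleR)
    have "q x = (\<Sum>i\<in>UNIV. x $ i *\<^sub>R q (axis i 1))"
      by (subst x) (simp add: linear_sum[OF lin] linear_cmul[OF lin])
    also have "\<dots> = c *\<^sub>R (\<Sum>i\<in>UNIV. x $ i *\<^sub>R axis i 1)"
      by (simp add: qi scaleR_sum_right mult.commute)
    finally show ?thesis using x by simp
  qed
  then show thesis using that by blast
qed

section \<open>Frame vectors\<close>

definition stab :: "'n::finite ambient \<Rightarrow> ('n ambient \<Rightarrow> 'n ambient) set" where
  "stab w = {r \<in> RR. r w = w \<or> r w = - w}"

text \<open>\<open>h\<close> is the inverse of \<open>g\<close>, kept as a parameter so that both
  conjugations are explicit.\<close>

definition normalizes_RR ::
    "('n::finite ambient \<Rightarrow> 'n ambient) \<Rightarrow> ('n ambient \<Rightarrow> 'n ambient) \<Rightarrow> bool" where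
  "normalizes_RR g h \<longleftrightarrow> orthogonal_transformation g \<and> (\<forall>x. g (h x) = x) \<and> (\<forall>x. h (g x) = x) \<and>
     (\<forall>r\<in>RR. (\<lambda>x. g (r (h x))) \<in> RR \<and> (\<lambda>x. h (r (g x))) \<in> RR)"

text \<open>These unit vectors of the lattice are indistinguishable from \<open>v0\<close> for
  \<open>RR\<close>: facts about the stabilizer of \<open>v0\<close> transfer by
  conjugation.\<close>

definition frame_vector :: "'n::finite ambient \<Rightarrow> bool" where
  "frame_vector w \<longleftrightarrow> w \<in> BW \<and> (\<exists>g h. normalizes_RR g h \<and> w = g v0)"

lemma frame_vector_inner: "frame_vector w \<Longrightarrow> w \<bullet> w = 1"
  by (auto simp: frame_vector_def normalizes_RR_def orthogonal_transformation_def v0_inner)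

lemma frame_vector_nonzero: "frame_vector w \<Longrightarrow> w \<noteq> 0"
  using frame_vector_inner by fastforce

lemma card_stab:
  assumes "frame_vector (w :: 'n::finite ambient)"
  shows "card (stab w) \<le> 2 ^ (CARD('n) + 1)"
proof -
  obtain g h where g: "normalizes_RR g h" "w = g v0" using assms by (auto simp: frame_vector_def)
  have gh: "g (h x) = x" "h (g x) = x" for x using g by (auto simp: normalizes_RR_def)
  have lin: "linear g" using g by (simp add: normalizes_RR_def orthogonal_transformation_def)
  have hneg: "h (- x) = - h x" for x
    by (metis gh lin linear_neg)
  have "inj_on (\<lambda>r x. h (r (g x))) (stab w)"
    by (rule inj_onI) (metis (no_types, opaque_lifting) ext gh)
  moreover have "(\<lambda>r x. h (r (g x))) ` stab w \<subseteq> {r \<in> RR. r v0 = v0 \<or> r v0 = - v0}"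
    using g gh hneg by (auto simp: stab_def normalizes_RR_def)
  ultimately have "card (stab w) \<le> card {r \<in> RR. r v0 = v0 \<or> r v0 = - (v0 :: 'n ambient)}"
    by (rule card_inj_on_le) (simp add: finite_RR)
  then show ?thesis using card_stab_v0[where 'n = 'n] by linarith
qed

lemma finite_stab: "finite (stab w)"
  by (simp add: stab_def finite_RR)

lemma frame_vector_fixed:
  assumes w: "frame_vector w" and x: "\<And>r. r \<in> RR \<Longrightarrow> r w = w \<Longrightarrow> r x = x"
  obtains c where "x = c *\<^sub>R w"
proof -
  obtain g h where g: "normalizes_RR g h" "w = g v0" using w by (auto simp: frame_vector_def)
  have gh: "g (h x) = x" "h (g x) = x" for x using g by (auto simp: normalizes_RR_def)
  have lin: "linear g" using g by (simp add: normalizes_RR_def orthogonal_transformation_def)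
  have "r (h x) = h x" if r: "r \<in> RR" "r v0 = v0" for r
  proof -
    have "(\<lambda>x. g (r (h x))) \<in> RR" using g r by (auto simp: normalizes_RR_def)
    from x[OF this] have "g (r (h x)) = x" using r gh g by simp
    then show ?thesis using gh by metis
  qed
  then obtain c where "h x = c *\<^sub>R v0" using RR_fixed_v0[of "h x"] by metis
  then have "x = c *\<^sub>R w" using gh lin g(2) by (metis linear_cmul)
  then show thesis using that by blast
qed

text \<open>Elements of \<open>RR\<close> commute up to sign, and two operators with a common
  eigenvector for nonzero eigenvalues cannot anticommute.\<close>

lemma stab_commute:
  assumes "w \<noteq> 0" "r \<in> stab w" "q \<in> stab w"
  shows "r (q x) = q (r x)"
proof -
  have RR: "r \<in> RR" "q \<in> RR" using assms by (auto simp: stab_def)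
  obtain \<sigma> where \<sigma>: "\<sigma> = 1 \<or> \<sigma> = -1" "\<And>x. r (q x) = \<sigma> *\<^sub>R q (r x)"
    using RR_commute[OF RR] by blast
  have neg: "r (- w) = - r w" "q (- w) = - q w" using RR RR_linear linear_neg by blast+
  have "r (q w) = q (r w)" using assms neg by (auto simp: stab_def)
  moreover have "q (r w) \<noteq> 0" using assms neg by (auto simp: stab_def)
  moreover have "q (r w) + q (r w) = 2 *\<^sub>R q (r w)" by (simp add: scaleR_2)
  ultimately have "\<sigma> \<noteq> -1" using \<sigma>(2)[of w]
    by (metis scaleR_minus_left scaleR_one add.right_inverse scaleR_eq_0_iff zero_neq_numeral)
  then show ?thesis using \<sigma> by auto
qed

lemma orthogonal_eigenvalue:
  assumes "orthogonal_transformation r" "r w = c *\<^sub>R w" "w \<noteq> 0"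
  shows "c = 1 \<or> c = -1"
proof -
  have "r w \<bullet> r w = w \<bullet> w" using assms(1) by (simp add: orthogonal_transformation_def)
  then have "c * c = 1" using assms(2,3) by simp
  then show ?thesis by (simp add: square_eq_1_iff)
qed

text \<open>As \<open>r w\<close> is not a multiple of \<open>w\<close>,
  \<open>frame_vector_fixed\<close> supplies an element that fixes \<open>w\<close> and moves
  \<open>r w\<close>; commuting with \<open>r\<close> up to sign, it must anticommute.\<close>

lemma anticommuting_fixer:
  assumes w: "frame_vector w" and r: "r \<in> RR" "r \<notin> stab w"
  obtains a where "a \<in> RR" "a w = w" "\<And>x. a (r x) = - r (a x)"
proof -
  have "\<exists>a\<in>RR. a w = w \<and> a (r w) \<noteq> r w"
  proof (rule ccontr)
    assume "\<not> ?thesis"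
    then obtain c where c: "r w = c *\<^sub>R w" using frame_vector_fixed[OF w] by metis
    from orthogonal_eigenvalue[OF RR_orthogonal[OF r(1)] c frame_vector_nonzero[OF w]] c r
    show False by (auto simp: stab_def)
  qed
  then obtain a where a: "a \<in> RR" "a w = w" "a (r w) \<noteq> r w" by blast
  obtain \<sigma> where \<sigma>: "\<sigma> = 1 \<or> \<sigma> = -1" "\<And>x. a (r x) = \<sigma> *\<^sub>R r (a x)"
    using RR_commute[OF a(1) r(1)] by blast
  then have "\<sigma> = -1" using a by (metis scaleR_one)
  then show thesis using that a \<sigma> by simp
qed

text \<open>Anticommutation makes the map an involution. It conjugates \<open>r\<close> to
  \<open>\<plusminus>r\<close> if \<open>a\<close> and \<open>z\<close> commute with
  \<open>r\<close> up to the same sign, and to \<open>\<plusminus>r z a\<close> otherwise: a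
  transvection modulo the center.\<close>

lemma normalizes_RR_reflection:
  assumes a: "a \<in> RR" "\<And>x. a (a x) = x" and z: "z \<in> RR" "\<And>x. z (z x) = x"
    and az: "\<And>x. a (z x) = - z (a x)"
  shows "normalizes_RR (\<lambda>x. (1 / sqrt 2) *\<^sub>R (a x + z x)) (\<lambda>x. (1 / sqrt 2) *\<^sub>R (a x + z x))"
proof -
  let ?h = "\<lambda>x. (1 / sqrt 2) *\<^sub>R (a x + z x)"
  note lin = RR_linear[OF a(1)] RR_linear[OF z(1)]
  note la = linear_add[OF lin(1)] linear_cmul[OF lin(1)] linear_neg[OF lin(1)]
  note lz = linear_add[OF lin(2)] linear_cmul[OF lin(2)] linear_neg[OF lin(2)]
  have lh: "linear ?h"
    by (rule linearI) (simp_all add: la lz algebra_simps)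
  have hh: "?h (?h x) = x" for x
  proof -
    have "?h (?h x) = (1 / 2) *\<^sub>R (x + x)"
      by (simp add: la lz a z az algebra_simps)
    then show ?thesis by (simp flip: scaleR_2)
  qed
  have oa: "a x \<bullet> a y = x \<bullet> y" and oz: "z x \<bullet> z y = x \<bullet> y" for x y
    using RR_orthogonal[OF a(1)] RR_orthogonal[OF z(1)] by (auto simp: orthogonal_transformation_def)
  have "?h x \<bullet> ?h y = x \<bullet> y" for x y
  proof -
    have "a x \<bullet> z y = z (a x) \<bullet> y" using oz[of "a x" "z y"] oz[of "z (a x)" y] z by metis
    moreover have "z x \<bullet> a y = - (z (a x) \<bullet> y)" using oa[of "z x" "a y"] oa[of "a (z x)" y] a az by (metis inner_minus_left)
    ultimately show ?thesis by (simp add: inner_add_left inner_add_right oa oz field_simps)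
  qed
  then have oh: "orthogonal_transformation ?h" using lh by (simp add: orthogonal_transformation_def)
  have "(\<lambda>x. ?h (r (?h x))) \<in> RR" if r: "r \<in> RR" for r
  proof -
    note lr = linear_add[OF RR_linear[OF r]] linear_cmul[OF RR_linear[OF r]] linear_neg[OF RR_linear[OF r]]
    obtain \<alpha> where \<alpha>: "\<alpha> = 1 \<or> \<alpha> = -1" "\<And>x. a (r x) = \<alpha> *\<^sub>R r (a x)"
      using RR_commute[OF a(1) r] by blast
    obtain \<beta> where \<beta>: "\<beta> = 1 \<or> \<beta> = -1" "\<And>x. z (r x) = \<beta> *\<^sub>R r (z x)"
      using RR_commute[OF z(1) r] by blast
    have "?h (r (?h x)) = (1 / 2) *\<^sub>R ((\<alpha> + \<beta>) *\<^sub>R r x + (\<beta> - \<alpha>) *\<^sub>R r (z (a x)))" for x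
      by (simp add: la lz lr \<alpha>(2) \<beta>(2) a z az algebra_simps)
    then have eq: "(\<lambda>x. ?h (r (?h x))) = (\<lambda>x. (1 / 2) *\<^sub>R ((\<alpha> + \<beta>) *\<^sub>R r x + (\<beta> - \<alpha>) *\<^sub>R r (z (a x))))"
      by blast
    have rza: "(\<lambda>x. r (z (a x))) \<in> RR" using RR_comp[OF r RR_comp[OF z(1) a(1)]] by (simp add: comp_def)
    show ?thesis unfolding eq
      using \<alpha>(1) \<beta>(1) r rza RR_neg[OF r] RR_neg[OF rza] by (elim disjE) simp_all
  qed
  then show ?thesis using oh hh by (simp add: normalizes_RR_def)
qed

lemma normalizes_RR_comp:
  assumes "normalizes_RR g h" "normalizes_RR p q"
  shows "normalizes_RR (\<lambda>x. p (g x)) (\<lambda>x. h (q x))"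
proof -
  have "orthogonal_transformation (\<lambda>x. p (g x))"
    using assms orthogonal_transformation_compose[of p g] by (simp add: normalizes_RR_def comp_def)
  then show ?thesis using assms by (auto simp: normalizes_RR_def)
qed

text \<open>This is the double commutator for \<open>-r\<close> and \<open>-q\<close>, as
  \<open>(-r - 1) (-q - 1) = (r + 1) (q + 1)\<close>.\<close>

lemma RR_sum4_BW:
  assumes "r \<in> RR" "q \<in> RR" "x \<in> BW"
  shows "(1 / 2) *\<^sub>R (x + r x + q x + r (q x)) \<in> BW"
proof -
  have l: "linear r" by (rule RR_linear[OF assms(1)])
  show ?thesis
    using RR_commutator[OF RR_neg[OF assms(1)] RR_neg[OF assms(2)] assms(3)]
    by (simp add: linear_add[OF l] linear_diff[OF l] linear_neg[OF l] algebra_simps)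
qed

text \<open>
  The new vector is \<open>w' = h\<^sub>1 h\<^sub>2 w\<close> with the reflections \<open>h\<^sub>1 = (a + z)/\<surd>2\<close>, \<open>h\<^sub>2 = (b + z')/\<surd>2\<close>, where
  \<open>a\<close>, \<open>b\<close> fix \<open>w\<close> and pair with \<open>z\<close>, \<open>z'\<close> like a dual basis under the commutator form.
\<close>

lemma frame_vector_step:
  assumes w: "frame_vector w" and z: "z \<in> RR" "\<And>x. z (z x) = x" and y: "y \<in> RR" "\<And>x. y (y x) = x"
    and ns: "z \<notin> stab w" "y \<notin> stab w" "(\<lambda>x. z (y x)) \<notin> stab w"
  obtains w' where "frame_vector w'" "z \<in> stab w'"
    "\<And>r. r \<in> stab w \<Longrightarrow> (\<And>x. r (z x) = z (r x)) \<Longrightarrow> (\<And>x. r (y x) = y (r x)) \<Longrightarrow> r \<in> stab w'"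
proof -
  \<comment> \<open>\<sigma> and \<tau> are the signs by which a fixer of \<open>w\<close> commutes
    with \<open>z\<close> and \<open>y\<close>; they multiply under composition.\<close>
  define P where "P a \<sigma> \<tau> \<longleftrightarrow> a \<in> RR \<and> a w = w \<and> (\<forall>x. a (z x) = \<sigma> *\<^sub>R z (a x)) \<and> (\<forall>x. a (y x) = \<tau> *\<^sub>R y (a x))"
    for a and \<sigma> \<tau> :: real
  have lz: "z (c *\<^sub>R x) = c *\<^sub>R z x" and ly: "y (c *\<^sub>R x) = c *\<^sub>R y x" for c x
    using RR_linear[OF z(1)] RR_linear[OF y(1)] by (simp_all add: linear_cmul)
  have ex: "\<exists>\<sigma> \<tau>. (\<sigma> = 1 \<or> \<sigma> = -1) \<and> (\<tau> = 1 \<or> \<tau> = -1) \<and> P a \<sigma> \<tau>" if "a \<in> RR" "a w = w" for a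
    using RR_commute[OF that(1) z(1)] RR_commute[OF that(1) y(1)] that unfolding P_def by metis
  have mult: "P (\<lambda>x. a (b x)) (\<sigma> * \<sigma>') (\<tau> * \<tau>')" if ab: "P a \<sigma> \<tau>" "P b \<sigma>' \<tau>'" for a b \<sigma> \<tau> \<sigma>' \<tau>'
  proof -
    have "(\<lambda>x. a (b x)) \<in> RR" using RR_comp[of a b] ab by (simp add: P_def comp_def)
    moreover have "a (c *\<^sub>R x) = c *\<^sub>R a x" for c x
      using ab RR_linear[of a] by (simp add: P_def linear_cmul)
    ultimately show ?thesis using ab by (simp add: P_def mult.commute)
  qed
  have nz: "z x = - z x \<longleftrightarrow> z x = 0" "y x = - y x \<longleftrightarrow> y x = 0" for x
    by (auto simp: eq_neg_iff_add_eq_0 simp flip: scaleR_2)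
  have w0: "w \<noteq> 0" by (rule frame_vector_nonzero[OF w])
  have zw0: "z w \<noteq> 0" "y w \<noteq> 0" "z (y w) \<noteq> 0"
    using w0 z y by (metis (no_types, lifting) lz ly scale_zero_left)+
  obtain a1 where a1: "a1 \<in> RR" "a1 w = w" "\<And>x. a1 (z x) = - z (a1 x)"
    using anticommuting_fixer[OF w z(1) ns(1)] by metis
  obtain a2 where a2: "a2 \<in> RR" "a2 w = w" "\<And>x. a2 (y x) = - y (a2 x)"
    using anticommuting_fixer[OF w y(1) ns(2)] by metis
  have zyR: "(\<lambda>x. z (y x)) \<in> RR" using RR_comp[OF z(1) y(1)] by (simp add: comp_def)
  \<comment> \<open>Anticommuting with \<open>z y\<close>, this element has signs of product -1 and
    is itself one member of the dual pair; \<open>a1\<close> or \<open>a2\<close>, corrected by it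
    if necessary, is the other.\<close>
  obtain a3 where a3: "a3 \<in> RR" "a3 w = w" "\<And>x. a3 (z (y x)) = - z (y (a3 x))"
    using anticommuting_fixer[OF w zyR ns(3)] by metis
  obtain \<tau>1 where \<tau>1: "\<tau>1 = 1 \<or> \<tau>1 = -1" "P a1 (-1) \<tau>1"
    using ex[OF a1(1,2)] a1(3) unfolding P_def by (metis scaleR_minus_left scaleR_one)
  obtain \<sigma>2 where \<sigma>2: "\<sigma>2 = 1 \<or> \<sigma>2 = -1" "P a2 \<sigma>2 (-1)"
    using ex[OF a2(1,2)] a2(3) unfolding P_def by (metis scaleR_minus_left scaleR_one)
  obtain \<sigma>3 \<tau>3 where \<sigma>3: "\<sigma>3 = 1 \<or> \<sigma>3 = -1" "\<tau>3 = 1 \<or> \<tau>3 = -1" "P a3 \<sigma>3 \<tau>3"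
    using ex[OF a3(1,2)] by metis
  have "a3 (z (y w)) = (\<sigma>3 * \<tau>3) *\<^sub>R z (y w)"
    using \<sigma>3(3) by (simp add: P_def lz)
  then have "- z (y w) = (\<sigma>3 * \<tau>3) *\<^sub>R z (y w)" using a3 by simp
  then have st: "\<sigma>3 * \<tau>3 \<noteq> 1" using zw0(3)
    by (auto simp: neg_eq_iff_add_eq_0 simp flip: scaleR_2)
  then consider "\<sigma>3 = -1" "\<tau>3 = 1" | "\<sigma>3 = 1" "\<tau>3 = -1" using \<sigma>3(1,2) by auto
  then have "(\<exists>a. P a (-1) 1) \<and> (\<exists>b. P b 1 (-1))"
  proof cases
    case 1
    have "\<exists>b. P b 1 (-1)"
      using \<sigma>2(1)
    proof
      assume "\<sigma>2 = -1"
      then show ?thesis using mult[OF \<sigma>3(3) \<sigma>2(2)] 1 by auto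
    qed (use \<sigma>2 in auto)
    then show ?thesis using 1 \<sigma>3(3) by auto
  next
    case 2
    have "\<exists>a. P a (-1) 1"
      using \<tau>1(1)
    proof
      assume "\<tau>1 = -1"
      then show ?thesis using mult[OF \<sigma>3(3) \<tau>1(2)] 2 by auto
    qed (use \<tau>1 in auto)
    then show ?thesis using 2 \<sigma>3(3) by auto
  qed
  then obtain a b where "P a (-1) 1" "P b 1 (-1)" by blast
  then have a: "a \<in> RR" "a w = w" "\<And>x. a (z x) = - z (a x)" "\<And>x. a (y x) = y (a x)"
    and b: "b \<in> RR" "b w = w" "\<And>x. b (z x) = z (b x)" "\<And>x. b (y x) = - y (b x)"
    by (simp_all add: P_def)
  have invol: "q (q x) = x" if qw: "q \<in> RR" "q w = w" for q x
  proof -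
    obtain \<sigma> where \<sigma>: "\<And>x. q (q x) = \<sigma> *\<^sub>R x" using RR_square[OF qw(1)] by metis
    have "\<sigma> *\<^sub>R w = 1 *\<^sub>R w" using \<sigma>[of w] qw by simp
    then have "\<sigma> = 1" using w0 by (metis scaleR_right_imp_eq)
    then show ?thesis using \<sigma> by simp
  qed
  define h1 where "h1 x = (1 / sqrt 2) *\<^sub>R (a x + z x)" for x
  define h2 where "h2 x = (1 / sqrt 2) *\<^sub>R (b x + y x)" for x
  have h1: "normalizes_RR h1 h1" and h2: "normalizes_RR h2 h2"
    unfolding h1_def h2_def
    using normalizes_RR_reflection[OF a(1) invol[OF a(1,2)] z a(3)]
      normalizes_RR_reflection[OF b(1) invol[OF b(1,2)] y b(4)] by blast+
  \<comment> \<open>\<open>h1 (h2 w)\<close> expands to this half sum, since \<open>a\<close> and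
    \<open>b\<close> fix \<open>w\<close> and \<open>a\<close> commutes with \<open>y\<close>. The
    product form shows a frame vector, the half sum shows lattice membership and invariance under
    \<open>z\<close>.\<close>
  define w' where "w' = (1 / 2) *\<^sub>R (w + z w + y w + z (y w))"
  note lin = RR_linear[OF a(1)] RR_linear[OF z(1)] RR_linear[OF y(1)]
  note la = linear_add[OF lin(1)] linear_cmul[OF lin(1)]
    and lz' = linear_add[OF lin(2)] linear_cmul[OF lin(2)]
    and ly' = linear_add[OF lin(3)] linear_cmul[OF lin(3)]
  have "w' = h1 (h2 w)"
    by (simp add: w'_def h1_def h2_def la lz' ly' a b algebra_simps)
  moreover obtain g h where g: "normalizes_RR g h" "w = g v0" using w by (auto simp: frame_vector_def)
  moreover have "normalizes_RR (\<lambda>x. h1 (h2 (g x))) (\<lambda>x. h (h2 (h1 x)))"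
    by (rule normalizes_RR_comp[OF normalizes_RR_comp[OF g(1) h2] h1])
  moreover have "w' \<in> BW"
    unfolding w'_def using w by (intro RR_sum4_BW z y) (simp add: frame_vector_def)
  ultimately have "frame_vector w'" by (auto simp: frame_vector_def)
  moreover have "z w' = w'"
    by (simp add: w'_def lz' z algebra_simps)
  then have "z \<in> stab w'" using z by (simp add: stab_def)
  moreover have "r \<in> stab w'" if r: "r \<in> stab w" "\<And>x. r (z x) = z (r x)" "\<And>x. r (y x) = y (r x)" for r
  proof -
    have "linear r" using r RR_linear by (auto simp: stab_def)
    then have "r w' = (1 / 2) *\<^sub>R (r w + z (r w) + y (r w) + z (y (r w)))"
      by (simp add: w'_def linear_add linear_cmul r)
    moreover have "z (- x) = - z x" "y (- x) = - y x" for x using lin by (simp_all add: linear_neg)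
    ultimately have "r w' = w' \<or> r w' = - w'"
      using r(1) by (auto simp: stab_def w'_def algebra_simps)
    then show ?thesis using r(1) by (simp add: stab_def)
  qed
  ultimately show thesis using that by blast
qed

lemma frame_vector_v0: "frame_vector v0"
proof -
  have "normalizes_RR (\<lambda>x. x) (\<lambda>x. x)" by (simp add: normalizes_RR_def)
  then show ?thesis using v0_in_BW by (auto simp: frame_vector_def)
qed

section \<open>Involutions of nonzero trace\<close>

text \<open>Nonzero trace will provide \<open>clean\<close>: what \<open>t\<close> centralizes
  modulo sign, it centralizes. The bound on the centralizer is 8 times the one in
  \<open>card_stab\<close>, the room needed by \<open>involution_outside\<close>.\<close>

locale clean_involution =
  fixes t :: "'n::finite ambient \<Rightarrow> 'n ambient"
  assumes orth_t: "orthogonal_transformation t"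
    and tt [simp]: "t (t x) = x"
    and t_normalizes: "r \<in> RR \<Longrightarrow> (\<lambda>x. t (r (t x))) \<in> RR"
    and clean: "q \<in> RR \<Longrightarrow> \<exists>x. t (q (t x)) \<noteq> - q x"
    and t_nonscalar: "\<exists>x. t x \<noteq> c *\<^sub>R x"
    and card_centralizer: "2 ^ (CARD('n) + 4) \<le> card {q \<in> RR. \<forall>x. t (q x) = q (t x)}"
begin

lemma lin_t: "linear t"
  using orth_t by (simp add: orthogonal_transformation_def)

definition centralizer :: "('n ambient \<Rightarrow> 'n ambient) set" where
  "centralizer = {q \<in> RR. \<forall>x. t (q x) = q (t x)}"

text \<open>The commutator of \<open>r\<close> and \<open>t\<close>, up to sign.\<close>

definition comm :: "('n ambient \<Rightarrow> 'n ambient) \<Rightarrow> 'n ambient \<Rightarrow> 'n ambient" where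
  "comm r x = r (t (r (t x)))"

lemma centralizerI:
  assumes "q \<in> RR" "\<sigma> = 1 \<or> \<sigma> = (-1::real)" "\<And>x. t (q (t x)) = \<sigma> *\<^sub>R q x"
  shows "q \<in> centralizer"
proof -
  have "t (q (t x)) = q x" for x
    using assms clean[OF assms(1)] by auto
  then have "t (q x) = q (t x)" for x by (metis tt)
  then show ?thesis using assms(1) by (simp add: centralizer_def)
qed

lemma comm_RR: "r \<in> RR \<Longrightarrow> comm r \<in> RR"
  using RR_comp[of r "\<lambda>x. t (r (t x))"] t_normalizes by (simp add: comm_def[abs_def] comp_def)

text \<open>\<open>r\<close> and its conjugate by \<open>t\<close> commute up to a sign \<sigma>, so
  conjugation by \<open>t\<close> multiplies \<open>comm r\<close> by \<sigma>, which cleanness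
  makes +1. The two commuting factors of \<open>comm r\<close> have the same scalar square
  \<plusminus>1, so \<open>comm r\<close> squares to 1.\<close>

lemma
  assumes r: "r \<in> RR"
  shows comm_centralizer: "comm r \<in> centralizer"
    and comm_involution: "comm r (comm r x) = x"
proof -
  obtain \<sigma> where \<sigma>: "\<sigma> = 1 \<or> \<sigma> = -1" "\<And>x. t (r (t (r x))) = \<sigma> *\<^sub>R r (t (r (t x)))"
    using RR_commute[OF t_normalizes[OF r] r] by blast
  have "t (comm r (t x)) = \<sigma> *\<^sub>R comm r x" for x
    using \<sigma>(2)[of x] by (simp add: comm_def)
  from centralizerI[OF comm_RR[OF r] \<sigma>(1) this] show c: "comm r \<in> centralizer" .
  then have c: "t (comm r x) = comm r (t x)" for x by (simp add: centralizer_def)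
  have sw: "t (r (t (r x))) = r (t (r (t x)))" for x
    using c[of "t x"] by (simp add: comm_def)
  obtain \<rho> where \<rho>: "\<rho> = 1 \<or> \<rho> = -1" "\<And>x. r (r x) = \<rho> *\<^sub>R x"
    using RR_square[OF r] by metis
  have "comm r (comm r x) = r (r (t (r (r (t x)))))"
    using sw[of "t (r (t x))"] by (simp add: comm_def)
  also have "\<dots> = \<rho> *\<^sub>R (\<rho> *\<^sub>R x)"
    by (simp add: \<rho>(2) linear_cmul[OF lin_t])
  also have "\<dots> = x" using \<rho>(1) by auto
  finally show "comm r (comm r x) = x" .
qed

text \<open>The sign between \<open>q\<close> and \<open>r\<close> enters once for each of the two
  conjugate factors of \<open>comm r\<close>, and cancels.\<close>

lemma centralizer_comm:
  assumes q: "q \<in> centralizer" and r: "r \<in> RR"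
  shows "q (comm r x) = comm r (q x)"
proof -
  have qR: "q \<in> RR" and qt: "\<And>x. q (t x) = t (q x)" using q by (auto simp: centralizer_def)
  obtain \<sigma> where \<sigma>: "\<sigma> = 1 \<or> \<sigma> = -1" "\<And>x. q (r x) = \<sigma> *\<^sub>R r (q x)"
    using RR_commute[OF qR r] by blast
  have "q (comm r x) = \<sigma> *\<^sub>R \<sigma> *\<^sub>R comm r (q x)"
    by (simp add: comm_def \<sigma>(2) qt linear_cmul[OF lin_t] linear_cmul[OF RR_linear[OF r]])
  then show ?thesis using \<sigma>(1) by auto
qed

text \<open>Commuting with \<open>comm r\<close> equates the signs of \<open>q\<close> against
  \<open>r\<close> and against its conjugate by \<open>t\<close>. Then \<open>p\<close>, which is
  \<open>comm q\<close>, commutes with all of \<open>RR\<close> and is scalar by Schur's lemma;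
  cleanness settles the sign.\<close>

lemma centralizerI_comm:
  assumes q: "q \<in> RR" and c: "\<And>r x. r \<in> RR \<Longrightarrow> q (comm r x) = comm r (q x)"
  shows "q \<in> centralizer"
proof -
  define p where "p x = q (t (q (t x)))" for x
  have s: "(\<lambda>x. t (q (t x))) \<in> RR" by (rule t_normalizes[OF q])
  have "p \<in> RR" using comm_RR[OF q] by (simp add: p_def[abs_def] comm_def[abs_def])
  have "p (r x) = r (p x)" if r: "r \<in> RR" for r x
  proof -
    have sr: "(\<lambda>x. t (r (t x))) \<in> RR" by (rule t_normalizes[OF r])
    note lr = linear_cmul[OF RR_linear[OF r]]
    obtain \<sigma> where \<sigma>: "\<sigma> = 1 \<or> \<sigma> = -1" "\<And>x. q (r x) = \<sigma> *\<^sub>R r (q x)"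
      using RR_commute[OF q r] by blast
    obtain \<tau> where \<tau>: "\<tau> = 1 \<or> \<tau> = -1" "\<And>x. q (t (r (t x))) = \<tau> *\<^sub>R t (r (t (q x)))"
      using RR_commute[OF q sr] by blast
    have eq: "(\<sigma> * \<tau>) *\<^sub>R comm r (q x) = comm r (q x)" for x
      using c[OF r, of x] by (simp add: comm_def \<sigma>(2) \<tau>(2) lr)
    obtain x where "q x \<noteq> 0"
    proof -
      have "q v0 \<bullet> q v0 = 1" using RR_orthogonal[OF q] by (simp add: orthogonal_transformation_def v0_inner)
      then have "q v0 \<noteq> 0" by auto
      then show thesis by (rule that)
    qed
    then have "comm r (q x) \<noteq> 0"
      using comm_involution[OF r, of "q x"] comm_RR[OF r] RR_linear linear_0 by metis
    then have st: "\<sigma> * \<tau> = 1" using eq[of x] by (metis scaleR_right_imp_eq scaleR_one)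
    have "t (q (t (r y))) = \<tau> *\<^sub>R r (t (q (t y)))" for y
    proof -
      have "q (t (r (t (t y)))) = \<tau> *\<^sub>R t (r (t (q (t y))))" by (rule \<tau>(2))
      then show ?thesis by (simp add: linear_cmul[OF lin_t])
    qed
    then have "p (r y) = (\<sigma> * \<tau>) *\<^sub>R r (p y)" for y
      by (simp add: p_def \<sigma>(2) linear_cmul[OF RR_linear[OF q]])
    then show ?thesis by (simp add: st)
  qed
  then obtain c where c: "\<And>x. p x = c *\<^sub>R x"
    using centralizer_RR[OF RR_linear[OF \<open>p \<in> RR\<close>]] by metis
  have cpm: "c = 1 \<or> c = -1"
    by (rule orthogonal_eigenvalue[OF RR_orthogonal[OF \<open>p \<in> RR\<close>] c frame_vector_nonzero[OF frame_vector_v0]])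
  obtain \<rho> where \<rho>: "\<rho> = 1 \<or> \<rho> = -1" "\<And>x. q (q x) = \<rho> *\<^sub>R x"
    using RR_square[OF q] by metis
  have "t (q (t x)) = (\<rho> * c) *\<^sub>R q x" for x
  proof -
    have "\<rho> *\<^sub>R t (q (t x)) = q (p x)" by (simp add: p_def \<rho>(2))
    also have "\<dots> = c *\<^sub>R q x" by (simp add: c linear_cmul[OF RR_linear[OF q]])
    finally have "\<rho> *\<^sub>R \<rho> *\<^sub>R t (q (t x)) = (\<rho> * c) *\<^sub>R q x" by simp
    then show ?thesis using \<rho>(1) by auto
  qed
  moreover have "\<rho> * c = 1 \<or> \<rho> * c = -1" using \<rho>(1) cpm by auto
  ultimately show ?thesis using centralizerI[OF q] by blast
qed

text \<open>
  Elements of the centralizer outside a subgroup \<open>K\<close> of index at least 8 cannot all square to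
  \<open>-1\<close>: three independent ones would anticommute pairwise, and then \<open>g (h l)\<close> squares to \<open>1\<close>.
\<close>

lemma involution_outside:
  assumes K: "K \<subseteq> centralizer" "\<And>q. q \<in> K \<Longrightarrow> (\<lambda>x. - q x) \<in> K" "card K \<le> 2 ^ (CARD('n) + 1)"
  shows "\<exists>y\<in>centralizer. y \<notin> K \<and> (\<forall>x. y (y x) = x)"
proof (rule ccontr)
  assume no: "\<not> ?thesis"
  have lin: "linear q" if "q \<in> centralizer" for q
    using that RR_linear by (auto simp: centralizer_def)
  have sq: "y (y x) = - x" if y: "y \<in> centralizer" "y \<notin> K" for y x
  proof -
    obtain \<sigma> where \<sigma>: "\<sigma> = 1 \<or> \<sigma> = -1" "\<And>x. y (y x) = \<sigma> *\<^sub>R x"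
      using RR_square[of y] y by (auto simp: centralizer_def)
    then have "\<sigma> \<noteq> 1" using no y by auto
    then show ?thesis using \<sigma> by auto
  qed
  have comp: "p \<circ> q \<in> centralizer" if "p \<in> centralizer" "q \<in> centralizer" for p q
    using that RR_comp by (auto simp: centralizer_def)
  have fin: "finite centralizer" unfolding centralizer_def by (simp add: finite_RR)
  have finK: "finite K" using K(1) fin by (rule finite_subset)
  define coset :: "('n ambient \<Rightarrow> 'n ambient) \<Rightarrow> _" where "coset p = (\<lambda>k. p \<circ> k) ` K" for p
  have cc: "card (coset p) \<le> card K" "finite (coset p)" for p
    unfolding coset_def using finK by (auto intro: card_image_le)
  have big: "2 ^ (CARD('n) + 4) \<le> card centralizer"
    using card_centralizer by (simp add: centralizer_def)
  have K8: "8 * card K \<le> 2 ^ (CARD('n) + 4)"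
    using mult_le_mono2[OF K(3), of 8] by (simp add: power_add)
  \<comment> \<open>Four translates of \<open>K\<close> cannot cover the centralizer, which has at
    least \<open>8 * card K\<close> elements.\<close>
  have ex: "\<exists>g. g \<in> centralizer \<and> g \<notin> A" if A: "finite A" "card A \<le> 4 * card K" for A
  proof (rule ccontr)
    assume "\<not> ?thesis"
    then have "card centralizer \<le> card A" by (intro card_mono A(1)) blast
    then have "8 * card K \<le> 4 * card K" "(2::nat) ^ (CARD('n) + 4) \<le> 4 * card K"
      using A(2) big K8 by linarith+
    then show False by auto
  qed
  obtain g where g: "g \<in> centralizer" "g \<notin> K" using ex[OF finK] by auto
  have "card (K \<union> coset g) \<le> 4 * card K"
    using card_Un_le[of K "coset g"] cc(1)[of g] by linarith
  then obtain h where h: "h \<in> centralizer" "h \<notin> K" "h \<notin> coset g"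
    using ex[of "K \<union> coset g"] finK cc(2) by auto
  have "card ((K \<union> coset g) \<union> (coset h \<union> coset (g \<circ> h))) \<le> 4 * card K"
    using card_Un_le[of "K \<union> coset g" "coset h \<union> coset (g \<circ> h)"] card_Un_le[of K "coset g"]
      card_Un_le[of "coset h" "coset (g \<circ> h)"] cc(1)[of g] cc(1)[of h] cc(1)[of "g \<circ> h"] by linarith
  then obtain l where l: "l \<in> centralizer" "l \<notin> K" "l \<notin> coset g" "l \<notin> coset h" "l \<notin> coset (g \<circ> h)"
    using ex[of "(K \<union> coset g) \<union> (coset h \<union> coset (g \<circ> h))"] finK cc(2) by auto
  \<comment> \<open>Here \<open>p\<close> has inverse \<open>-p\<close>, so closure of
    \<open>K\<close> under negation would put \<open>q\<close> into the coset.\<close>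
  have out: "p \<circ> q \<notin> K" if pq: "p \<in> centralizer" "p \<notin> K" "q \<notin> coset p" for p q
  proof
    assume "p \<circ> q \<in> K"
    then have "(\<lambda>x. - (p \<circ> q) x) \<in> K" by (rule K(2))
    moreover have "q = p \<circ> (\<lambda>x. - (p \<circ> q) x)"
      using sq[OF pq(1,2)] linear_neg[OF lin[OF pq(1)]] by (simp add: fun_eq_iff)
    ultimately show False using pq(3) unfolding coset_def by blast
  qed
  have anti: "p (q x) = - q (p x)"
    if pq: "p \<in> centralizer" "p \<notin> K" "q \<in> centralizer" "q \<notin> K" "q \<notin> coset p" for p q x
  proof -
    have "p (q (p (q x))) = - x" for x
      using sq[OF comp[OF pq(1,3)] out[OF pq(1,2,5)], of x] by simp
    then have "p (p (q (p (q x)))) = - p x" for x by (simp add: linear_neg[OF lin[OF pq(1)]])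
    then have "q (p (q x)) = p x" for x by (simp add: sq[OF pq(1,2)])
    from this[of "q x"] show ?thesis
      by (simp add: sq[OF pq(3,4)] linear_neg[OF lin[OF pq(1)]] linear_neg[OF lin[OF pq(3)]])
  qed
  have gh: "g \<circ> h \<in> centralizer" "g \<circ> h \<notin> K"
    by (rule comp[OF g(1) h(1)], rule out[OF g h(3)])
  have ghl: "(g \<circ> h) \<circ> l \<in> centralizer" "(g \<circ> h) \<circ> l \<notin> K"
    by (rule comp[OF gh(1) l(1)], rule out[OF gh l(5)])
  have hl: "h \<circ> l \<in> centralizer" "h \<circ> l \<notin> K"
    by (rule comp[OF h(1) l(1)], rule out[OF h(1,2) l(4)])
  note neg = linear_neg[OF lin[OF g(1)]] linear_neg[OF lin[OF h(1)]] linear_neg[OF lin[OF l(1)]]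
  \<comment> \<open>\<open>g\<close> anticommutes with both \<open>h\<close> and \<open>l\<close>,
    hence commutes with \<open>h \<circ> l\<close>; the square of the triple product is then a
    product of two squares equal to -1.\<close>
  have "h (l (g x)) = g (h (l x))" for x
    by (simp add: anti[OF g h] anti[OF g l(1,2,3)] neg)
  then have "g (h (l (g (h (l x))))) = g (g (h (l (h (l x)))))" for x by simp
  also have "g (g (h (l (h (l x))))) = x" for x
    using sq[OF hl, of x] by (simp add: sq[OF g])
  finally have "g (h (l (g (h (l x))))) = x" for x .
  moreover have "g (h (l (g (h (l x))))) = - x" for x
    using sq[OF ghl, of x] by simp
  ultimately have "v0 = - (v0 :: 'n ambient)" by metis
  from arg_cong[OF this, of "inner v0"] show False by (simp add: v0_inner)
qed

lemma stab_comp: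
  assumes "r \<in> stab w" "q \<in> stab w"
  shows "r \<circ> q \<in> stab (w :: 'n ambient)"
  using assms RR_comp[of r q] linear_neg[OF RR_linear, of r w] by (auto simp: stab_def)

lemma stab_neg: "r \<in> stab w \<Longrightarrow> (\<lambda>x. - r x) \<in> stab (w :: 'n ambient)"
  using RR_neg[of r] by (auto simp: stab_def)

text \<open>Take a frame vector whose signed stabilizer contains the most commutators. If
  \<open>z\<close> is missing, \<open>frame_vector_step\<close> with some \<open>y\<close> from the
  centralizer adds \<open>z\<close> and loses none, as \<open>z\<close> and \<open>y\<close> commute
  with every commutator.\<close>

lemma exists_comm_stable: "\<exists>w. frame_vector w \<and> (\<forall>r\<in>RR. comm r \<in> stab w)"
proof -
  define m where "m w = card (stab w \<inter> comm ` RR)" for w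
  have "m w \<le> card (RR :: ('n ambient \<Rightarrow> 'n ambient) set)" for w
    unfolding m_def by (rule card_mono[OF finite_RR]) (auto simp: stab_def)
  then have "\<forall>w. frame_vector w \<longrightarrow> m w < Suc (card (RR :: ('n ambient \<Rightarrow> 'n ambient) set))"
    by (simp add: le_imp_less_Suc)
  from ex_has_greatest_nat[of frame_vector, OF frame_vector_v0 this]
  obtain w where w: "frame_vector w" and mx: "\<And>v. frame_vector v \<Longrightarrow> m v \<le> m w" by blast
  have "comm r \<in> stab w" if r: "r \<in> RR" for r
  proof (rule ccontr)
    assume ns: "comm r \<notin> stab w"
    define z where "z = comm r"
    have z: "z \<in> RR" "z \<notin> stab w" "z \<in> centralizer" "\<And>x. z (z x) = x"
      using comm_RR[OF r] ns comm_centralizer[OF r] comm_involution[OF r] by (auto simp: z_def)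
    have cz: "q (z x) = z (q x)" if "q \<in> centralizer" for q x
      unfolding z_def by (rule centralizer_comm[OF that r])
    obtain a where a: "a \<in> RR" "a w = w" "\<And>x. a (z x) = - z (a x)"
      using anticommuting_fixer[OF w z(1,2)] by metis
    have a_stab: "a \<in> stab w" using a by (simp add: stab_def)
    \<comment> \<open>Multiplication by \<open>a\<close>, which anticommutes with \<open>z\<close>,
      moves \<open>E\<close> off itself inside \<open>stab w\<close>. The factor two gained pays for
      the two translates that cover \<open>K\<close>.\<close>
    define E where "E = {q \<in> stab w. \<forall>x. q (z x) = z (q x)}"
    have finE: "finite E" unfolding E_def by (simp add: finite_stab)
    have "E \<inter> (\<lambda>q. a \<circ> q) ` E = {}"
    proof (rule ccontr)
      assume "\<not> ?thesis"
      then obtain q where q: "q \<in> E" "a \<circ> q \<in> E" by auto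
      then have "a (q (z v0)) = z (a (q v0))" unfolding E_def by auto
      moreover have "a (q (z v0)) = - z (a (q v0))" using q a by (simp add: E_def)
      ultimately have "2 *\<^sub>R z (a (q v0)) = 0" by (simp add: scaleR_2)
      moreover have "q \<in> RR" using q by (simp add: E_def stab_def)
      then have "z (a (q v0)) \<bullet> z (a (q v0)) = 1"
        using RR_orthogonal[of q] RR_orthogonal[OF a(1)] RR_orthogonal[OF z(1)]
        by (simp add: orthogonal_transformation_def v0_inner)
      ultimately show False by auto
    qed
    moreover have "card ((\<lambda>q. a \<circ> q) ` E) = card E"
    proof (rule card_image, rule inj_onI)
      fix p q assume "p \<in> E" "q \<in> E" and eq: "a \<circ> p = a \<circ> q"
      have "inj a" by (rule orthogonal_transformation_inj[OF RR_orthogonal[OF a(1)]])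
      then show "p = q" using eq by (metis fun.inj_map_strong injD o_apply ext)
    qed
    ultimately have "2 * card E = card (E \<union> (\<lambda>q. a \<circ> q) ` E)"
      using finE by (simp add: card_Un_disjoint)
    also have "\<dots> \<le> card (stab w)"
      using stab_comp[OF a_stab] by (intro card_mono finite_stab) (auto simp: E_def)
    finally have E2: "2 * card E \<le> 2 ^ (CARD('n) + 1)" using card_stab[OF w] by linarith
    \<comment> \<open>\<open>K\<close> collects the elements forbidden as \<open>y\<close> in
      \<open>frame_vector_step\<close>.\<close>
    define K where "K = {q \<in> centralizer. q \<in> stab w \<or> z \<circ> q \<in> stab w}"
    have "K \<subseteq> E \<union> (\<lambda>q. z \<circ> q) ` E"
    proof
      fix q assume q: "q \<in> K"
      then have qz: "q (z x) = z (q x)" for x using cz by (simp add: K_def)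
      have "q = z \<circ> (z \<circ> q)" using z(4) by (simp add: fun_eq_iff)
      moreover have "z \<circ> q \<in> E" if "z \<circ> q \<in> stab w" using that qz by (simp add: E_def)
      ultimately show "q \<in> E \<union> (\<lambda>q. z \<circ> q) ` E" using q qz by (auto simp: K_def E_def)
    qed
    then have "card K \<le> card (E \<union> (\<lambda>q. z \<circ> q) ` E)" using finE by (intro card_mono) auto
    also have "\<dots> \<le> card E + card E"
      using card_Un_le[of E "(\<lambda>q. z \<circ> q) ` E"] card_image_le[OF finE, of "\<lambda>q. z \<circ> q"] by linarith
    finally have cardK: "card K \<le> 2 ^ (CARD('n) + 1)" using E2 by linarith
    have "(\<lambda>x. - q x) \<in> K" if q: "q \<in> K" for q
    proof -
      have "(\<lambda>x. - q x) \<in> centralizer"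
        using q RR_neg by (auto simp: K_def centralizer_def linear_neg[OF lin_t])
      moreover have "z \<circ> (\<lambda>x. - q x) = (\<lambda>x. - (z \<circ> q) x)"
        by (simp add: fun_eq_iff linear_neg[OF RR_linear[OF z(1)]])
      ultimately show ?thesis
        using q stab_neg[of q w] stab_neg[of "z \<circ> q" w] by (auto simp: K_def simp del: o_apply)
    qed
    from involution_outside[OF _ this cardK] obtain y
      where y: "y \<in> centralizer" "y \<notin> K" "\<And>x. y (y x) = x" by (auto simp: K_def)
    have yns: "y \<notin> stab w" "(\<lambda>x. z (y x)) \<notin> stab w" using y by (auto simp: K_def comp_def)
    have yR: "y \<in> RR" using y by (simp add: centralizer_def)
    obtain v where v: "frame_vector v" "z \<in> stab v"
      "\<And>r. r \<in> stab w \<Longrightarrow> (\<And>x. r (z x) = z (r x)) \<Longrightarrow> (\<And>x. r (y x) = y (r x)) \<Longrightarrow> r \<in> stab v"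
      using frame_vector_step[OF w z(1,4) yR y(3) z(2) yns] by blast
    have "q \<in> stab v" if q: "q \<in> stab w" "s \<in> RR" "q = comm s" for q s
    proof (rule v(3)[OF q(1)])
      show "q (z x) = z (q x)" for x
        using cz comm_centralizer[OF q(2)] q(3) by simp
      show "q (y x) = y (q x)" for x
        using centralizer_comm[OF y(1) q(2)] q(3) by simp
    qed
    then have "stab w \<inter> comm ` RR \<subseteq> stab v \<inter> comm ` RR" by blast
    moreover have "z \<in> stab v \<inter> comm ` RR" "z \<notin> stab w \<inter> comm ` RR"
      using v(2) z(2) r by (auto simp: z_def)
    ultimately have "stab w \<inter> comm ` RR \<subset> stab v \<inter> comm ` RR" by blast
    then have "m w < m v"
      unfolding m_def by (intro psubset_card_mono) (simp_all add: finite_stab)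
    then show False using mx[OF v(1)] by simp
  qed
  then show ?thesis using w by blast
qed

lemma comm_eigen:
  assumes r: "r \<in> RR" and v: "t v = \<mu> *\<^sub>R v" "\<mu> = 1 \<or> \<mu> = -1" and c: "comm r v = l *\<^sub>R v" "l = 1 \<or> l = -1"
    and \<rho>: "\<rho> = 1 \<or> \<rho> = -1" "\<And>x. r (r x) = \<rho> *\<^sub>R x"
  shows "t (r v) = (\<mu> * l * \<rho>) *\<^sub>R r v"
proof -
  note lr = linear_cmul[OF RR_linear[OF r]]
  have "\<mu> *\<^sub>R r (t (r v)) = l *\<^sub>R v" using c(1) by (simp add: comm_def v(1) lr linear_cmul[OF lin_t])
  then have "r (\<mu> *\<^sub>R r (t (r v))) = l *\<^sub>R r v" by (simp add: lr)
  then have "(\<mu> * \<rho>) *\<^sub>R t (r v) = l *\<^sub>R r v" by (simp add: lr \<rho>(2))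
  then have "(\<mu> * \<rho>) *\<^sub>R (\<mu> * \<rho>) *\<^sub>R t (r v) = (\<mu> * \<rho>) *\<^sub>R l *\<^sub>R r v" by simp
  then show ?thesis using v(2) \<rho>(1) by auto
qed

lemma exists_four_eigenvectors:
  obtains w r q e0 e1 e2 where "frame_vector w" "r \<in> RR" "q \<in> RR"
    "e0 = 1 \<or> e0 = (-1::real)" "e1 = 1 \<or> e1 = (-1::real)" "e2 = 1 \<or> e2 = (-1::real)"
    "t w = e0 *\<^sub>R w" "t (r w) = e1 *\<^sub>R r w" "t (q w) = e2 *\<^sub>R q w"
    "t (r (q w)) = - (e0 * e1 * e2) *\<^sub>R r (q w)"
proof -
  obtain w where w: "frame_vector w" and ws: "\<And>r. r \<in> RR \<Longrightarrow> comm r \<in> stab w"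
    using exists_comm_stable by blast
  have w0: "w \<noteq> 0" by (rule frame_vector_nonzero[OF w])
  \<comment> \<open>All commutators lie in \<open>stab w\<close>, whose elements commute with each
    other; by \<open>centralizerI_comm\<close> these commute with \<open>t\<close>, so every fixer
    of \<open>w\<close> fixes \<open>t w\<close>.\<close>
  have "stab w \<subseteq> centralizer"
  proof
    fix q assume q: "q \<in> stab w"
    then show "q \<in> centralizer"
      using stab_commute[OF w0 q ws] by (intro centralizerI_comm) (auto simp: stab_def)
  qed
  then have "r (t w) = t w" if "r \<in> RR" "r w = w" for r
  proof -
    have "r \<in> centralizer" using \<open>stab w \<subseteq> centralizer\<close> that by (auto simp: stab_def)
    then have "t (r w) = r (t w)" by (simp add: centralizer_def)
    then show ?thesis using that by simp
  qed
  then obtain e0 where e0: "t w = e0 *\<^sub>R w" using frame_vector_fixed[OF w] by metis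
  have e0s: "e0 = 1 \<or> e0 = -1" by (rule orthogonal_eigenvalue[OF orth_t e0 w0])
  \<comment> \<open>Were all commutators scalar, cleanness would make \<open>t\<close> commute with
    \<open>RR\<close>, and Schur's lemma would make it scalar.\<close>
  have "\<exists>r\<in>RR. \<forall>c. \<exists>x. comm r x \<noteq> c *\<^sub>R x"
  proof (rule ccontr)
    assume "\<not> ?thesis"
    then have sc: "\<exists>c. \<forall>x. comm r x = c *\<^sub>R x" if "r \<in> RR" for r using that by blast
    have "r \<in> centralizer" if r: "r \<in> RR" for r
    proof -
      obtain c where c: "\<And>x. comm r x = c *\<^sub>R x" using sc[OF r] by blast
      have cpm: "c = 1 \<or> c = -1"
        by (rule orthogonal_eigenvalue[OF RR_orthogonal[OF comm_RR[OF r]] c w0])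
      obtain \<rho> where \<rho>: "\<rho> = 1 \<or> \<rho> = -1" "\<And>x. r (r x) = \<rho> *\<^sub>R x"
        using RR_square[OF r] by metis
      have "t (r (t x)) = (\<rho> * c) *\<^sub>R r x" for x
      proof -
        have "r (comm r x) = c *\<^sub>R r x" by (simp add: c linear_cmul[OF RR_linear[OF r]])
        then have "\<rho> *\<^sub>R t (r (t x)) = c *\<^sub>R r x" by (simp add: comm_def \<rho>(2))
        then have "\<rho> *\<^sub>R \<rho> *\<^sub>R t (r (t x)) = \<rho> *\<^sub>R c *\<^sub>R r x" by simp
        then show ?thesis using \<rho>(1) by auto
      qed
      moreover have "\<rho> * c = 1 \<or> \<rho> * c = -1" using \<rho>(1) cpm by auto
      ultimately show ?thesis using centralizerI[OF r] by blast
    qed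
    then have "t (r x) = r (t x)" if "r \<in> RR" for r x using that by (auto simp: centralizer_def)
    then obtain c where "\<And>x. t x = c *\<^sub>R x" using centralizer_RR[OF lin_t] by metis
    then show False using t_nonscalar by blast
  qed
  then obtain r where r: "r \<in> RR" and nsc: "\<And>c. \<exists>x. comm r x \<noteq> c *\<^sub>R x" by blast
  have "\<exists>q\<in>RR. \<exists>x. comm r (q x) \<noteq> q (comm r x)"
  proof (rule ccontr)
    assume "\<not> ?thesis"
    then obtain c where "\<And>x. comm r x = c *\<^sub>R x"
      using centralizer_RR[OF RR_linear[OF comm_RR[OF r]]] by metis
    then show False using nsc by blast
  qed
  then obtain q where q: "q \<in> RR" and nc: "\<exists>x. comm r (q x) \<noteq> q (comm r x)" by blast
  obtain \<sigma> where \<sigma>: "\<sigma> = 1 \<or> \<sigma> = -1" "\<And>x. comm r (q x) = \<sigma> *\<^sub>R q (comm r x)"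
    using RR_commute[OF comm_RR[OF r] q] by blast
  then have anti: "comm r (q x) = - q (comm r x)" for x using nc by auto
  have "\<exists>l. (l = 1 \<or> l = -1) \<and> comm p w = l *\<^sub>R w" if "p \<in> RR" for p
    using ws[OF that] unfolding stab_def by (metis (mono_tags, lifting) mem_Collect_eq scaleR_minus_left scaleR_one)
  then obtain l1 l2 where l: "l1 = 1 \<or> l1 = -1" "comm r w = l1 *\<^sub>R w" "l2 = 1 \<or> l2 = -1" "comm q w = l2 *\<^sub>R w"
    using r q by metis
  obtain \<rho>1 where \<rho>1: "\<rho>1 = 1 \<or> \<rho>1 = -1" "\<And>x. r (r x) = \<rho>1 *\<^sub>R x" using RR_square[OF r] by metis
  obtain \<rho>2 where \<rho>2: "\<rho>2 = 1 \<or> \<rho>2 = -1" "\<And>x. q (q x) = \<rho>2 *\<^sub>R x" using RR_square[OF q] by metis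
  have 1: "t (r w) = (e0 * l1 * \<rho>1) *\<^sub>R r w" by (rule comm_eigen[OF r e0 e0s l(2,1) \<rho>1])
  have 2: "t (q w) = (e0 * l2 * \<rho>2) *\<^sub>R q w" by (rule comm_eigen[OF q e0 e0s l(4,3) \<rho>2])
  \<comment> \<open>\<open>q\<close> reverses the eigenvalue of \<open>comm r\<close>; this one
    reversal makes the product of the four eigenvalues of \<open>t\<close> equal to -1.\<close>
  have "comm r (q w) = (- l1) *\<^sub>R q w" by (simp add: anti l(2) linear_cmul[OF RR_linear[OF q]])
  moreover have s2: "e0 * l2 * \<rho>2 = 1 \<or> e0 * l2 * \<rho>2 = -1" using e0s l \<rho>2(1) by auto
  moreover have "- l1 = 1 \<or> - l1 = -1" using l(1) by auto
  ultimately have 3: "t (r (q w)) = (e0 * l2 * \<rho>2 * - l1 * \<rho>1) *\<^sub>R r (q w)"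
    using comm_eigen[OF r 2 _ _ _ \<rho>1] by blast
  have s1: "e0 * l1 * \<rho>1 = 1 \<or> e0 * l1 * \<rho>1 = -1" using e0s l \<rho>1(1) by auto
  have "e0 * l2 * \<rho>2 * - l1 * \<rho>1 = - (e0 * (e0 * l1 * \<rho>1) * (e0 * l2 * \<rho>2))"
    using e0s by (elim disjE) simp_all
  then have "t (r (q w)) = - (e0 * (e0 * l1 * \<rho>1) * (e0 * l2 * \<rho>2)) *\<^sub>R r (q w)"
    using 3 by metis
  then show thesis using that[OF w r q e0s s1 s2 e0 1 2] by blast
qed

end

section \<open>The lattices \<open>M\<^sub>\<epsilon>\<close>\<close>

lemma trace_matrix: "trace (matrix g) = (\<Sum>i\<in>UNIV. g (axis i 1) $ i)"
  for g :: "real ^ 'm::finite \<Rightarrow> real ^ 'm"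
  by (simp add: trace_def matrix_def)

text \<open>Conjugation by \<open>q\<close> turns \<open>t\<close> into \<open>-t\<close> but
  preserves the trace.\<close>

lemma trace_zero:
  assumes t: "linear t" "\<And>x. t (t x) = x" and q: "q \<in> RR" and anti: "\<And>x. t (q (t x)) = - q x"
  shows "trace (matrix (t :: 'n::finite ambient \<Rightarrow> 'n ambient)) = 0"
proof -
  have lq: "linear q" by (rule RR_linear[OF q])
  obtain \<rho> where \<rho>: "\<rho> = 1 \<or> \<rho> = -1" "\<And>x. q (q x) = \<rho> *\<^sub>R x" using RR_square[OF q] by metis
  have qt: "q (t x) = - t (q x)" for x
    using anti[of x] t linear_neg[OF t(1)] by metis
  have "trace (matrix (q \<circ> (t \<circ> q))) = trace (matrix ((t \<circ> q) \<circ> q))"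
    using lq t(1) by (simp only: matrix_compose linear_compose) (rule trace_mul_sym)
  moreover have "(q \<circ> (t \<circ> q)) x = - (\<rho> *\<^sub>R t x)" "((t \<circ> q) \<circ> q) x = \<rho> *\<^sub>R t x" for x
    by (simp_all add: qt \<rho>(2) linear_cmul[OF t(1)])
  ultimately have "- (\<rho> * trace (matrix t)) = \<rho> * trace (matrix t)"
    by (simp add: trace_matrix sum_negf sum_distrib_left)
  then show ?thesis using \<rho>(1) by auto
qed

lemma center_RR:
  "group_center (OV\<lparr>carrier := RR\<rparr>) = {id, uminus :: 'n::finite ambient \<Rightarrow> 'n ambient}"
proof -
  have "z = id \<or> z = uminus"
    if z: "z \<in> RR" "\<And>g. g \<in> RR \<Longrightarrow> g \<circ> z = z \<circ> g" for z :: "'n ambient \<Rightarrow> 'n ambient"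
  proof -
    have "z (r x) = r (z x)" if "r \<in> RR" for r x using z(2)[OF that] by (metis comp_apply)
    then obtain c where c: "\<And>x. z x = c *\<^sub>R x"
      using centralizer_RR[OF RR_linear[OF z(1)]] by metis
    have "c = 1 \<or> c = -1"
      by (rule orthogonal_eigenvalue[OF RR_orthogonal[OF z(1)] c frame_vector_nonzero[OF frame_vector_v0]])
    then show ?thesis using c by (auto simp: fun_eq_iff)
  qed
  moreover have "g \<circ> uminus = uminus \<circ> g" if "g \<in> RR" for g :: "'n ambient \<Rightarrow> 'n ambient"
    using linear_neg[OF RR_linear[OF that]] by (simp add: fun_eq_iff)
  ultimately show ?thesis
    using RR_id RR_uminus by (auto simp: group_center_def OV_def)
qed

text \<open>Elements of the quotient by the center are pairs \<open>{r, -r}\<close>. In a pair fixed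
  by \<open>t\<close>, cleanness leaves only \<open>t r t = r\<close>, so both members centralize
  \<open>t\<close>; this doubles the count \<open>2 ^ (2 * e)\<close>.\<close>

lemma card_centralizer_of_defect:
  fixes t :: "'n::finite ambient \<Rightarrow> 'n ambient"
  assumes lt: "linear t" and tt: "\<And>x. t (t x) = x" and inv: "inv\<^bsub>OV\<^esub> t = t"
    and clean: "\<And>q. q \<in> RR \<Longrightarrow> \<exists>x. t (q (t x)) \<noteq> - q x"
    and defect: "has_defect t k"
  shows "2 ^ (2 * (CARD('n) - k) + 1) \<le> card {q \<in> RR. \<forall>x. t (q x) = q (t x)}"
proof -
  let ?C = "{q \<in> RR. \<forall>x. t (q x) = q (t x)}"
  define pm where "pm r = {r, \<lambda>x. - r x}" for r :: "'n ambient \<Rightarrow> 'n ambient"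
  have carr: "carrier (OV\<lparr>carrier := RR\<rparr> Mod group_center (OV\<lparr>carrier := RR\<rparr>)) = pm ` RR"
  proof -
    have "(\<Union>h\<in>{id, uminus}. {h \<otimes>\<^bsub>OV\<lparr>carrier := RR\<rparr>\<^esub> a}) = pm a" if "a \<in> RR" for a
    proof -
      have "(\<lambda>x. a (- x)) = (\<lambda>x. - a x)"
        using linear_neg[OF RR_linear[OF that]] by blast
      then show ?thesis by (simp add: pm_def OV_def comp_def insert_commute)
    qed
    then show ?thesis
      unfolding center_RR FactGroup_def RCOSETS_def r_coset_def by auto
  qed
  have conj: "(\<lambda>r. inv\<^bsub>OV\<^esub> t \<otimes>\<^bsub>OV\<^esub> r \<otimes>\<^bsub>OV\<^esub> t) = (\<lambda>r x. t (r (t x)))"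
    unfolding inv by (simp add: OV_def comp_def)
  have "conj_fixed t \<subseteq> pm ` ?C"
  proof
    fix C assume C: "C \<in> conj_fixed t"
    then obtain r where r: "r \<in> RR" "C = pm r"
      unfolding conj_fixed_def carr by blast
    have "(\<lambda>r x. t (r (t x))) ` C = C" using C unfolding conj_fixed_def conj by blast
    moreover have "r \<in> C" using r by (simp add: pm_def)
    ultimately have "(\<lambda>x. t (r (t x))) \<in> C" by blast
    then have "(\<lambda>x. t (r (t x))) = r"
      using clean[OF r(1)] r(2) by (auto simp: pm_def fun_eq_iff)
    then have "t (r x) = r (t x)" for x by (metis tt)
    then show "C \<in> pm ` ?C" using r by blast
  qed
  then have le: "card (conj_fixed t) \<le> card (pm ` ?C)"
    by (rule card_mono[rotated]) (simp add: finite_RR)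
  have "2 * card (pm ` ?C) = card (\<Union> (pm ` ?C))"
  proof (rule card_partition)
    show "card c = 2" if "c \<in> pm ` ?C" for c
    proof -
      obtain r where r: "r \<in> RR" "c = pm r" using \<open>c \<in> pm ` ?C\<close> by blast
      have "r \<noteq> (\<lambda>x. - r x)"
      proof
        assume "r = (\<lambda>x. - r x)"
        then have "r v0 = - r v0" by (rule fun_cong)
        then have "r v0 \<bullet> r v0 = r v0 \<bullet> - r v0" by (rule arg_cong)
        moreover have "r v0 \<bullet> r v0 = 1"
          using RR_orthogonal[OF r(1)] by (simp add: orthogonal_transformation_def v0_inner)
        ultimately show False by simp
      qed
      then show ?thesis using r by (simp add: pm_def)
    qed
    show "c \<inter> c' = {}" if "c \<in> pm ` ?C" "c' \<in> pm ` ?C" "c \<noteq> c'" for c c'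
    proof -
      have "pm s = pm r" if "s \<in> pm r" for r s
        using that by (auto simp: pm_def)
      then have "pm r = pm q" if "s \<in> pm r" "s \<in> pm q" for r q s
        using that by metis
      then show ?thesis using that by blast
    qed
  qed (auto simp: finite_RR pm_def)
  also have "\<Union> (pm ` ?C) = ?C"
    using RR_neg by (auto simp: pm_def linear_neg[OF lt])
  finally have "2 * card (conj_fixed t) \<le> card ?C" using le by linarith
  moreover obtain e where e: "card (conj_fixed t) = 2 ^ (2 * e)" "k + e = CARD('n)"
    using defect by (auto simp: has_defect_def)
  moreover have "CARD('n) - k = e" using e(2) by simp
  ultimately show ?thesis by simp
qed

section \<open>A vector of half the minimum norm\<close>

context clean_involution
begin

text \<open>With \<open>s = \<plusminus>q p\<close>, the sign chosen so that \<open>s\<close> sends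
  \<open>p w\<close> to \<open>- q w\<close>, the sum is \<open>-(s - 1)\<close> applied to
  \<open>p w\<close>, and a double commutator appears.\<close>

lemma orbit_sum_half:
  assumes w: "w \<in> BW" and f: "f \<in> RR" and p: "p \<in> RR" and q: "q \<in> RR"
  shows "(1 / 2) *\<^sub>R (f (p w + q w) - (p w + q w)) \<in> BW"
proof -
  obtain \<rho> where \<rho>: "\<rho> = 1 \<or> \<rho> = -1" "\<And>x. p (p x) = \<rho> *\<^sub>R x" using RR_square[OF p] by metis
  define s where "s x = (- \<rho>) *\<^sub>R q (p x)" for x
  have "(\<lambda>x. q (p x)) \<in> RR" using RR_comp[OF q p] by (simp add: comp_def)
  then have s: "s \<in> RR"
    using \<rho>(1) RR_neg[of "\<lambda>x. q (p x)"] unfolding s_def[abs_def] by auto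
  have "s (p w) = - q w"
    using \<rho>(1) by (auto simp: s_def \<rho>(2) linear_cmul[OF RR_linear[OF q]] linear_neg[OF RR_linear[OF q]])
  then have eq: "s (p w) - p w = - (p w + q w)" by simp
  have "f (s (p w) - p w) - (s (p w) - p w) = - (f (p w + q w) - (p w + q w))"
    unfolding eq linear_neg[OF RR_linear[OF f]] by simp
  from RR_commutator[OF f s RR_BW[OF p w], unfolded this scaleR_minus_right]
  have "- ((1 / 2) *\<^sub>R (f (p w + q w) - (p w + q w))) \<in> BW" .
  from BW_neg[OF this] show ?thesis by (simp only: minus_minus)
qed

text \<open>
  Among the four eigenvectors \<open>w, r w, q w, r q w\<close>, with half sum \<open>u \<in> L\<close>, exactly one or exactly
  three have eigenvalue \<open>\<epsilon>\<close>. In the first case \<open>P\<^sup>\<epsilon>(u)\<close> is half a vector of the frame; in the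
  second it is half a sum of three, and the commutator relation removes two of them modulo \<open>L\<^sup>\<epsilon>(t)\<close>.
\<close>

lemma exists_half_vector:
  assumes f: "f \<in> RR" and ft: "\<And>x. f (t x) = t (f x)" and \<epsilon>: "\<epsilon> = 1 \<or> \<epsilon> = (-1::real)"
  obtains a u x where "a \<bullet> a = 1" "u \<in> BW" "x \<in> BW" "t x = \<epsilon> *\<^sub>R x"
    "x + (f ((1 / 2) *\<^sub>R (u + \<epsilon> *\<^sub>R t u)) - (1 / 2) *\<^sub>R (u + \<epsilon> *\<^sub>R t u)) = (1 / 2) *\<^sub>R (f a - a)"
proof -
  obtain w r q e0 e1 e2 where w: "frame_vector w" and r: "r \<in> RR" and q: "q \<in> RR"
    and e: "e0 = 1 \<or> e0 = (-1::real)" "e1 = 1 \<or> e1 = (-1::real)" "e2 = 1 \<or> e2 = (-1::real)"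
    and ev: "t w = e0 *\<^sub>R w" "t (r w) = e1 *\<^sub>R r w" "t (q w) = e2 *\<^sub>R q w"
      "t (r (q w)) = - (e0 * e1 * e2) *\<^sub>R r (q w)"
    by (rule exists_four_eigenvectors) blast
  note goal = that
  have wB: "w \<in> BW" using w by (simp add: frame_vector_def)
  define u where "u = (1 / 2) *\<^sub>R (w + r w + q w + r (q w))"
  have u: "u \<in> BW" unfolding u_def by (rule RR_sum4_BW[OF r q wB])
  define orb where "orb = (\<lambda>p. p w) ` RR"
  have orb: "w \<in> orb" "r w \<in> orb" "q w \<in> orb" "r (q w) \<in> orb"
    using imageI[OF RR_id, of "\<lambda>p. p w"] imageI[OF r, of "\<lambda>p. p w"] imageI[OF q, of "\<lambda>p. p w"]
      imageI[OF RR_comp[OF r q], of "\<lambda>p. p w"] by (simp_all add: orb_def)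
  have norm: "a \<bullet> a = 1" if a: "a \<in> orb" for a
  proof -
    obtain p where p: "p \<in> RR" "a = p w" using a by (auto simp: orb_def)
    show ?thesis
      using RR_orthogonal[OF p(1)] frame_vector_inner[OF w] by (simp add: p(2) orthogonal_transformation_def)
  qed
  have half: "(1 / 2) *\<^sub>R (f (a + b) - (a + b)) \<in> BW" if "a \<in> orb" "b \<in> orb" for a b
    using that orbit_sum_half[OF wB f] by (auto simp: orb_def)
  note lf = linear_add[OF RR_linear[OF f]] linear_cmul[OF RR_linear[OF f]] linear_diff[OF RR_linear[OF f]]
  note lt = linear_add[OF lin_t] linear_cmul[OF lin_t] linear_diff[OF lin_t]
  have one: thesis if a: "a \<in> orb" "t a = \<epsilon> *\<^sub>R a" "t b = - (\<epsilon> *\<^sub>R b)" "t c = - (\<epsilon> *\<^sub>R c)" "t d = - (\<epsilon> *\<^sub>R d)"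
    "u = (1 / 2) *\<^sub>R (a + b + c + d)" for a b c d
  proof (rule goal[OF norm[OF a(1)] u, of 0])
    have "u + \<epsilon> *\<^sub>R t u = a"
      unfolding a(6) using \<epsilon> by (elim disjE) (simp_all add: lt a(2-5) vec_eq_iff field_simps)
    then show "0 + (f ((1 / 2) *\<^sub>R (u + \<epsilon> *\<^sub>R t u)) - (1 / 2) *\<^sub>R (u + \<epsilon> *\<^sub>R t u)) = (1 / 2) *\<^sub>R (f a - a)"
      by (simp add: lf scaleR_diff_right)
  qed (use lin_t linear_0 in \<open>auto simp: BW_0\<close>)
  have three: thesis if a: "a \<in> orb" "b \<in> orb" "c \<in> orb" "t a = \<epsilon> *\<^sub>R a" "t b = \<epsilon> *\<^sub>R b" "t c = \<epsilon> *\<^sub>R c"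
    "t d = - (\<epsilon> *\<^sub>R d)" "u = (1 / 2) *\<^sub>R (a + b + c + d)" for a b c d
  \<comment> \<open>Since \<open>f\<close> commutes with \<open>t\<close>, this correction lies in
    the eigenlattice; it cancels the contributions of \<open>b\<close> and \<open>c\<close>.\<close>
  proof (rule goal[OF norm[OF a(1)] u, of "- ((1 / 2) *\<^sub>R (f (b + c) - (b + c)))"])
    show "- ((1 / 2) *\<^sub>R (f (b + c) - (b + c))) \<in> BW"
      by (rule BW_neg[OF half[OF a(2,3)]])
    show "t (- ((1 / 2) *\<^sub>R (f (b + c) - (b + c)))) = \<epsilon> *\<^sub>R - ((1 / 2) *\<^sub>R (f (b + c) - (b + c)))"
      by (simp add: linear_neg[OF lin_t] lt lf a(5,6) flip: ft) (simp add: lf algebra_simps)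
    have "u + \<epsilon> *\<^sub>R t u = a + b + c"
      unfolding a(8) using \<epsilon> by (elim disjE) (simp_all add: lt a(4-7) vec_eq_iff field_simps)
    then show "- ((1 / 2) *\<^sub>R (f (b + c) - (b + c))) +
        (f ((1 / 2) *\<^sub>R (u + \<epsilon> *\<^sub>R t u)) - (1 / 2) *\<^sub>R (u + \<epsilon> *\<^sub>R t u)) = (1 / 2) *\<^sub>R (f a - a)"
      by (simp add: lf algebra_simps)
  qed
  \<comment> \<open>Seven orders of the half sum serve the eight sign patterns below.\<close>
  have perm: "u = (1 / 2) *\<^sub>R (w + r w + q w + r (q w))" "u = (1 / 2) *\<^sub>R (r w + w + q w + r (q w))"
    "u = (1 / 2) *\<^sub>R (q w + w + r w + r (q w))" "u = (1 / 2) *\<^sub>R (r (q w) + w + r w + q w)"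
    "u = (1 / 2) *\<^sub>R (w + r w + r (q w) + q w)" "u = (1 / 2) *\<^sub>R (w + q w + r (q w) + r w)"
    "u = (1 / 2) *\<^sub>R (r w + q w + r (q w) + w)"
    by (simp_all add: u_def ac_simps)
  have s: "e = \<epsilon> \<or> e = - \<epsilon>" if "e = 1 \<or> e = -1" for e using that \<epsilon> by auto
  have cube: "\<epsilon> * (\<epsilon> * x) = x" for x using \<epsilon> by auto
  note ev' = ev[unfolded mult.assoc]
  from s[OF e(1)] s[OF e(2)] s[OF e(3)] show thesis
  proof (elim disjE)
    assume "e0 = \<epsilon>" "e1 = \<epsilon>" "e2 = \<epsilon>"
    then show thesis by (intro three[OF orb(1,2,3) _ _ _ _ perm(1)]) (simp_all add: ev' cube)
  next
    assume "e0 = - \<epsilon>" "e1 = \<epsilon>" "e2 = \<epsilon>"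
    then show thesis by (intro three[OF orb(2,3,4) _ _ _ _ perm(7)]) (simp_all add: ev' cube)
  next
    assume "e0 = \<epsilon>" "e1 = - \<epsilon>" "e2 = \<epsilon>"
    then show thesis by (intro three[OF orb(1,3,4) _ _ _ _ perm(6)]) (simp_all add: ev' cube)
  next
    assume "e0 = \<epsilon>" "e1 = \<epsilon>" "e2 = - \<epsilon>"
    then show thesis by (intro three[OF orb(1,2,4) _ _ _ _ perm(5)]) (simp_all add: ev' cube)
  next
    assume "e0 = \<epsilon>" "e1 = - \<epsilon>" "e2 = - \<epsilon>"
    then show thesis by (intro one[OF orb(1) _ _ _ _ perm(1)]) (simp_all add: ev' cube)
  next
    assume "e0 = - \<epsilon>" "e1 = \<epsilon>" "e2 = - \<epsilon>"
    then show thesis by (intro one[OF orb(2) _ _ _ _ perm(2)]) (simp_all add: ev' cube)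
  next
    assume "e0 = - \<epsilon>" "e1 = - \<epsilon>" "e2 = \<epsilon>"
    then show thesis by (intro one[OF orb(3) _ _ _ _ perm(3)]) (simp_all add: ev' cube)
  next
    assume "e0 = - \<epsilon>" "e1 = - \<epsilon>" "e2 = - \<epsilon>"
    then show thesis by (intro one[OF orb(4) _ _ _ _ perm(4)]) (simp_all add: ev' cube)
  qed
qed

end

text \<open>Twice the candidate lies in the eigenlattice and one half is rational; the remainder is
  orthogonal because \<open>t\<close> is an isometry acting as \<epsilon>. Positive definiteness
  gives the uniqueness that the definite description requires.\<close>

lemma eigenproj_BW:
  fixes t :: "'n::finite ambient \<Rightarrow> 'n ambient"
  assumes ot: "orthogonal_transformation t" and tt: "\<And>x. t (t x) = x" and tB: "\<And>x. x \<in> BW \<Longrightarrow> t x \<in> BW"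
    and \<epsilon>: "\<epsilon> = 1 \<or> \<epsilon> = -1" and u: "u \<in> BW"
  shows "eigenproj BW \<epsilon> t u = (1 / 2) *\<^sub>R (u + \<epsilon> *\<^sub>R t u)"
proof -
  have lt: "linear t" using ot by (simp add: orthogonal_transformation_def)
  note l = linear_add[OF lt] linear_cmul[OF lt]
  let ?W = "rat_span (eigenlattice BW \<epsilon> t)"
  let ?y = "(1 / 2) *\<^sub>R (u + \<epsilon> *\<^sub>R t u)"
  have "\<epsilon> *\<^sub>R t u \<in> BW"
    using \<epsilon> tB[OF u] BW_neg by auto
  then have "u + \<epsilon> *\<^sub>R t u \<in> BW" by (rule BW_add[OF u])
  moreover have "t (u + \<epsilon> *\<^sub>R t u) = \<epsilon> *\<^sub>R (u + \<epsilon> *\<^sub>R t u)"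
    using \<epsilon> by (auto simp: l tt algebra_simps linear_diff[OF lt])
  ultimately have "u + \<epsilon> *\<^sub>R t u \<in> ?W"
    unfolding rat_span_def by (intro rat_mod.span_base) (simp add: eigenlattice_def)
  then have yW: "?y \<in> ?W"
    using rat_mod.span_scale[of "u + \<epsilon> *\<^sub>R t u" _ "1 / 2"] unfolding rat_span_def by (simp add: of_rat_divide)
  have W: "t x = \<epsilon> *\<^sub>R x" if "x \<in> ?W" for x
    using that unfolding rat_span_def
  proof (induction rule: rat_mod.span_induct_alt)
    case base
    then show ?case using linear_0[OF lt] by simp
  next
    case (step c x y)
    then show ?case by (simp add: l eigenlattice_def algebra_simps)
  qed
  have orth: "(u - ?y) \<bullet> x = 0" if "x \<in> ?W" for x
  proof -
    have "t u \<bullet> t x = u \<bullet> x" using ot by (simp add: orthogonal_transformation_def)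
    then have "\<epsilon> * (t u \<bullet> x) = u \<bullet> x" using W[OF that] by simp
    then show ?thesis by (simp add: inner_diff_left inner_add_left)
  qed
  have diff: "x - y \<in> ?W" if "x \<in> ?W" "y \<in> ?W" for x y
    using that unfolding rat_span_def by (rule rat_mod.span_diff)
  show ?thesis
    unfolding eigenproj_def orth_proj_def
  proof (rule the_equality)
    show "?y \<in> ?W \<and> (\<forall>w\<in>?W. bw_inner (u - ?y) w = 0)"
      using yW orth by (simp add: bw_inner_def)
    fix y assume y: "y \<in> ?W \<and> (\<forall>w\<in>?W. bw_inner (u - y) w = 0)"
    then have "(u - y) \<bullet> (?y - y) = 0" using diff[OF yW, of y] by (simp add: bw_inner_def)
    moreover have "(u - ?y) \<bullet> (?y - y) = 0" using orth diff[OF yW, of y] y by blast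
    ultimately have "((u - y) - (u - ?y)) \<bullet> (?y - y) = 0" by (simp add: inner_diff_left)
    then have "(?y - y) \<bullet> (?y - y) = 0" by simp
    then show "y = ?y" by simp
  qed
qed

section \<open>Minimal vectors and the conclusion\<close>

lemma minimal_vector_iff:
  assumes low: "\<And>w. w \<in> L \<Longrightarrow> w \<noteq> 0 \<Longrightarrow> c \<le> w \<bullet> w" and att: "w \<in> L" "w \<bullet> w = c" "0 < c" and v: "v \<in> L"
  shows "minimal_vector L v \<longleftrightarrow> v \<bullet> v = c"
proof
  assume m: "minimal_vector L v"
  have "w \<noteq> 0" using att by auto
  then have "v \<bullet> v \<le> c" using m att by (auto simp: minimal_vector_def bw_inner_def)
  then show "v \<bullet> v = c" using low[OF v] m by (auto simp: minimal_vector_def)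
next
  assume "v \<bullet> v = c"
  then show "minimal_vector L v"
    using low v att by (auto simp: minimal_vector_def bw_inner_def)
qed

theorem theorem3p9:
  fixes G :: "('n::finite ambient \<Rightarrow> 'n ambient) set"
    and t f :: "'n ambient \<Rightarrow> 'n ambient"
    and L M :: "'n ambient set"
    and d k \<delta> :: nat
    and \<epsilon> :: real
  assumes d_def: "d = CARD('n)"
    and d_odd: "odd d"
    and k_ge: "k \<ge> 1"
    and d_ge: "int d - 2 * int k \<ge> 3"
    and \<delta>_def: "\<delta> = (d - 1) div 2"
    and L_def: "L = BW"
    and G: "is_BRW_group G"
    and t_in: "t \<in> G"
    and t_invol: "involution t"
    and t_defect: "has_defect t k"
    and t_trace: "trace (matrix t) > 0"
    and f_in: "f \<in> RR"
    and f_four: "fourvolution f"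
    and f_comm: "f \<circ> t = t \<circ> f"
    and \<epsilon>: "\<epsilon> \<in> {1, -1}"
    and M_def: "M = M_lattice L \<epsilon> t f"
  shows "has_min_norm M (2 ^ (\<delta> - 1)) \<and>
         (\<forall>v \<in> M.
           (minimal_vector M v \<longleftrightarrow> minimal_vector (eigenlattice L \<epsilon> t) (f v - v)) \<and>
           (minimal_vector (eigenlattice L \<epsilon> t) (f v - v) \<longleftrightarrow>
              minimal_vector L (f v - v) \<and> f v - v \<in> eigenlattice L \<epsilon> t)) \<and>
         (\<forall>v. minimal_vector M v \<longrightarrow> v \<in> M - eigenlattice L \<epsilon> t)"
proof -
  have gOV: "group OV" by (rule group_OV)
  have Gsub: "subgroup G OV" and Giso: "G \<subseteq> lattice_isometries BW" and nor: "RR \<lhd> OV\<lparr>carrier := G\<rparr>"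
    using G by (auto simp: is_BRW_group_def normal_2_subgroup_def)
  have RG: "RR \<subseteq> G"
    using normal_imp_subgroup[OF nor] subgroup.subset by fastforce
  have ot: "orthogonal_transformation t" and tBW: "t ` BW = BW"
    using t_in Giso by (auto simp: lattice_isometries_def OV_def)
  have lt: "linear t" using ot by (simp add: orthogonal_transformation_def)
  have tt: "t (t x) = x" for x using t_invol by (metis involution_def comp_apply id_apply)
  have inv: "inv\<^bsub>OV\<^esub> t = t" by (rule inv_OV[OF ot tt])
  have t_norm: "(\<lambda>x. t (r (t x))) \<in> RR" if r: "r \<in> RR" for r
  proof -
    have "inv\<^bsub>OV\<lparr>carrier := G\<rparr>\<^esub> t \<otimes>\<^bsub>OV\<lparr>carrier := G\<rparr>\<^esub> r \<otimes>\<^bsub>OV\<lparr>carrier := G\<rparr>\<^esub> t \<in> RR"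
      using normal.inv_op_closed1[OF nor _ r, of t] t_in by simp
    then show ?thesis
      using group.m_inv_consistent[OF gOV Gsub t_in] by (simp add: inv) (simp add: OV_def comp_def)
  qed
  have clean: "\<exists>x. t (q (t x)) \<noteq> - q x" if "q \<in> RR" for q
    using trace_zero[OF lt tt that] t_trace by force
  have nonscalar: "\<exists>x. t x \<noteq> c *\<^sub>R x" for c
  proof (rule ccontr)
    assume "\<not> ?thesis"
    then have c: "t x = c *\<^sub>R x" for x by blast
    from orthogonal_eigenvalue[OF ot c frame_vector_nonzero[OF frame_vector_v0]] show False
    proof
      assume "c = 1"
      then have "t = id" using c by (simp add: fun_eq_iff)
      then show False using t_invol by (simp add: involution_def)
    next
      assume "c = -1"
      then have "trace (matrix t) = (\<Sum>i\<in>(UNIV :: 'n omega set). - 1)"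
        by (simp add: trace_matrix c)
      also have "\<dots> \<le> 0" by (simp add: sum_nonpos)
      finally show False using t_trace by simp
    qed
  qed
  \<comment> \<open>This is the hypothesis \<open>d - 2 * k \<ge> 3\<close>, rewritten for the
    orders of subgroups of \<open>RR\<close>.\<close>
  have "CARD('n) + 4 \<le> 2 * (CARD('n) - k) + 1"
    using d_ge d_def by linarith
  then have "(2::nat) ^ (CARD('n) + 4) \<le> 2 ^ (2 * (CARD('n) - k) + 1)"
    by (rule power_increasing) simp
  also note card_centralizer_of_defect[OF lt tt inv clean t_defect]
  finally interpret clean_involution t
    by unfold_locales (use ot tt t_norm clean nonscalar in auto)
  have of: "orthogonal_transformation f" and ff: "f (f x) = - x" for x
    using f_four by (auto simp: fourvolution_def fun_eq_iff)
  have lf: "linear f" using of by (simp add: orthogonal_transformation_def)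
  have ft: "f (t x) = t (f x)" for x using f_comm by (metis comp_apply)
  have \<epsilon>': "\<epsilon> = 1 \<or> \<epsilon> = -1" using \<epsilon> by simp
  let ?E = "eigenlattice L \<epsilon> t"
  have proj: "eigenproj L \<epsilon> t u = (1 / 2) *\<^sub>R (u + \<epsilon> *\<^sub>R t u)" if "u \<in> L" for u
    using eigenproj_BW[OF ot tt _ \<epsilon>'] that tBW by (auto simp: L_def)
  \<comment> \<open>An isometry with square -1 makes \<open>f v\<close> orthogonal to
    \<open>v\<close>.\<close>
  have fnorm: "(f v - v) \<bullet> (f v - v) = 2 * (v \<bullet> v)" for v
  proof -
    have "f (f v) \<bullet> f v = f v \<bullet> v" and n: "f v \<bullet> f v = v \<bullet> v"
      using of by (simp_all add: orthogonal_transformation_def)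
    then have "f v \<bullet> v = 0" by (simp add: ff inner_commute)
    then show ?thesis using n by (simp add: inner_diff_left inner_diff_right inner_commute)
  qed
  have f_M: "f v - v \<in> ?E" if "v \<in> M" for v
  proof -
    obtain x u where x: "x \<in> L" "t x = \<epsilon> *\<^sub>R x" and u: "u \<in> L"
      and v: "v = x + (f ((1 / 2) *\<^sub>R (u + \<epsilon> *\<^sub>R t u)) - (1 / 2) *\<^sub>R (u + \<epsilon> *\<^sub>R t u))"
      using \<open>v \<in> M\<close> proj by (auto simp: M_def M_lattice_def eigenlattice_def)
    let ?s = "u + \<epsilon> *\<^sub>R t u"
    have "t u \<in> BW" using u tBW by (auto simp: L_def)
    then have s: "?s \<in> BW" using u BW_add[of u "t u"] BW_diff[of u "t u"] \<epsilon>' by (auto simp: L_def)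
    have ts: "t ?s = \<epsilon> *\<^sub>R ?s"
      using \<epsilon>' by (auto simp: linear_add[OF lt] linear_diff[OF lt] linear_cmul[OF lt] tt)
    \<comment> \<open>The factor 2 in \<open>(f - 1)^2 = -2 f\<close> clears the one half in the
      projection.\<close>
    have eq: "f v - v = (f x - x) - f ?s"
    proof -
      have "f v - v = (f x - x) + (f (f ((1 / 2) *\<^sub>R ?s)) - f ((1 / 2) *\<^sub>R ?s) - f ((1 / 2) *\<^sub>R ?s) + (1 / 2) *\<^sub>R ?s)"
        by (simp add: v linear_add[OF lf] linear_diff[OF lf])
      also have "\<dots> = (f x - x) - 2 *\<^sub>R f ((1 / 2) *\<^sub>R ?s)"
        unfolding ff by (simp add: scaleR_2)
      also have "2 *\<^sub>R f ((1 / 2) *\<^sub>R ?s) = f ?s"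
        unfolding linear_cmul[OF lf] by simp
      finally show ?thesis .
    qed
    have "f v - v \<in> BW"
      unfolding eq using x s RR_BW[OF f_in] by (auto simp: L_def intro!: BW_diff[OF BW_diff])
    moreover have "t (f v - v) = \<epsilon> *\<^sub>R (f v - v)"
      unfolding eq
      by (simp only: linear_diff[OF lt] ft[symmetric] x(2) ts linear_cmul[OF lf] scaleR_diff_right)
    ultimately show ?thesis by (simp add: eigenlattice_def L_def)
  qed
  have odd: "odd CARD('n)" using d_odd d_def by simp
  have lowL: "1 \<le> w \<bullet> w" if "w \<in> L" "w \<noteq> 0" for w
    using BW_min_norm[OF _ odd] that by (simp add: L_def)
  have lowE: "1 \<le> w \<bullet> w" if "w \<in> ?E" "w \<noteq> 0" for w
    using lowL that by (simp add: eigenlattice_def)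
  have lowM: "1 / 2 \<le> w \<bullet> w" if "w \<in> M" "w \<noteq> 0" for w
  proof -
    have "f w - w \<noteq> 0" using fnorm[of w] that(2) by auto
    then show ?thesis using lowE[OF f_M[OF that(1)]] fnorm[of w] by simp
  qed
  obtain a u x where a: "a \<bullet> a = 1" and ux: "u \<in> BW" "x \<in> BW" "t x = \<epsilon> *\<^sub>R x"
    and eq: "x + (f ((1 / 2) *\<^sub>R (u + \<epsilon> *\<^sub>R t u)) - (1 / 2) *\<^sub>R (u + \<epsilon> *\<^sub>R t u)) = (1 / 2) *\<^sub>R (f a - a)"
    by (rule exists_half_vector[OF f_in ft \<epsilon>'])
  define v where "v = (1 / 2) *\<^sub>R (f a - a)"
  have vM: "v \<in> M"
  proof -
    have "x \<in> ?E" using ux by (simp add: eigenlattice_def L_def)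
    moreover have "(1 / 2) *\<^sub>R (u + \<epsilon> *\<^sub>R t u) \<in> eigenproj L \<epsilon> t ` L"
      using proj[of u] ux(1) by (metis L_def image_eqI)
    ultimately show ?thesis unfolding M_def M_lattice_def v_def using eq by force
  qed
  have vv: "v \<bullet> v = 1 / 2"
    using fnorm[of a] a by (simp add: v_def)
  have fv: "f v - v \<in> ?E" "(f v - v) \<bullet> (f v - v) = 1"
    using f_M[OF vM] fnorm[of v] vv by simp_all
  have EL: "?E \<subseteq> L" by (auto simp: eigenlattice_def)
  have minM: "minimal_vector M y \<longleftrightarrow> y \<bullet> y = 1 / 2" if "y \<in> M" for y
    using minimal_vector_iff[OF lowM vM vv _ that] by simp
  have minE: "minimal_vector ?E y \<longleftrightarrow> y \<bullet> y = 1" if "y \<in> ?E" for y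
    using minimal_vector_iff[OF lowE fv _ that] by simp
  have minL: "minimal_vector L y \<longleftrightarrow> y \<bullet> y = 1" if "y \<in> L" for y
    using minimal_vector_iff[OF lowL _ fv(2) _ that] EL fv(1) by auto
  \<comment> \<open>\<open>bw_inner\<close> is \<open>2 ^ \<delta>\<close> times the standard
    product, so the norms 1 and 1/2 found above become \<open>2 ^ \<delta>\<close> and
    \<open>2 ^ (\<delta> - 1)\<close>. As \<open>d \<ge> 5\<close>, the natural subtraction in
    \<open>\<delta> - 1\<close> does not truncate.\<close>
  have d2: "CARD('n) div 2 = Suc (\<delta> - 1)"
    using \<delta>_def d_def d_odd d_ge k_ge by (auto elim!: oddE)
  have half: "bw_inner y z = 2 ^ (\<delta> - 1) * (2 * (y \<bullet> z))" for y z :: "'n ambient"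
    by (simp add: bw_inner_def d2)
  have "has_min_norm M (2 ^ (\<delta> - 1))"
    unfolding has_min_norm_def half
  proof (intro conjI bexI ballI)
    show "v \<in> M - {0}" using vM vv by auto
    show "2 ^ (\<delta> - 1) * (2 * (v \<bullet> v)) = 2 ^ (\<delta> - 1)" using vv by simp
    fix w assume "w \<in> M - {0}"
    then have "1 \<le> 2 * (w \<bullet> w)" using lowM[of w] by simp
    then show "2 ^ (\<delta> - 1) \<le> 2 ^ (\<delta> - 1) * (2 * (w \<bullet> w))" by simp
  qed
  moreover have "(minimal_vector M y \<longleftrightarrow> minimal_vector ?E (f y - y)) \<and>
      (minimal_vector ?E (f y - y) \<longleftrightarrow> minimal_vector L (f y - y) \<and> f y - y \<in> ?E)" if "y \<in> M" for y
    using minM[OF that] minE[OF f_M[OF that]] minL[of "f y - y"] f_M[OF that] EL fnorm[of y] by auto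
  \<comment> \<open>A vector of standard norm 1/2 is too short for the eigenlattice, where nonzero
    vectors have norm at least 1.\<close>
  moreover have "y \<in> M - ?E" if "minimal_vector M y" for y
    using that minM[of y] lowE[of y] by (auto simp: minimal_vector_def)
  ultimately show ?thesis by blast
qed

end
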